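(* The map $\Phi:\mathbb H_B\to\mathbb D_B$ defined by $\Phi(\epsilon_j)=D_j$ and $\Phi(t_w)=t_w$, for $j=1,\dots,n$ and $w\in W_B$, is an isomorphism of algebras. In particular, $\mathbb H_B$ is isomorphic to $S(V_{\mathbb C})\otimes\mathbb C W_B$ as an $S(V_{\mathbb C})$-module.
   Context: Let $n\ge 2$ and let $V$ be a real Euclidean space with orthonormal basis $\epsilon_1,\dots,\epsilon_n$; $V_{\mathbb C}$ is its complexification, $S(V_{\mathbb C})$ the symmetric algebra. Let $R_B=\{\pm\epsilon_i\pm\epsilon_j\ (i<j),\ \pm\epsilon_l\}$ be the root system of type $B_n$, with Weyl group $W_B\subset GL(V)$. For a root $\alpha$, $s_\alpha$ is the reflection and $\alpha^\vee\in V^*$ the coroot, so $s_\alpha(v)=v-\langle\alpha^\vee,v\rangle\alpha$. Put $\alpha_{i,j}=\epsilon_i-\epsilon_j$, $S_A=\{\alpha_i=\epsilon_i-\epsilon_{i+1}:1\le i\le n-1\}$; $W_A\cong\mathfrak S_n$ is the group generated by the $s_{\alpha_{i,j}}$, and $T\cong\{\pm1\}^n$ is the subgroup of $W_B$ generated by the $s_{\epsilon_i}$; $W_B=T\rtimes W_A$. Let $t_w$ ($w\in W_B$) be the standard basis of $\mathbb C W_B$, $t_i=t_{s_{\epsilon_i}}$. Let $\bar k=(k,k_c):R_B\to\mathbb C$ be the function with value $k\ne0$ on long roots and $k_c\in\mathbb C$ on short roots, and put $\tilde k_{\alpha_{i,j}}=k(1+t_it_j)\in\mathbb C T$ for $i\neq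 j$. $\mathbb H_B$ is the unital associative $\mathbb C$-algebra generated by $S(V_{\mathbb C})$ and $\mathbb C W_B$ (each with its own multiplication) subject to: $t_x\zeta=\zeta t_x$ for $x\in T$, $\zeta\in V$; and $t_{s_\alpha}\zeta=s_\alpha(\zeta)t_{s_\alpha}+\langle\alpha^\vee,s_\alpha(\zeta)\rangle\tilde k_\alpha$ for $\alpha\in S_A$, $\zeta\in V$. Realization: let $\mathfrak a_{\mathbb R}$ be a Euclidean space of dimension $n$ with orthonormal basis $e_1,\dots,e_n$, dual basis $z_1,\dots,z_n$ of $\mathfrak a_{\mathbb R}^*$, $\mathfrak a=\mathbb C\otimes\mathfrak a_{\mathbb R}$, and identify $R_B$ with $\{\pm z_i\pm z_j\ (i<j),\pm z_l\}\subset\mathfrak a_{\mathbb R}^*$ (via $\epsilon_i\leftrightarrow z_i$), so that $W_B$ acts on $\mathfrak a^*$. Let $\mathcal P=S(\mathfrak a^* )$ be the algebra of polynomial functions on $\mathfrak a$; for $w\in W_B$ let $t_w$ also denote the algebra automorphism of $\mathcal P$ induced by $w$. For $y\in\mathfrak a$ the Dunkl operator is $$T_y=\partial_y+\tfrac12\sum_{\alpha\in R_B}\bar k_\alpha\frac{\langle\alpha,y\rangle}{\alpha}(1-t_{s_\alpha})\in\operatorname{End}_{\mathbb C}(\mathcal P).$$ $\mathbb D_B$ is the subalgebra of $\operatorname{End}_{\mathbb C}(\mathcal P)$ (contained in the rational Cherednik algebra of type $B_n$, the subalgebra generated by $\mathfrak a^*$, $W_B$ and the $T_y$) generated by the $z_jT_{e_j}$,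 $1\le j\le n$ ($z_j$ acting by multiplication) and the $t_w$, $w\in W_B$. Put $$D_j=z_jT_{e_j}+\sum_{1\le i<j}\tilde k_{\alpha_{i,j}}t_{s_{\alpha_{i,j}}}\in\mathbb D_B .$$ *)

theory Defs
  imports
    "HOL-Analysis.Analysis"
    "HOL-Library.Poly_Mapping"
    "HOL-Algebra.QuotRing"
    "HOL-Algebra.Module"
begin

text \<open>
  The Euclidean space is \<open>real ^ 'n\<close> with orthonormal basis \<open>axis i 1\<close>. The index type is a finite
  linear order, which plays the role of \<open>{1..n}\<close> with \<open>n = CARD('n)\<close>.
\<close>

definition basis_vec :: "'n \<Rightarrow> real ^ 'n" where
  "basis_vec i = axis i 1"

definition long_roots :: "(real ^ 'n::{finite,linorder}) set" where
  "long_roots = {a *\<^sub>R basis_vec i + b *\<^sub>R basis_vec j | a b i j. a \<in> {1, -1} \<and> b \<in> {1, -1} \<and> i < j}"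

definition short_roots :: "(real ^ 'n::{finite,linorder}) set" where
  "short_roots = {a *\<^sub>R basis_vec l | a l. a \<in> {1, -1}}"

definition roots_B :: "(real ^ 'n::{finite,linorder}) set" where
  "roots_B = long_roots \<union> short_roots"

definition coroot :: "'v::real_inner \<Rightarrow> 'v \<Rightarrow> real" where
  "coroot \<alpha> v = 2 * (\<alpha> \<bullet> v) / (\<alpha> \<bullet> \<alpha>)"

definition reflection :: "'v::real_inner \<Rightarrow> 'v \<Rightarrow> 'v" where
  "reflection \<alpha> v = v - coroot \<alpha> v *\<^sub>R \<alpha>"

text \<open>Reflections are involutions, so the monoid they generate is already a group.\<close>

inductive_set reflection_group :: "'v::real_inner set \<Rightarrow> ('v \<Rightarrow> 'v) set" for R where
  id: "id \<in> reflection_group R"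
| refl: "\<alpha> \<in> R \<Longrightarrow> w \<in> reflection_group R \<Longrightarrow> reflection \<alpha> \<circ> w \<in> reflection_group R"

lemma reflection_group_comp:
  assumes "v \<in> reflection_group R" "w \<in> reflection_group R"
  shows "v \<circ> w \<in> reflection_group R"
  using assms by induction (auto simp: comp_assoc intro: reflection_group.intros)

typedef (overloaded) 'n weyl =
  "reflection_group (roots_B :: (real ^ 'n::{finite,linorder}) set)"
  morphisms weyl_fun Abs_weyl
  by (blast intro: reflection_group.id)

setup_lifting type_definition_weyl

text \<open>
  The convolution product on \<open>\<Rightarrow>\<^sub>0\<close> is defined for additively written (not necessarily
  commutative) monoids. Hence the group law of the Weyl group is written \<open>+\<close>,
  and \<open>0\<close> is its neutral element.
\<close>

instantiation weyl :: ("{finite,linorder}") monoid_add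
begin

lift_definition zero_weyl :: "'a weyl" is id
  by (rule reflection_group.id)

lift_definition plus_weyl :: "'a weyl \<Rightarrow> 'a weyl \<Rightarrow> 'a weyl" is "(\<circ>)"
  by (rule reflection_group_comp)

instance
  by standard (transfer, simp add: comp_assoc)+

end

definition weyl_refl :: "real ^ 'n::{finite,linorder} \<Rightarrow> 'n weyl" where
  "weyl_refl \<alpha> = Abs_weyl (reflection \<alpha>)"

definition sign_group :: "'n::{finite,linorder} weyl set" where
  "sign_group = {x. weyl_fun x \<in> reflection_group (range basis_vec)}"

text \<open>
  The symmetric algebra of the complexification of \<open>real ^ 'n\<close> is the algebra of polynomials
  in the basis vectors. The same type serves for the algebra of polynomial functions on
  \<open>complex ^ 'n\<close>, its variables being then the coordinates.
\<close>

type_synonym 'n sym_alg = "('n \<Rightarrow>\<^sub>0 nat) \<Rightarrow>\<^sub>0 complex"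
type_synonym 'n grp_alg = "'n weyl \<Rightarrow>\<^sub>0 complex"

definition cscale :: "complex \<Rightarrow> ('a \<Rightarrow>\<^sub>0 complex) \<Rightarrow> ('a \<Rightarrow>\<^sub>0 complex)" where
  "cscale c f = Poly_Mapping.map ((*) c) f"

definition lin_elem :: "real ^ 'n \<Rightarrow> 'n::finite sym_alg" where
  "lin_elem v = (\<Sum>i\<in>UNIV. Poly_Mapping.single (Poly_Mapping.single i 1) (complex_of_real (v $ i)))"

definition grp :: "'n weyl \<Rightarrow> 'n::{finite,linorder} grp_alg" where
  "grp w = Poly_Mapping.single w 1"

definition t_refl :: "real ^ 'n::{finite,linorder} \<Rightarrow> 'n grp_alg" where
  "t_refl \<alpha> = grp (weyl_refl \<alpha>)"

definition ktilde :: "complex \<Rightarrow> 'n \<Rightarrow> 'n \<Rightarrow> 'n::{finite,linorder} grp_alg" where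
  "ktilde k i j = cscale k (1 + t_refl (basis_vec i) * t_refl (basis_vec j))"

text \<open>
  A complex algebra is a \<open>(complex, 'a) module\<close> record; the locale \<open>algebra\<close> of the library
  covers commutative algebras only.
\<close>

definition alg_hom ::
  "(complex, 'a, 'c) module_scheme \<Rightarrow> (complex, 'b, 'd) module_scheme \<Rightarrow> ('a \<Rightarrow> 'b) set" where
  "alg_hom A B = {h \<in> ring_hom A B. \<forall>c. \<forall>x\<in>carrier A. h (c \<odot>\<^bsub>A\<^esub> x) = c \<odot>\<^bsub>B\<^esub> h x}"

definition alg_iso ::
  "(complex, 'a, 'c) module_scheme \<Rightarrow> (complex, 'b, 'd) module_scheme \<Rightarrow> ('a \<Rightarrow> 'b) set" where
  "alg_iso A B = {h \<in> alg_hom A B. bij_betw h (carrier A) (carrier B)}"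

definition module_iso ::
  "('r, 'q) ring_scheme \<Rightarrow> ('r, 'a, 'c) module_scheme \<Rightarrow> ('r, 'b, 'd) module_scheme \<Rightarrow> ('a \<Rightarrow> 'b) set"
  where
  "module_iso R M N = {h. bij_betw h (carrier M) (carrier N) \<and>
     (\<forall>x\<in>carrier M. \<forall>y\<in>carrier M. h (x \<oplus>\<^bsub>M\<^esub> y) = h x \<oplus>\<^bsub>N\<^esub> h y) \<and>
     (\<forall>r\<in>carrier R. \<forall>x\<in>carrier M. h (r \<odot>\<^bsub>M\<^esub> x) = r \<odot>\<^bsub>N\<^esub> h x)}"

inductive_set subalg_gen :: "(complex, 'a, 'c) module_scheme \<Rightarrow> 'a set \<Rightarrow> 'a set" for A and X where
  one: "\<one>\<^bsub>A\<^esub> \<in> subalg_gen A X"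
| gen: "x \<in> X \<Longrightarrow> x \<in> subalg_gen A X"
| add: "x \<in> subalg_gen A X \<Longrightarrow> y \<in> subalg_gen A X \<Longrightarrow> x \<oplus>\<^bsub>A\<^esub> y \<in> subalg_gen A X"
| mult: "x \<in> subalg_gen A X \<Longrightarrow> y \<in> subalg_gen A X \<Longrightarrow> x \<otimes>\<^bsub>A\<^esub> y \<in> subalg_gen A X"
| smult: "x \<in> subalg_gen A X \<Longrightarrow> c \<odot>\<^bsub>A\<^esub> x \<in> subalg_gen A X"

definition type_ring :: "'a::ring_1 ring" where
  "type_ring = \<lparr>carrier = UNIV, mult = (*), one = 1, zero = 0, add = (+)\<rparr>"

definition with_smult :: "'a ring \<Rightarrow> ('r \<Rightarrow> 'a \<Rightarrow> 'a) \<Rightarrow> ('r, 'a) module" where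
  "with_smult R s = ring.extend R (module.fields s)"

text \<open>Words, i.e. the free monoid, again written additively.\<close>

datatype 'g word = Word "'g list"

instantiation word :: (type) monoid_add
begin

definition zero_word :: "'a word" where
  "zero_word = Word []"

fun plus_word :: "'a word \<Rightarrow> 'a word \<Rightarrow> 'a word" where
  "plus_word (Word u) (Word v) = Word (u @ v)"

instance
proof
  fix a b c :: "'a word"
  show "a + b + c = a + (b + c)" by (cases a; cases b; cases c) simp
  show "0 + a = a" by (cases a) (simp add: zero_word_def)
  show "a + 0 = a" by (cases a) (simp add: zero_word_def)
qed

end

type_synonym 'g free_alg = "'g word \<Rightarrow>\<^sub>0 complex"

text \<open>
  The algebra generated by the symmetric algebra and the group algebra (each with its own
  multiplication) is obtained from the free algebra on the disjoint union of their elements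
  by forcing both embeddings to be homomorphisms of unital algebras.
\<close>

type_synonym 'n pre_HB = "('n sym_alg + 'n grp_alg) free_alg"

definition gen_S :: "'n sym_alg \<Rightarrow> 'n::{finite,linorder} pre_HB" where
  "gen_S p = Poly_Mapping.single (Word [Inl p]) 1"

definition gen_W :: "'n grp_alg \<Rightarrow> 'n::{finite,linorder} pre_HB" where
  "gen_W a = Poly_Mapping.single (Word [Inr a]) 1"

definition hom_relations ::
  "(('a::monoid_add \<Rightarrow>\<^sub>0 complex) \<Rightarrow> ('b::monoid_add \<Rightarrow>\<^sub>0 complex)) \<Rightarrow> ('b \<Rightarrow>\<^sub>0 complex) set" where
  "hom_relations \<iota> =
     {\<iota> 1 - 1} \<union>
     {\<iota> (x + y) - (\<iota> x + \<iota> y) | x y. True} \<union>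
     {\<iota> (cscale c x) - cscale c (\<iota> x) | c x. True} \<union>
     {\<iota> (x * y) - \<iota> x * \<iota> y | x y. True}"

definition cross_relations :: "complex \<Rightarrow> 'n::{finite,linorder} pre_HB set" where
  "cross_relations k =
     {gen_W (grp x) * gen_S (lin_elem \<zeta>) - gen_S (lin_elem \<zeta>) * gen_W (grp x) | x \<zeta>. x \<in> sign_group} \<union>
     {let \<alpha> = basis_vec i - basis_vec j in
        gen_W (t_refl \<alpha>) * gen_S (lin_elem \<zeta>)
        - (gen_S (lin_elem (reflection \<alpha> \<zeta>)) * gen_W (t_refl \<alpha>)
           + cscale (complex_of_real (coroot \<alpha> (reflection \<alpha> \<zeta>))) (gen_W (ktilde k i j)))
      | i j \<zeta>. i < j \<and> (\<forall>l. \<not> (i < l \<and> l < j))}"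

definition HB_ideal :: "complex \<Rightarrow> 'n::{finite,linorder} pre_HB set" where
  "HB_ideal k = genideal type_ring
     (hom_relations gen_S \<union> hom_relations gen_W \<union> cross_relations k)"

definition HB_ring :: "complex \<Rightarrow> ('n::{finite,linorder} pre_HB set) ring" where
  "HB_ring k = type_ring Quot HB_ideal k"

definition HB_class :: "complex \<Rightarrow> 'n pre_HB \<Rightarrow> 'n::{finite,linorder} pre_HB set" where
  "HB_class k x = HB_ideal k +>\<^bsub>type_ring\<^esub> x"

definition HB :: "complex \<Rightarrow> (complex, 'n::{finite,linorder} pre_HB set) module" where
  "HB k = with_smult (HB_ring k) (\<lambda>c X. HB_class k (cscale c 1) \<otimes>\<^bsub>HB_ring k\<^esub> X)"

definition HB_eps :: "complex \<Rightarrow> 'n \<Rightarrow> 'n::{finite,linorder} pre_HB set" where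
  "HB_eps k j = HB_class k (gen_S (lin_elem (basis_vec j)))"

definition HB_t :: "complex \<Rightarrow> 'n weyl \<Rightarrow> 'n::{finite,linorder} pre_HB set" where
  "HB_t k w = HB_class k (gen_W (grp w))"

definition HB_S_module :: "complex \<Rightarrow> ('n sym_alg, 'n::{finite,linorder} pre_HB set) module" where
  "HB_S_module k = with_smult (HB_ring k) (\<lambda>p X. HB_class k (gen_S p) \<otimes>\<^bsub>HB_ring k\<^esub> X)"

text \<open>
  The quotient of the vector space with basis the set of pairs by the span of the bilinearity
  relations. The left factor acts on itself by multiplication; as only this module structure
  is used, the ring multiplication fields of the record are left unspecified.
\<close>

inductive_set tensor_null ::
  "((('a \<Rightarrow>\<^sub>0 complex) \<times> ('b \<Rightarrow>\<^sub>0 complex)) \<Rightarrow>\<^sub>0 complex) set" where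
  zero: "0 \<in> tensor_null"
| add: "f \<in> tensor_null \<Longrightarrow> g \<in> tensor_null \<Longrightarrow> f + g \<in> tensor_null"
| scale: "f \<in> tensor_null \<Longrightarrow> cscale c f \<in> tensor_null"
| add_left: "Poly_Mapping.single (x + x', y) 1 - Poly_Mapping.single (x, y) 1
     - Poly_Mapping.single (x', y) 1 \<in> tensor_null"
| add_right: "Poly_Mapping.single (x, y + y') 1 - Poly_Mapping.single (x, y) 1
     - Poly_Mapping.single (x, y') 1 \<in> tensor_null"
| scale_left: "Poly_Mapping.single (cscale c x, y) 1 - Poly_Mapping.single (x, y) c \<in> tensor_null"
| scale_right: "Poly_Mapping.single (x, cscale c y) 1 - Poly_Mapping.single (x, y) c \<in> tensor_null"

definition tensor_rel ::
  "(((('a \<Rightarrow>\<^sub>0 complex) \<times> ('b \<Rightarrow>\<^sub>0 complex)) \<Rightarrow>\<^sub>0 complex) \<times>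
    ((('a \<Rightarrow>\<^sub>0 complex) \<times> ('b \<Rightarrow>\<^sub>0 complex)) \<Rightarrow>\<^sub>0 complex)) set" where
  "tensor_rel = {(f, g). f - g \<in> tensor_null}"

definition tensor_act ::
  "('a::monoid_add \<Rightarrow>\<^sub>0 complex) \<Rightarrow> ((('a \<Rightarrow>\<^sub>0 complex) \<times> ('b \<Rightarrow>\<^sub>0 complex)) \<Rightarrow>\<^sub>0 complex)
    \<Rightarrow> ((('a \<Rightarrow>\<^sub>0 complex) \<times> ('b \<Rightarrow>\<^sub>0 complex)) \<Rightarrow>\<^sub>0 complex)" where
  "tensor_act p f = (\<Sum>(x, y)\<in>Poly_Mapping.keys f.
     Poly_Mapping.single (p * x, y) (Poly_Mapping.lookup f (x, y)))"

definition tensor ::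
  "('a::monoid_add \<Rightarrow>\<^sub>0 complex, ((('a \<Rightarrow>\<^sub>0 complex) \<times> ('b \<Rightarrow>\<^sub>0 complex)) \<Rightarrow>\<^sub>0 complex) set) module"
  where
  "tensor = \<lparr>carrier = UNIV // tensor_rel, mult = undefined, one = undefined,
     zero = tensor_rel `` {0},
     add = \<lambda>X Y. \<Union>f\<in>X. \<Union>g\<in>Y. tensor_rel `` {f + g},
     smult = \<lambda>p X. \<Union>f\<in>X. tensor_rel `` {tensor_act p f}\<rparr>"

definition subst :: "('n \<Rightarrow> 'n sym_alg) \<Rightarrow> 'n::finite sym_alg \<Rightarrow> 'n sym_alg" where
  "subst \<phi> p = (\<Sum>m\<in>Poly_Mapping.keys p.
     cscale (Poly_Mapping.lookup p m) (\<Prod>i\<in>UNIV. \<phi> i ^ Poly_Mapping.lookup m i))"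

definition lin_act :: "(real ^ 'n \<Rightarrow> real ^ 'n) \<Rightarrow> 'n::finite sym_alg \<Rightarrow> 'n sym_alg" where
  "lin_act g = subst (\<lambda>i. lin_elem (g (basis_vec i)))"

definition weyl_act :: "'n weyl \<Rightarrow> 'n::{finite,linorder} sym_alg \<Rightarrow> 'n sym_alg" where
  "weyl_act w = lin_act (weyl_fun w)"

definition grp_alg_act :: "'n grp_alg \<Rightarrow> 'n::{finite,linorder} sym_alg \<Rightarrow> 'n sym_alg" where
  "grp_alg_act a p = (\<Sum>w\<in>Poly_Mapping.keys a. cscale (Poly_Mapping.lookup a w) (weyl_act w p))"

definition partial :: "'n \<Rightarrow> 'n::finite sym_alg \<Rightarrow> 'n sym_alg" where
  "partial i p = (\<Sum>m\<in>Poly_Mapping.keys p. Poly_Mapping.single (m - Poly_Mapping.single i 1)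
     (of_nat (Poly_Mapping.lookup m i) * Poly_Mapping.lookup p m))"

definition dir_deriv :: "complex ^ 'n \<Rightarrow> 'n::finite sym_alg \<Rightarrow> 'n sym_alg" where
  "dir_deriv y p = (\<Sum>i\<in>UNIV. cscale (y $ i) (partial i p))"

definition pairing :: "real ^ 'n \<Rightarrow> complex ^ 'n \<Rightarrow> complex" where
  "pairing \<alpha> y = (\<Sum>i\<in>UNIV. complex_of_real (\<alpha> $ i) * y $ i)"

definition kbar :: "complex \<Rightarrow> complex \<Rightarrow> real ^ 'n::{finite,linorder} \<Rightarrow> complex" where
  "kbar k kc \<alpha> = (if \<alpha> \<in> long_roots then k else kc)"

text \<open>The quotient of \<open>p - t\<^sub>s p\<close> by the linear form \<open>\<alpha>\<close>, which exists and is unique for a root \<open>\<alpha>\<close>.\<close>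

definition div_diff :: "real ^ 'n::{finite,linorder} \<Rightarrow> 'n sym_alg \<Rightarrow> 'n sym_alg" where
  "div_diff \<alpha> p = (THE q. lin_elem \<alpha> * q = p - weyl_act (weyl_refl \<alpha>) p)"

definition dunkl :: "complex \<Rightarrow> complex \<Rightarrow> complex ^ 'n::{finite,linorder} \<Rightarrow>
    'n sym_alg \<Rightarrow> 'n sym_alg" where
  "dunkl k kc y p = dir_deriv y p
     + cscale (1 / 2) (\<Sum>\<alpha>\<in>roots_B. cscale (kbar k kc \<alpha> * pairing \<alpha> y) (div_diff \<alpha> p))"

definition zT :: "complex \<Rightarrow> complex \<Rightarrow> 'n \<Rightarrow> 'n::{finite,linorder} sym_alg \<Rightarrow> 'n sym_alg" where
  "zT k kc j p = lin_elem (basis_vec j) * dunkl k kc (axis j 1) p"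

definition End_P :: "(complex, 'n::{finite,linorder} sym_alg \<Rightarrow> 'n sym_alg) module" where
  "End_P = \<lparr>carrier = {f. (\<forall>p q. f (p + q) = f p + f q) \<and> (\<forall>c p. f (cscale c p) = cscale c (f p))},
     mult = (\<circ>), one = id, zero = (\<lambda>_. 0), add = (\<lambda>f g p. f p + g p),
     smult = (\<lambda>c f p. cscale c (f p))\<rparr>"

definition DB :: "complex \<Rightarrow> complex \<Rightarrow>
    (complex, 'n::{finite,linorder} sym_alg \<Rightarrow> 'n sym_alg) module" where
  "DB k kc = End_P\<lparr>carrier := subalg_gen End_P (range (zT k kc) \<union> range weyl_act)\<rparr>"

definition D_op :: "complex \<Rightarrow> complex \<Rightarrow> 'n \<Rightarrow> 'n::{finite,linorder} sym_alg \<Rightarrow> 'n sym_alg" where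
  "D_op k kc j p = zT k kc j p
     + (\<Sum>i\<in>{..<j}. grp_alg_act (ktilde k i j * t_refl (basis_vec i - basis_vec j)) p)"

end

theory Submission imports Defs begin

text \<open>
  The map \<open>\<Phi>\<close> is obtained from the universal property of the presented algebra, and three things have to
  be seen: the defining relations hold for the operators \<open>D\<^sub>j\<close> and \<open>t\<^sub>w\<close>, the products \<open>p t\<^sub>w\<close> with \<open>p\<close> in
  the symmetric algebra span the presented algebra, and the operators \<open>p(D) t\<^sub>w\<close> are linearly independent.
  The last two statements give injectivity of \<open>\<Phi>\<close> and the tensor product decomposition at the same time.
  Surjectivity is clear, since \<open>z\<^sub>j T\<^sub>j\<close> differs from \<open>D\<^sub>j\<close> by an element of the group algebra.

  Relations. The commutator of a Dunkl operator \<open>T\<^sub>u\<close> with the multiplication by a linear form \<open>v\<close> is an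
  element of the group algebra that is symmetric in \<open>u\<close> and \<open>v\<close>. By the Jacobi identity the commutator
  \<open>[T\<^sub>u, T\<^sub>v]\<close> then commutes with all multiplications, and as it kills \<open>1\<close> it vanishes (\<open>Y_commute\<close>).
  The same formula for \<open>[T\<^sub>i, z\<^sub>j]\<close> yields \<open>[A\<^sub>i, A\<^sub>j] = (A\<^sub>j - A\<^sub>i) B\<^sub>i\<^sub>j\<close> for
  \<open>A\<^sub>i = z\<^sub>i T\<^sub>i\<close> and \<open>B\<^sub>i\<^sub>j = k (1 + t\<^sub>i t\<^sub>j) s\<^sub>i\<^sub>j\<close> (\<open>A_commutator\<close>). The elements
  \<open>B\<^sub>i\<^sub>j\<close> permute the \<open>A\<^sub>l\<close> and satisfy braid-like relations, and from this alone it follows that the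
  \<open>D\<^sub>j = A\<^sub>j + \<Sum>i<j. B\<^sub>i\<^sub>j\<close> commute (\<open>commuting_sums\<close>). The cross relations are a short
  computation (\<open>W_sigma_D\<close>, \<open>W_tau_D\<close>).

  Spanning. A simple reflection can be moved past a polynomial at the cost of a term with \<open>k (1 + t\<^sub>i t\<^sub>j)\<close>,
  which commutes with polynomials (\<open>sigma_straighten\<close>, \<open>HB_normal_form\<close>).

  Independence. Fix a point with trivial stabilizer in the Weyl group. On a polynomial that vanishes to
  order \<open>r\<close> along its orbit, \<open>D\<^sub>j\<close> agrees with \<open>z\<^sub>j \<partial>\<^sub>j\<close> up to polynomials that also vanish to order \<open>r\<close>:
  roots are invertible near the orbit, so divided differences do not lower the order. Hence \<open>p(D) t\<^sub>w\<close>,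
  applied to a test polynomial that vanishes to order \<open>deg p\<close> along the orbit and to a higher order away from
  one chosen point of it, reads off a single top-degree coefficient of \<open>p\<close> for a single \<open>w\<close>
  (\<open>D_word_leading\<close>, \<open>ex_test_function\<close>, \<open>D_poly_W_op_independent\<close>).
\<close>

section \<open>Linear extensions and algebra maps\<close>

abbreviation (input) lookup where "lookup \<equiv> Poly_Mapping.lookup"

abbreviation (input) single where "single \<equiv> Poly_Mapping.single"

abbreviation scal :: "complex \<Rightarrow> ('m::monoid_add \<Rightarrow>\<^sub>0 complex)" where
  "scal \<equiv> single 0"

definition var :: "'n \<Rightarrow> 'n sym_alg" where
  "var i \<equiv> single (single i 1) 1"

lemma cscale_eq_mult: "cscale c f = scal c * f"
  unfolding cscale_def by (rule mult_map_scale_conv_mult)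

lemma poly_mapping_add_induct [case_names single add]:
  fixes f :: "'m \<Rightarrow>\<^sub>0 'c::comm_monoid_add"
  assumes "\<And>m c. P (single m c)" and "\<And>x y. P x \<Longrightarrow> P y \<Longrightarrow> P (x + y)"
  shows "P f"
proof -
  have eq: "f = (\<Sum>m\<in>Poly_Mapping.keys f. single m (lookup f m))"
    by (rule poly_mapping_eqI) (simp add: lookup_sum lookup_single when_def in_keys_iff)
  have "P (\<Sum>m\<in>A. single m (g m))" if "finite A" for A and g :: "'m \<Rightarrow> 'c"
    using that
  proof induction
    case empty
    show ?case using assms(1)[of undefined 0] by simp
  qed (simp add: assms)
  then show ?thesis by (subst eq) simp
qed

lemma scal_central: "scal c * f = f * scal c"
  by (induction f rule: poly_mapping_add_induct) (simp_all add: mult_single distrib_left distrib_right mult.commute)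

text \<open>A unital complex algebra, given by its structure map; it need not be commutative. The instances below
  are the convolution algebras and the endomorphism ring of the polynomials.\<close>

locale complex_scalars =
  fixes sc :: "complex \<Rightarrow> 'r::ring_1"
  assumes sc_add: "sc (a + b) = sc a + sc b"
    and sc_mult: "sc (a * b) = sc a * sc b"
    and sc_one: "sc 1 = 1"
    and sc_central: "sc c * x = x * sc c"
begin

lemma sc_zero: "sc 0 = 0"
  using sc_add[of 0 0] by simp

lemma sc_diff: "sc (a - b) = sc a - sc b"
  using sc_add[of "a - b" b] by simp

end

interpretation scal: complex_scalars "scal :: complex \<Rightarrow> ('m::monoid_add \<Rightarrow>\<^sub>0 complex)"
  by unfold_locales (simp_all add: single_add mult_single scal_central)

locale alg_map = complex_scalars sc for sc :: "complex \<Rightarrow> 'r::ring_1" +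
  fixes h :: "('m::monoid_add \<Rightarrow>\<^sub>0 complex) \<Rightarrow> 'r"
  assumes add: "h (x + y) = h x + h y"
    and mult: "h (x * y) = h x * h y"
    and scal: "h (scal c) = sc c"
begin

lemma one: "h 1 = 1"
  using scal[of 1] sc_one by simp

lemma zero: "h 0 = 0"
  using add[of 0 0] by simp

lemma minus: "h (- x) = - h x"
  using add[of x "- x"] by (simp add: zero eq_neg_iff_add_eq_0 add.commute)

lemma diff: "h (x - y) = h x - h y"
  using add[of x "- y"] by (simp add: minus)

lemma cscale: "h (cscale c x) = sc c * h x"
  by (simp add: cscale_eq_mult mult scal)

lemma sum: "h (\<Sum>i\<in>A. f i) = (\<Sum>i\<in>A. h (f i))"
  by (induction A rule: infinite_finite_induct) (simp_all add: zero add)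

lemma power: "h (x ^ n) = h x ^ n"
  by (induction n) (simp_all add: one mult)

end

definition lin_ext :: "(complex \<Rightarrow> 'r::ring_1) \<Rightarrow> ('m \<Rightarrow> 'r) \<Rightarrow> ('m \<Rightarrow>\<^sub>0 complex) \<Rightarrow> 'r" where
  "lin_ext sc \<phi> f = (\<Sum>m\<in>Poly_Mapping.keys f. sc (lookup f m) * \<phi> m)"

text \<open>Symmetric algebra, group algebra and free algebra are all monoid algebras, so one universal property
  provides substitution, the action of the group algebra, evaluation at commuting operators and
  evaluation of words.\<close>

context complex_scalars
begin

lemma lin_ext_single: "lin_ext sc \<phi> (single m c) = sc c * \<phi> m"
  by (simp add: lin_ext_def sc_zero)

lemma lin_ext_add: "lin_ext sc \<phi> (f + g) = lin_ext sc \<phi> f + lin_ext sc \<phi> g"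
  unfolding lin_ext_def
  by (rule setsum_keys_plus_distrib) (simp_all add: sc_zero sc_add distrib_right)

lemma lin_ext_alg_map:
  fixes \<phi> :: "'m::monoid_add \<Rightarrow> 'r"
  assumes "\<phi> 0 = 1" and "\<And>m m'. \<phi> (m + m') = \<phi> m * \<phi> m'"
  shows "alg_map sc (lin_ext sc \<phi>)"
proof
  show "lin_ext sc \<phi> (x + y) = lin_ext sc \<phi> x + lin_ext sc \<phi> y" for x y
    by (rule lin_ext_add)
  show "lin_ext sc \<phi> (scal c) = sc c" for c
    by (simp add: lin_ext_single assms)
  show "lin_ext sc \<phi> (x * y) = lin_ext sc \<phi> x * lin_ext sc \<phi> y" for x y
  proof (induction x rule: poly_mapping_add_induct)
    case (single m c)
    show ?case
    proof (induction y rule: poly_mapping_add_induct)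
      case (single m' c')
      have "sc c * (sc c' * (\<phi> m * \<phi> m')) = sc c * \<phi> m * (sc c' * \<phi> m')"
        by (metis mult.assoc sc_central)
      then show ?case by (simp add: mult_single lin_ext_single assms sc_mult mult.assoc)
    qed (simp add: distrib_left lin_ext_add)
  qed (simp add: distrib_right lin_ext_add)
qed

end

lemma sym_alg_induct [case_names scal var add mult]:
  fixes p :: "'n::finite sym_alg"
  assumes sc: "\<And>c. P (scal c)" and v: "\<And>i. P (var i)"
    and ad: "\<And>p q. P p \<Longrightarrow> P q \<Longrightarrow> P (p + q)" and mu: "\<And>p q. P p \<Longrightarrow> P q \<Longrightarrow> P (p * q)"
  shows "P p"
proof (induction p rule: poly_mapping_add_induct)
  case (single m c)
  have pow: "P (single (single i n) 1)" for i n
  proof (induction n)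
    case 0
    show ?case using sc[of 1] by simp
  next
    case (Suc n)
    have "single (single i (Suc n)) (1::complex)
        = var i * single (single i n) 1"
      by (simp add: var_def mult_single flip: single_add)
    then show ?case using mu[OF v Suc] by simp
  qed
  have "P (single m 1)"
  proof (induction m rule: poly_mapping_add_induct)
    case (single i n)
    show ?case by (rule pow)
  next
    case (add x y)
    then show ?case using mu[OF add] by (simp add: mult_single)
  qed
  then show ?case using mu[OF sc[of c], of "single m 1"] by (simp add: mult_single)
qed (rule ad)

lemma alg_map_eqI:
  fixes p :: "'n::finite sym_alg"
  assumes "alg_map sc h" "alg_map sc h'" and "\<And>i. h (var i) = h' (var i)"
  shows "h p = h' p"
proof -
  interpret h: alg_map sc h by fact
  interpret h': alg_map sc h' by fact
  show ?thesis
    by (induction p rule: sym_alg_induct)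
      (simp_all add: assms h.scal h'.scal h.add h'.add h.mult h'.mult)
qed

section \<open>The ring of linear endomorphisms\<close>

text \<open>As a type in class \<open>ring_1\<close>, so that identities between operators can be computed with the ring
  simplification rules.\<close>

typedef (overloaded) 'n endo = "carrier (End_P :: (complex, 'n::{finite,linorder} sym_alg \<Rightarrow> 'n sym_alg) module)"
  morphisms app Endo
  by (auto simp: End_P_def intro: exI[of _ "\<lambda>_. 0"] simp: cscale_eq_mult)

setup_lifting type_definition_endo

lemma End_P_iff: "f \<in> carrier End_P \<longleftrightarrow>
    (\<forall>p q. f (p + q) = f p + f q) \<and> (\<forall>c p. f (scal c * p) = scal c * f p)"
  by (simp add: End_P_def cscale_eq_mult)

instantiation endo :: ("{finite,linorder}") ring_1
begin

lift_definition zero_endo :: "'a endo" is "\<lambda>_. 0" by (simp add: End_P_iff)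
lift_definition one_endo :: "'a endo" is "\<lambda>p. p" by (simp add: End_P_iff)
lift_definition plus_endo :: "'a endo \<Rightarrow> 'a endo \<Rightarrow> 'a endo" is "\<lambda>f g p. f p + g p"
  by (simp add: End_P_iff distrib_left)
lift_definition minus_endo :: "'a endo \<Rightarrow> 'a endo \<Rightarrow> 'a endo" is "\<lambda>f g p. f p - g p"
  by (simp add: End_P_iff right_diff_distrib)
lift_definition uminus_endo :: "'a endo \<Rightarrow> 'a endo" is "\<lambda>f p. - f p"
  by (simp add: End_P_iff)
lift_definition times_endo :: "'a endo \<Rightarrow> 'a endo \<Rightarrow> 'a endo" is "\<lambda>f g p. f (g p)"
  by (simp add: End_P_iff)

instance
proof
  show "(0::'a endo) \<noteq> 1" by transfer (metis one_neq_zero)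
qed (transfer; simp add: fun_eq_iff End_P_iff algebra_simps)+

end

definition Mul :: "'n sym_alg \<Rightarrow> 'n::{finite,linorder} endo" where
  "Mul q = Endo (\<lambda>p. q * p)"

definition escal :: "complex \<Rightarrow> 'n::{finite,linorder} endo" where
  "escal c = Mul (scal c)"

lemma app_Mul: "app (Mul q) p = q * p"
  unfolding Mul_def by (subst Endo_inverse) (simp_all add: End_P_iff algebra_simps)

lemma app_escal: "app (escal c) p = scal c * p"
  by (simp add: escal_def app_Mul)

lemmas app_simps [simp] = zero_endo.rep_eq one_endo.rep_eq plus_endo.rep_eq minus_endo.rep_eq
  uminus_endo.rep_eq times_endo.rep_eq app_escal app_Mul

lemma app_sum [simp]: "app (\<Sum>i\<in>A. f i) p = (\<Sum>i\<in>A. app (f i) p)"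
  by (induction A rule: infinite_finite_induct) simp_all

lemma app_add_arg: "app f (p + q) = app f p + app f q"
  and app_scal_arg: "app f (scal c * p) = scal c * app f p"
  using app[of f] by (simp_all add: End_P_iff)

lemma app_zero_arg [simp]: "app f 0 = 0"
  using app_add_arg[of f 0 0] by simp

lemma endo_eqI: "(\<And>p. app f p = app g p) \<Longrightarrow> f = g"
  by (metis app_inverse ext)

interpretation escal: complex_scalars "escal :: complex \<Rightarrow> 'n::{finite,linorder} endo"
proof
  show "escal (a * b) = escal a * (escal b :: 'n endo)" for a b
    using scal.sc_mult[of a b] by (auto intro!: endo_eqI simp: mult.assoc)
qed (auto intro!: endo_eqI simp: single_add distrib_right app_scal_arg)

lemma Mul_alg_map: "alg_map escal Mul"
  by unfold_locales (auto intro!: endo_eqI simp: algebra_simps)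

section \<open>Roots and the Weyl group\<close>

lemma inner_basis_vec [simp]: "basis_vec i \<bullet> basis_vec j = (if i = j then 1 else 0)"
  by (simp add: basis_vec_def inner_axis_axis)

lemma inner_basis_vec_right [simp]: "v \<bullet> basis_vec j = v $ j"
  by (simp add: basis_vec_def inner_axis)

lemma inner_basis_vec_left [simp]: "basis_vec j \<bullet> v = v $ j"
  by (simp add: basis_vec_def inner_axis')

lemma basis_vec_nth [simp]: "basis_vec i $ j = (if i = j then 1 else 0)"
  by (simp add: basis_vec_def axis_def)

lemma basis_vec_expansion: "(\<Sum>i\<in>UNIV. v $ i *\<^sub>R basis_vec i) = (v :: real ^ 'n::finite)"
  by (simp add: vec_eq_iff if_distrib cong: if_cong)

lemma linear_reflection: "linear (reflection \<alpha>)"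
  by (rule linearI)
    (simp_all add: reflection_def coroot_def inner_add_right algebra_simps add_divide_distrib)

lemma inner_reflection: "reflection \<alpha> u \<bullet> reflection \<alpha> v = u \<bullet> v"
proof (cases "\<alpha> \<bullet> \<alpha> = 0")
  case False
  then show ?thesis
    by (simp add: reflection_def coroot_def inner_diff_left inner_diff_right inner_commute field_simps)
qed (simp add: reflection_def coroot_def)

lemma reflection_reflection: "reflection \<alpha> (reflection \<alpha> v) = v"
proof (cases "\<alpha> \<bullet> \<alpha> = 0")
  case False
  then show ?thesis
    by (simp add: reflection_def coroot_def inner_diff_right field_simps)
qed (simp add: reflection_def coroot_def)

lemma reflection_minus: "reflection (- \<alpha>) = reflection \<alpha>"
  by (simp add: fun_eq_iff reflection_def coroot_def)

lemma reflection_group_linear: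
  assumes "g \<in> reflection_group R"
  shows "linear g"
  using assms
proof induction
  case id
  show ?case by (rule linear_id)
next
  case (refl \<alpha> w)
  then show ?case by (intro linear_compose linear_reflection)
qed

lemma reflection_group_inner:
  assumes "g \<in> reflection_group R"
  shows "g u \<bullet> g v = u \<bullet> v"
  using assms by induction (simp_all add: inner_reflection)

lemma reflection_group_inverse:
  assumes "g \<in> reflection_group R"
  shows "\<exists>h\<in>reflection_group R. h \<circ> g = id"
  using assms
proof induction
  case id
  show ?case by (rule bexI[OF _ reflection_group.id]) simp
next
  case (refl \<alpha> w)
  then obtain h where h: "h \<in> reflection_group R" "h \<circ> w = id" by blast
  have "h \<circ> (reflection \<alpha> \<circ> id) \<in> reflection_group R"
    using refl h by (intro reflection_group_comp reflection_group.intros)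
  moreover have "h \<circ> (reflection \<alpha> \<circ> id) \<circ> (reflection \<alpha> \<circ> w) = id"
    using h(2) by (simp add: fun_eq_iff reflection_reflection)
  ultimately show ?case by blast
qed

lemma reflection_conj:
  assumes "linear g" and "\<And>u v. g u \<bullet> g v = u \<bullet> v"
  shows "g (reflection \<alpha> v) = reflection (g \<alpha>) (g v)"
  using assms by (simp add: reflection_def coroot_def linear_diff linear_cmul)

lemma short_rootsE:
  assumes "u \<in> short_roots"
  obtains a i where "a = 1 \<or> a = - 1" "u = a *\<^sub>R basis_vec i"
  using assms by (auto simp: short_roots_def)

lemma basis_vec_short [simp]: "basis_vec i \<in> short_roots"
  unfolding short_roots_def by (rule CollectI, rule exI[of _ 1]) auto

lemma minus_short_roots: "u \<in> short_roots \<Longrightarrow> - u \<in> short_roots"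
  unfolding short_roots_def by force

lemma inner_short_self: "u \<in> short_roots \<Longrightarrow> u \<bullet> u = 1"
  by (auto elim!: short_rootsE)

lemma inner_short_cases:
  assumes "u \<in> short_roots" "v \<in> short_roots"
  shows "u \<bullet> v = 0 \<or> v = u \<or> v = - u"
  using assms by (elim short_rootsE) (auto split: if_splits)

text \<open>In this form, stability of the roots under the Weyl group follows from stability of the short roots and
  invariance of the inner product.\<close>

lemma long_roots_eq: "long_roots = {u + v | u v. u \<in> short_roots \<and> v \<in> short_roots \<and> u \<bullet> v = 0}"
proof (intro equalityI subsetI)
  fix \<alpha> :: "real ^ 'n::{finite,linorder}" assume "\<alpha> \<in> long_roots"
  then obtain a b :: real and i j :: 'n where *: "\<alpha> = a *\<^sub>R basis_vec i + b *\<^sub>R basis_vec j"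
    "a \<in> {1,-1}" "b \<in> {1,-1}" "i < j"
    unfolding long_roots_def by blast
  then have "a *\<^sub>R basis_vec i \<in> short_roots" "b *\<^sub>R basis_vec j \<in> short_roots"
    unfolding short_roots_def by blast+
  moreover have "(a *\<^sub>R basis_vec i) \<bullet> (b *\<^sub>R basis_vec j) = 0" using * by auto
  ultimately show "\<alpha> \<in> {u + v | u v. u \<in> short_roots \<and> v \<in> short_roots \<and> u \<bullet> v = 0}"
    using *(1) by blast
next
  fix \<alpha> :: "real ^ 'n::{finite,linorder}" assume "\<alpha> \<in> {u + v | u v. u \<in> short_roots \<and> v \<in> short_roots \<and> u \<bullet> v = 0}"
  then obtain a b :: real and i j :: 'n where *: "\<alpha> = a *\<^sub>R basis_vec i + b *\<^sub>R basis_vec j"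
    "a \<in> {1,-1}" "b \<in> {1,-1}" "(a *\<^sub>R basis_vec i) \<bullet> (b *\<^sub>R basis_vec j) = 0"
    unfolding short_roots_def by blast
  then have "i \<noteq> j" by auto
  then consider "i < j" | "j < i" by force
  then show "\<alpha> \<in> long_roots"
  proof cases
    case 1
    then show ?thesis using * unfolding long_roots_def by blast
  next
    case 2
    moreover have "\<alpha> = b *\<^sub>R basis_vec j + a *\<^sub>R basis_vec i" using * by (simp add: add.commute)
    ultimately show ?thesis using * unfolding long_roots_def by blast
  qed
qed

lemma long_rootsE:
  assumes "\<alpha> \<in> long_roots"
  obtains u v where "\<alpha> = u + v" "u \<in> short_roots" "v \<in> short_roots" "u \<bullet> v = 0"
  using assms unfolding long_roots_eq by blast

lemma inner_long_self: "\<alpha> \<in> long_roots \<Longrightarrow> \<alpha> \<bullet> \<alpha> = 2"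
  by (auto elim!: long_rootsE simp: inner_add_left inner_add_right inner_short_self inner_commute)

lemma short_not_long: "\<alpha> \<in> short_roots \<Longrightarrow> \<alpha> \<notin> long_roots"
  using inner_short_self inner_long_self by force

lemma root_nonzero: "\<alpha> \<in> roots_B \<Longrightarrow> \<alpha> \<noteq> 0"
  using inner_short_self inner_long_self unfolding roots_B_def by fastforce

lemma reflection_short: "u \<in> short_roots \<Longrightarrow> reflection u x = x - (2 * (u \<bullet> x)) *\<^sub>R u"
  by (simp add: reflection_def coroot_def inner_short_self)

lemma reflection_long: "\<alpha> \<in> long_roots \<Longrightarrow> reflection \<alpha> x = x - (\<alpha> \<bullet> x) *\<^sub>R \<alpha>"
  by (simp add: reflection_def coroot_def inner_long_self)

lemma reflection_maps_short:
  assumes "\<alpha> \<in> roots_B" "x \<in> short_roots"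
  shows "reflection \<alpha> x \<in> short_roots"
proof (cases "\<alpha> \<in> long_roots")
  case True
  then obtain u v where uv: "\<alpha> = u + v" "u \<in> short_roots" "v \<in> short_roots" "u \<bullet> v = 0"
    by (rule long_rootsE)
  have vu: "v \<bullet> u = 0" using uv(4) by (simp add: inner_commute)
  have eq: "reflection \<alpha> x = x - (u \<bullet> x + v \<bullet> x) *\<^sub>R (u + v)"
    using reflection_long[OF True, of x] by (simp add: uv(1) inner_add_left)
  note sq = inner_short_self[OF uv(2)] inner_short_self[OF uv(3)]
  consider "x = u" | "x = - u" | "u \<bullet> x = 0" "x = v" | "u \<bullet> x = 0" "x = - v" | "u \<bullet> x = 0" "v \<bullet> x = 0"
    using inner_short_cases[OF uv(2) assms(2)] inner_short_cases[OF uv(3) assms(2)] by blast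
  then show ?thesis
  proof cases
    case 1
    then have "reflection \<alpha> x = - v" unfolding eq by (simp add: sq vu)
    then show ?thesis using uv minus_short_roots by simp
  next
    case 2
    then have "reflection \<alpha> x = v" unfolding eq by (simp add: sq vu)
    then show ?thesis using uv by simp
  next
    case 3
    then have "reflection \<alpha> x = - u" unfolding eq by (simp add: sq uv(4))
    then show ?thesis using uv minus_short_roots by simp
  next
    case 4
    then have "reflection \<alpha> x = u" unfolding eq by (simp add: sq uv(4))
    then show ?thesis using uv by simp
  next
    case 5
    then have "reflection \<alpha> x = x" unfolding eq by simp
    then show ?thesis using assms by simp
  qed
next
  case False
  then have s: "\<alpha> \<in> short_roots" using assms by (simp add: roots_B_def)
  have "reflection \<alpha> x \<in> {x, - x}"
    using inner_short_cases[OF s assms(2)] inner_short_self[OF s]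
    by (auto simp: reflection_short[OF s] scaleR_2)
  then show ?thesis using assms minus_short_roots by auto
qed

lemma weyl_fun_in: "weyl_fun w \<in> reflection_group roots_B"
  by (rule weyl_fun)

lemmas linear_weyl_fun = reflection_group_linear[OF weyl_fun]
  and inner_weyl_fun = reflection_group_inner[OF weyl_fun]

lemma weyl_fun_add [simp]: "weyl_fun (v + w) u = weyl_fun v (weyl_fun w u)"
  by (simp add: plus_weyl.rep_eq)

lemma weyl_fun_zero [simp]: "weyl_fun 0 u = u"
  by (simp add: zero_weyl.rep_eq)

lemma weyl_eqI: "(\<And>u. weyl_fun v u = weyl_fun w u) \<Longrightarrow> v = w"
  by (metis ext weyl_fun_inject)

lemma weyl_fun_refl: "\<alpha> \<in> roots_B \<Longrightarrow> weyl_fun (weyl_refl \<alpha>) = reflection \<alpha>"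
  unfolding weyl_refl_def
  using reflection_group.refl[OF _ reflection_group.id, of \<alpha> roots_B] by (simp add: Abs_weyl_inverse)

lemma weyl_induct [case_names zero refl]:
  assumes "P 0" and "\<And>\<alpha> w. \<alpha> \<in> roots_B \<Longrightarrow> P w \<Longrightarrow> P (weyl_refl \<alpha> + w)"
  shows "P w"
proof -
  have "\<exists>w. weyl_fun w = g \<and> P w" if "g \<in> reflection_group roots_B" for g
    using that
  proof (induction rule: reflection_group.induct)
    case id
    then show ?case using assms(1) by (intro exI[of _ 0]) (simp add: zero_weyl.rep_eq)
  next
    case (refl \<alpha> g)
    then obtain w where "weyl_fun w = g" "P w" by blast
    then show ?case using refl assms(2)
      by (intro exI[of _ "weyl_refl \<alpha> + w"]) (simp add: plus_weyl.rep_eq weyl_fun_refl)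
  qed
  from this[OF weyl_fun_in[of w]] show ?thesis by (auto simp: weyl_fun_inject)
qed

lemma weyl_inverse: "\<exists>v. v + w = (0 :: 'n::{finite,linorder} weyl)"
proof -
  obtain h where h: "h \<in> reflection_group roots_B" "h \<circ> weyl_fun w = id"
    using reflection_group_inverse[OF weyl_fun_in] by blast
  show ?thesis
    by (rule exI[of _ "Abs_weyl h"], rule weyl_eqI)
      (use h in \<open>simp add: Abs_weyl_inverse fun_eq_iff\<close>)
qed

lemma weyl_fun_short: "u \<in> short_roots \<Longrightarrow> weyl_fun w u \<in> short_roots"
  by (induction w rule: weyl_induct) (simp_all add: weyl_fun_refl reflection_maps_short)

lemma weyl_fun_long:
  assumes "\<alpha> \<in> long_roots"
  shows "weyl_fun w \<alpha> \<in> long_roots"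
  using assms
proof (rule long_rootsE)
  fix u v assume "\<alpha> = u + v" "u \<in> short_roots" "v \<in> short_roots" "u \<bullet> v = 0"
  then show ?thesis unfolding long_roots_eq
    by (intro CollectI exI[of _ "weyl_fun w u"] exI[of _ "weyl_fun w v"] conjI)
      (simp_all only: weyl_fun_short inner_weyl_fun linear_add[OF linear_weyl_fun])
qed

lemma weyl_fun_root: "\<alpha> \<in> roots_B \<Longrightarrow> weyl_fun w \<alpha> \<in> roots_B"
  using weyl_fun_short weyl_fun_long unfolding roots_B_def by blast

lemma inj_weyl_fun: "inj (weyl_fun w)"
proof -
  obtain v where "v + w = 0" using weyl_inverse by blast
  then have "weyl_fun v (weyl_fun w u) = u" for u
    by (metis weyl_fun_add weyl_fun_zero)
  then show ?thesis by (metis injI)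
qed

lemma finite_short_roots: "finite (short_roots :: (real ^ 'n::{finite,linorder}) set)"
proof -
  have "short_roots \<subseteq> (\<lambda>(a, i). a *\<^sub>R basis_vec i) ` ({1, - 1} \<times> (UNIV :: 'n set))"
    by (auto elim!: short_rootsE simp: image_iff)
  then show ?thesis by (rule finite_subset) simp
qed

lemma finite_roots_B: "finite (roots_B :: (real ^ 'n::{finite,linorder}) set)"
proof -
  have "long_roots \<subseteq> (\<lambda>(u, v). u + v) ` (short_roots \<times> (short_roots :: (real, 'n) vec set))"
    by (auto simp: long_roots_eq)
  then have "finite (long_roots :: (real, 'n) vec set)"
    by (rule finite_subset) (simp add: finite_short_roots)
  then show ?thesis by (simp add: roots_B_def finite_short_roots)
qed

lemma bij_weyl_fun_roots: "bij_betw (weyl_fun w) roots_B roots_B"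
  unfolding bij_betw_def
  using inj_weyl_fun[of w] finite_roots_B weyl_fun_root
  by (metis endo_inj_surj image_subsetI inj_on_subset subset_UNIV)

lemma kbar_weyl_fun: "\<alpha> \<in> roots_B \<Longrightarrow> kbar k kc (weyl_fun w \<alpha>) = kbar k kc \<alpha>"
  unfolding kbar_def roots_B_def
  using weyl_fun_short weyl_fun_long short_not_long by (metis UnE)

text \<open>The relations between transpositions and sign changes (\<open>sigma_tau\<close>, \<open>sigma_sigma\<close>) are instances.\<close>

lemma weyl_conj_refl:
  assumes "\<alpha> \<in> roots_B"
  shows "w + weyl_refl \<alpha> = weyl_refl (weyl_fun w \<alpha>) + w"
  by (rule weyl_eqI) (simp add: assms weyl_fun_refl weyl_fun_root
      reflection_conj[OF linear_weyl_fun inner_weyl_fun])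

lemma weyl_refl_self: "\<alpha> \<in> roots_B \<Longrightarrow> weyl_refl \<alpha> + weyl_refl \<alpha> = 0"
  by (rule weyl_eqI) (simp add: weyl_fun_refl reflection_reflection)

lemma weyl_refl_minus: "weyl_refl (- \<alpha>) = weyl_refl \<alpha>"
  by (simp add: weyl_refl_def reflection_minus)

lemma weyl_eq_basisI:
  fixes v w :: "'n::{finite,linorder} weyl"
  assumes "\<And>i. weyl_fun v (basis_vec i) = weyl_fun w (basis_vec i)"
  shows "v = w"
proof (rule weyl_eqI)
  fix u
  have "weyl_fun x u = (\<Sum>i\<in>UNIV. u $ i *\<^sub>R weyl_fun x (basis_vec i))" for x :: "'n weyl"
    by (subst basis_vec_expansion[symmetric, of u])
      (simp only: linear_sum[OF linear_weyl_fun] linear_cmul[OF linear_weyl_fun])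
  then show "weyl_fun v u = weyl_fun w u" using assms by simp
qed

instance weyl :: ("{finite,linorder}") finite
proof
  have "inj (\<lambda>(w :: 'a weyl) i. weyl_fun w (basis_vec i))"
    by (rule injI) (metis weyl_eq_basisI)
  moreover have "range (\<lambda>(w :: 'a weyl) i. weyl_fun w (basis_vec i)) \<subseteq> PiE UNIV (\<lambda>_. short_roots)"
    by (auto simp: weyl_fun_short)
  then have "finite (range (\<lambda>(w :: 'a weyl) i. weyl_fun w (basis_vec i)))"
    by (rule finite_subset) (simp add: finite_PiE finite_short_roots)
  ultimately show "finite (UNIV :: 'a weyl set)"
    using finite_imageD by blast
qed

lemma basis_diff_long: "i \<noteq> j \<Longrightarrow> basis_vec i - basis_vec j \<in> long_roots"
  unfolding long_roots_eq
  by (intro CollectI exI[of _ "basis_vec i"] exI[of _ "- basis_vec j"])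
    (simp add: minus_short_roots)

lemma basis_add_long: "i \<noteq> j \<Longrightarrow> basis_vec i + basis_vec j \<in> long_roots"
  unfolding long_roots_eq
  by (intro CollectI exI[of _ "basis_vec i"] exI[of _ "basis_vec j"]) simp

lemma basis_diff_root [simp]: "i \<noteq> j \<Longrightarrow> basis_vec i - basis_vec j \<in> roots_B"
  by (simp add: roots_B_def basis_diff_long)

lemma basis_add_root [simp]: "i \<noteq> j \<Longrightarrow> basis_vec i + basis_vec j \<in> roots_B"
  by (simp add: roots_B_def basis_add_long)

lemma basis_vec_root [simp]: "basis_vec i \<in> roots_B"
  by (simp add: roots_B_def)

abbreviation tau :: "'n \<Rightarrow> 'n::{finite,linorder} weyl" where
  "tau i \<equiv> weyl_refl (basis_vec i)"

abbreviation sigma :: "'n \<Rightarrow> 'n \<Rightarrow> 'n::{finite,linorder} weyl" where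
  "sigma i j \<equiv> weyl_refl (basis_vec i - basis_vec j)"

lemma tau_basis: "weyl_fun (tau i) (basis_vec j) = (if i = j then - basis_vec j else basis_vec j)"
  by (simp add: weyl_fun_refl reflection_short scaleR_2)

lemma sigma_basis:
  "i \<noteq> j \<Longrightarrow> weyl_fun (sigma i j) (basis_vec l) = basis_vec (Transposition.transpose i j l)"
  by (auto simp: weyl_fun_refl reflection_long basis_diff_long Transposition.transpose_def)

lemma tau_comm: "tau i + tau j = tau j + tau i"
  by (rule weyl_eq_basisI) (simp add: tau_basis linear_neg[OF linear_weyl_fun])

lemma sigma_tau: "i \<noteq> j \<Longrightarrow> sigma i j + tau l = tau (Transposition.transpose i j l) + sigma i j"
  by (simp add: weyl_conj_refl sigma_basis)

lemma sigma_sigma: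
  assumes "i \<noteq> j" "l \<noteq> m"
  shows "sigma i j + sigma l m
    = sigma (Transposition.transpose i j l) (Transposition.transpose i j m) + sigma i j"
  using assms by (simp add: weyl_conj_refl sigma_basis linear_diff[OF linear_weyl_fun])

lemma sigma_commute: "sigma i j = sigma j i"
  using weyl_refl_minus[of "basis_vec i - basis_vec j"] by simp

lemma refl_add_eq: "i \<noteq> j \<Longrightarrow> weyl_refl (basis_vec i + basis_vec j) = tau i + tau j + sigma i j"
  by (rule weyl_eq_basisI)
    (auto simp: weyl_fun_refl reflection_long basis_add_long basis_diff_long reflection_short
      algebra_simps scaleR_2)

section \<open>The action on polynomials\<close>

lemma lin_elem_eq: "lin_elem v = (\<Sum>i\<in>UNIV. scal (complex_of_real (v $ i)) * var i)"
  by (simp add: lin_elem_def var_def mult_single)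

lemma lin_elem_add: "lin_elem (u + v) = lin_elem u + lin_elem v"
  by (simp add: lin_elem_eq single_add distrib_right sum.distrib)

lemma lin_elem_scaleR: "lin_elem (c *\<^sub>R v) = scal (of_real c) * lin_elem v"
  by (simp add: lin_elem_eq sum_distrib_left mult_single flip: mult.assoc)

lemma lin_elem_minus: "lin_elem (- v) = - lin_elem v"
  by (simp add: lin_elem_eq single_uminus sum_negf)

lemma lin_elem_diff: "lin_elem (u - v) = lin_elem u - lin_elem v"
  using lin_elem_add[of u "- v"] by (simp add: lin_elem_minus)

lemma lin_elem_sum: "lin_elem (\<Sum>i\<in>A. f i) = (\<Sum>i\<in>A. lin_elem (f i))"
  by (induction A rule: infinite_finite_induct) (simp_all add: lin_elem_add lin_elem_def[of 0])

lemma scal_sum: "scal (\<Sum>i\<in>A. f i) = (\<Sum>i\<in>A. scal (f i))"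
  by (induction A rule: infinite_finite_induct) (simp_all add: single_add)

lemma lin_elem_basis: "lin_elem (basis_vec i) = var i"
proof -
  have "lin_elem (basis_vec i) = (\<Sum>j\<in>UNIV. if j = i then var j else 0)"
    unfolding lin_elem_eq by (rule sum.cong) auto
  then show ?thesis by simp
qed

lemma single_single_eq_iff:
  "single i (Suc 0) = single j (Suc 0) \<longleftrightarrow> i = j"
  by (metis keys_single nat.distinct(1) singleton_inject)

lemma lookup_lin_elem: "lookup (lin_elem v) (single i 1) = of_real (v $ i)"
proof -
  have "lookup (lin_elem v) (single i 1)
      = (\<Sum>j\<in>UNIV. if j = i then complex_of_real (v $ j) else 0)"
    unfolding lin_elem_def lookup_sum
    by (rule sum.cong) (auto simp: lookup_single when_def single_single_eq_iff)
  then show ?thesis by simp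
qed

lemma lin_elem_nonzero: "v \<noteq> 0 \<Longrightarrow> lin_elem v \<noteq> 0"
  by (metis lookup_lin_elem lookup_zero of_real_eq_0_iff vec_eq_iff zero_index)

lemma subst_alg_map: "alg_map scal (subst \<phi>)"
proof -
  have "subst \<phi> = lin_ext scal (\<lambda>m. \<Prod>i\<in>UNIV. \<phi> i ^ lookup m i)"
    by (rule ext) (simp add: subst_def lin_ext_def cscale_eq_mult)
  then show ?thesis
    by (simp add: scal.lin_ext_alg_map lookup_add power_add prod.distrib)
qed

lemma subst_var: "subst \<phi> (var i) = \<phi> i"
proof -
  have "(\<Prod>j\<in>UNIV. \<phi> j ^ lookup (single i (Suc 0)) j)
      = (\<Prod>j\<in>UNIV. if j = i then \<phi> j else 1)"
    by (rule prod.cong) (auto simp: lookup_single when_def)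
  then show ?thesis by (simp add: subst_def var_def cscale_eq_mult)
qed

lemma lin_act_alg_map: "alg_map scal (lin_act g)"
  by (simp add: lin_act_def subst_alg_map)

lemma weyl_act_alg_map: "alg_map scal (weyl_act w)"
  by (simp add: weyl_act_def lin_act_alg_map)

interpretation weyl_act: alg_map scal "weyl_act w"
  by (rule weyl_act_alg_map)

lemma weyl_act_lin_elem: "weyl_act w (lin_elem v) = lin_elem (weyl_fun w v)"
proof -
  have "lin_elem (weyl_fun w v) = lin_elem (\<Sum>i\<in>UNIV. v $ i *\<^sub>R weyl_fun w (basis_vec i))"
    by (subst basis_vec_expansion[symmetric, of v])
      (simp only: linear_sum[OF linear_weyl_fun] linear_cmul[OF linear_weyl_fun])
  also have "\<dots> = (\<Sum>i\<in>UNIV. scal (of_real (v $ i)) * lin_elem (weyl_fun w (basis_vec i)))"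
    by (simp add: lin_elem_sum lin_elem_scaleR)
  also have "\<dots> = weyl_act w (lin_elem v)"
    by (simp add: lin_elem_eq[of v] weyl_act.sum weyl_act.mult weyl_act.scal)
      (simp add: weyl_act_def lin_act_def subst_var)
  finally show ?thesis by simp
qed

lemma weyl_act_var: "weyl_act w (var i) = lin_elem (weyl_fun w (basis_vec i))"
  by (metis lin_elem_basis weyl_act_lin_elem)

lemma weyl_act_add: "weyl_act (v + w) p = weyl_act v (weyl_act w p)"
proof (rule alg_map_eqI[where h = "weyl_act (v + w)" and h' = "\<lambda>p. weyl_act v (weyl_act w p)"])
  show "alg_map scal (weyl_act (v + w))" by (rule weyl_act_alg_map)
  show "alg_map scal (\<lambda>p. weyl_act v (weyl_act w p))"
    by unfold_locales (simp_all add: weyl_act.add weyl_act.mult weyl_act.scal)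
qed (simp add: weyl_act_var weyl_act_lin_elem)

lemma weyl_act_zero: "weyl_act 0 p = p"
proof (rule alg_map_eqI[where h = "weyl_act 0" and h' = "\<lambda>p. p"])
  show "alg_map scal (weyl_act 0)" by (rule weyl_act_alg_map)
  show "alg_map scal (\<lambda>p. p)" by unfold_locales simp_all
qed (simp add: weyl_act_var lin_elem_basis)

definition W_op :: "'n weyl \<Rightarrow> 'n::{finite,linorder} endo" where
  "W_op w = Endo (weyl_act w)"

lemma app_W_op [simp]: "app (W_op w) p = weyl_act w p"
  unfolding W_op_def
  by (subst Endo_inverse) (simp_all add: End_P_iff weyl_act.add weyl_act.mult weyl_act.scal)

lemma W_op_zero: "W_op 0 = 1" and W_op_add: "W_op (v + w) = W_op v * W_op w"
  by (auto intro!: endo_eqI simp: weyl_act_zero weyl_act_add)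

lemma W_op_Mul: "W_op w * Mul p = Mul (weyl_act w p) * W_op w"
  by (rule endo_eqI) (simp add: weyl_act.mult)

subsection \<open>Divided differences\<close>

lemma weyl_refl_lin_elem:
  "\<alpha> \<in> roots_B \<Longrightarrow> lin_elem u - weyl_act (weyl_refl \<alpha>) (lin_elem u)
    = lin_elem \<alpha> * scal (of_real (coroot \<alpha> u))"
  by (simp add: weyl_act_lin_elem weyl_fun_refl reflection_def lin_elem_diff lin_elem_scaleR mult.commute)

text \<open>The polynomials for which the quotient exists form an algebra, by the twisted product rule below.\<close>

lemma div_diff_exists:
  assumes "\<alpha> \<in> roots_B"
  shows "\<exists>q. lin_elem \<alpha> * q = p - weyl_act (weyl_refl \<alpha>) p"
proof (induction p rule: sym_alg_induct)
  case (scal c)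
  show ?case by (rule exI[of _ 0]) (simp add: weyl_act.scal)
next
  case (var i)
  show ?case using weyl_refl_lin_elem[OF assms, of "basis_vec i"] by (metis lin_elem_basis)
next
  case (add p p')
  then obtain q q' where "lin_elem \<alpha> * q = p - weyl_act (weyl_refl \<alpha>) p"
    "lin_elem \<alpha> * q' = p' - weyl_act (weyl_refl \<alpha>) p'" by blast
  then show ?case by (intro exI[of _ "q + q'"]) (simp add: distrib_left weyl_act.add)
next
  case (mult p p')
  then obtain q q' where *: "lin_elem \<alpha> * q = p - weyl_act (weyl_refl \<alpha>) p"
    "lin_elem \<alpha> * q' = p' - weyl_act (weyl_refl \<alpha>) p'" by blast
  have "lin_elem \<alpha> * (p * q' + q * weyl_act (weyl_refl \<alpha>) p')
     = p * (lin_elem \<alpha> * q') + (lin_elem \<alpha> * q) * weyl_act (weyl_refl \<alpha>) p'"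
    by (simp add: algebra_simps)
  also have "\<dots> = p * p' - weyl_act (weyl_refl \<alpha>) (p * p')"
    unfolding * by (simp add: algebra_simps weyl_act.mult)
  finally show ?case by blast
qed

lemma div_diff_unique:
  assumes "\<alpha> \<in> roots_B" and "lin_elem \<alpha> * q = p - weyl_act (weyl_refl \<alpha>) p"
  shows "div_diff \<alpha> p = q"
  unfolding div_diff_def
proof (rule the_equality)
  fix q' assume "lin_elem \<alpha> * q' = p - weyl_act (weyl_refl \<alpha>) p"
  with assms(2) have "lin_elem \<alpha> * q' = lin_elem \<alpha> * q" by simp
  then show "q' = q" using lin_elem_nonzero[OF root_nonzero[OF assms(1)]] by simp
qed (rule assms)

lemma div_diff_eq:
  assumes "\<alpha> \<in> roots_B"
  shows "lin_elem \<alpha> * div_diff \<alpha> p = p - weyl_act (weyl_refl \<alpha>) p"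
  using div_diff_exists[OF assms] div_diff_unique[OF assms] by metis

lemma div_diff_add:
  "\<alpha> \<in> roots_B \<Longrightarrow> div_diff \<alpha> (p + q) = div_diff \<alpha> p + div_diff \<alpha> q"
  by (rule div_diff_unique) (simp_all add: distrib_left div_diff_eq weyl_act.add)

lemma div_diff_scal_mult:
  "\<alpha> \<in> roots_B \<Longrightarrow> div_diff \<alpha> (scal c * p) = scal c * div_diff \<alpha> p"
  by (rule div_diff_unique)
    (simp_all add: mult.left_commute[of "lin_elem \<alpha>"] div_diff_eq weyl_act.mult weyl_act.scal right_diff_distrib)

lemma div_diff_mult:
  assumes "\<alpha> \<in> roots_B"
  shows "div_diff \<alpha> (q * p) = q * div_diff \<alpha> p + div_diff \<alpha> q * weyl_act (weyl_refl \<alpha>) p"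
proof (rule div_diff_unique[OF assms])
  have "lin_elem \<alpha> * (q * div_diff \<alpha> p + div_diff \<alpha> q * weyl_act (weyl_refl \<alpha>) p)
     = q * (lin_elem \<alpha> * div_diff \<alpha> p) + (lin_elem \<alpha> * div_diff \<alpha> q) * weyl_act (weyl_refl \<alpha>) p"
    by (simp add: algebra_simps)
  also have "\<dots> = q * p - weyl_act (weyl_refl \<alpha>) (q * p)"
    unfolding div_diff_eq[OF assms] by (simp add: algebra_simps weyl_act.mult)
  finally show "lin_elem \<alpha> * (q * div_diff \<alpha> p + div_diff \<alpha> q * weyl_act (weyl_refl \<alpha>) p)
     = q * p - weyl_act (weyl_refl \<alpha>) (q * p)" .
qed

lemma div_diff_lin_elem:
  "\<alpha> \<in> roots_B \<Longrightarrow> div_diff \<alpha> (lin_elem u) = scal (of_real (coroot \<alpha> u))"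
  by (rule div_diff_unique) (simp_all add: weyl_refl_lin_elem)

lemma div_diff_one: "\<alpha> \<in> roots_B \<Longrightarrow> div_diff \<alpha> 1 = 0"
  by (rule div_diff_unique) (simp_all add: weyl_act.one)

lemma div_diff_weyl_act:
  assumes "\<alpha> \<in> roots_B"
  shows "div_diff (weyl_fun w \<alpha>) (weyl_act w p) = weyl_act w (div_diff \<alpha> p)"
proof (rule div_diff_unique)
  have "lin_elem (weyl_fun w \<alpha>) * weyl_act w (div_diff \<alpha> p) = weyl_act w (lin_elem \<alpha> * div_diff \<alpha> p)"
    by (simp add: weyl_act.mult weyl_act_lin_elem)
  then show "lin_elem (weyl_fun w \<alpha>) * weyl_act w (div_diff \<alpha> p)
      = weyl_act w p - weyl_act (weyl_refl (weyl_fun w \<alpha>)) (weyl_act w p)"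
    using weyl_conj_refl[OF assms, of w] by (simp add: div_diff_eq assms weyl_act.diff flip: weyl_act_add)
qed (simp add: assms weyl_fun_root)

subsection \<open>Partial derivatives\<close>

lemma partial_add: "partial i (p + q) = partial i p + partial i q"
  unfolding partial_def
  by (rule setsum_keys_plus_distrib) (simp_all add: single_add distrib_left)

lemma partial_single: "partial i (single m c)
    = single (m - single i 1) (of_nat (lookup m i) * c)"
  by (simp add: partial_def)

lemma partial_mult: "partial i (p * q) = partial i p * q + p * partial i q"
proof (induction p rule: poly_mapping_add_induct)
  case (single m c)
  show ?case
  proof (induction q rule: poly_mapping_add_induct)
    case (single m' c')
    have 1: "m + m' - single i 1 = m - single i 1 + m'"
      if "lookup m i \<noteq> 0" for m m' :: "'a \<Rightarrow>\<^sub>0 nat"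
      using that
      by (intro poly_mapping_eqI) (auto simp: lookup_add lookup_minus lookup_single when_def)
    have 2: "m + m' - single i 1 = m + (m' - single i 1)"
      if "lookup m' i \<noteq> 0"
      using 1[of m' m] that by (simp add: add.commute)
    have "partial i (single m c * single m' c')
      = single (m + m' - single i 1) (of_nat (lookup m i) * c * c')
      + single (m + m' - single i 1) (of_nat (lookup m' i) * c * c')"
      by (simp add: mult_single partial_single lookup_add algebra_simps flip: single_add)
    also have "\<dots> = partial i (single m c) * single m' c'
       + single m c * partial i (single m' c')"
      using 1[of m m'] 2
      by (cases "lookup m i = 0"; cases "lookup m' i = 0")
        (simp_all add: mult_single partial_single algebra_simps)
    finally show ?case .
  qed (simp add: distrib_left partial_add)
qed (simp add: distrib_right partial_add)

lemma partial_scal: "partial i (scal c) = 0"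
  by (simp add: partial_single)

lemma partial_scal_mult: "partial i (scal c * p) = scal c * partial i p"
  by (simp add: partial_mult partial_scal)

lemma partial_one: "partial i 1 = 0"
  using partial_scal[of i 1] by simp

lemma partial_zero: "partial i 0 = 0"
  by (simp add: partial_def)

lemma partial_var: "partial i (var j) = (if i = j then 1 else 0)"
  by (auto simp: var_def partial_single lookup_single when_def)

lemma partial_sum: "partial i (\<Sum>j\<in>A. f j) = (\<Sum>j\<in>A. partial i (f j))"
  by (induction A rule: infinite_finite_induct) (simp_all add: partial_zero partial_add)

lemma partial_lin_elem: "partial i (lin_elem v) = scal (of_real (v $ i))"
  by (simp add: lin_elem_eq partial_sum partial_scal_mult partial_var if_distrib cong: if_cong)

lemma lookup_partial: "lookup (partial i p) m
    = of_nat (Suc (lookup m i)) * lookup p (m + single i 1)"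
proof (induction p rule: poly_mapping_add_induct)
  case (single m' c)
  show ?case
  proof (cases "lookup m' i = 0")
    case True
    then have "m' \<noteq> m + single i 1"
      by (auto simp: lookup_add)
    with True show ?thesis by (simp add: partial_single lookup_single)
  next
    case False
    then have *: "m' - single i 1 + single i 1 = m'"
      by (intro poly_mapping_eqI) (auto simp: lookup_add lookup_minus lookup_single when_def)
    then have "m' - single i 1 = m \<longleftrightarrow> m' = m + single i 1"
      by auto
    then show ?thesis by (auto simp: partial_single lookup_single when_def lookup_add)
  qed
qed (simp add: partial_add lookup_add distrib_left)

text \<open>Both sides are derivations along the algebra map given by \<open>w\<close>, and they agree on linear forms.\<close>

lemma partial_weyl_act: "partial i (weyl_act w p)
    = (\<Sum>j\<in>UNIV. scal (of_real (weyl_fun w (basis_vec j) $ i)) * weyl_act w (partial j p))"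
proof (induction p rule: sym_alg_induct)
  case (scal c)
  then show ?case by (simp add: weyl_act.scal partial_scal weyl_act.zero)
next
  case (var l)
  then show ?case
    by (simp add: weyl_act_var partial_lin_elem partial_var weyl_act.one weyl_act.zero if_distrib cong: if_cong)
next
  case (add p q)
  then show ?case by (simp add: weyl_act.add partial_add distrib_left sum.distrib)
next
  case (mult p q)
  then show ?case
    by (simp add: weyl_act.add weyl_act.mult partial_mult algebra_simps sum.distrib sum_distrib_left
        sum_distrib_right)
qed

lemma weyl_act_partial: "weyl_act w (partial j p)
    = (\<Sum>i\<in>UNIV. scal (of_real (weyl_fun w (basis_vec j) $ i)) * partial i (weyl_act w p))"
proof -
  have orth: "(\<Sum>i\<in>UNIV. weyl_fun w (basis_vec j) $ i * weyl_fun w (basis_vec l) $ i)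
      = (if j = l then 1 else 0)" for l
    using inner_weyl_fun[of w "basis_vec j" "basis_vec l"] inner_basis_vec[of j l]
    by (simp only: inner_vec_def[of "weyl_fun w (basis_vec j)"] inner_real_def)
  have "(\<Sum>i\<in>UNIV. scal (of_real (weyl_fun w (basis_vec j) $ i)) * partial i (weyl_act w p))
    = (\<Sum>i\<in>UNIV. \<Sum>l\<in>UNIV. scal (of_real (weyl_fun w (basis_vec j) $ i * weyl_fun w (basis_vec l) $ i))
        * weyl_act w (partial l p))"
    by (simp add: partial_weyl_act sum_distrib_left mult_single flip: mult.assoc)
  also have "\<dots> = (\<Sum>l\<in>UNIV. \<Sum>i\<in>UNIV. scal (of_real (weyl_fun w (basis_vec j) $ i * weyl_fun w (basis_vec l) $ i))
        * weyl_act w (partial l p))"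
    by (rule sum.swap)
  also have "\<dots> = (\<Sum>l\<in>UNIV. scal (of_real (\<Sum>i\<in>UNIV. weyl_fun w (basis_vec j) $ i * weyl_fun w (basis_vec l) $ i))
        * weyl_act w (partial l p))"
    by (simp add: scal_sum sum_distrib_right)
  also have "\<dots> = (\<Sum>l\<in>UNIV. if j = l then weyl_act w (partial l p) else 0)"
    unfolding orth by (rule sum.cong) auto
  finally show ?thesis by simp
qed

section \<open>Commutation in a noncommutative ring\<close>

lemma commute_mult: "x * a = a * x \<Longrightarrow> x * b = b * x \<Longrightarrow> x * (a * b) = (a * b) * x" for x :: "'r::ring_1"
  by (metis mult.assoc)

lemma commute_add: "x * a = a * x \<Longrightarrow> x * b = b * x \<Longrightarrow> x * (a + b) = (a + b) * x" for x :: "'r::ring_1"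
  by (simp add: distrib_left distrib_right)

lemma commute_sum: "(\<And>i. i \<in> I \<Longrightarrow> x * f i = f i * x) \<Longrightarrow> x * sum f I = sum f I * x" for x :: "'r::ring_1"
  by (simp add: sum_distrib_left sum_distrib_right)

text \<open>For \<open>i < j\<close> the commutator of \<open>A i\<close> with the second sum cancels that of \<open>A i\<close> and \<open>A j\<close>, since only its
  summand \<open>B i j\<close> moves \<open>A i\<close>. The two sums commute because for \<open>m < i\<close> the element \<open>B m i\<close> exchanges
  \<open>B m j\<close> and \<open>B i j\<close> and commutes with the other summands of the second sum.\<close>

lemma commuting_sums:
  fixes A :: "'n::{finite,linorder} \<Rightarrow> 'r::ring_1"
  assumes AA: "\<And>i j. i \<noteq> j \<Longrightarrow> A i * A j - A j * A i = (A j - A i) * B i j"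
    and BA: "\<And>i j l. i \<noteq> j \<Longrightarrow> B i j * A l = A (Transposition.transpose i j l) * B i j"
    and sym: "\<And>i j. B i j = B j i"
    and braid: "\<And>i j l. i \<noteq> j \<Longrightarrow> i \<noteq> l \<Longrightarrow> j \<noteq> l \<Longrightarrow> B i j * B i l = B j l * B i j"
    and disj: "\<And>i j l m. i \<noteq> j \<Longrightarrow> l \<noteq> m \<Longrightarrow> l \<noteq> i \<Longrightarrow> l \<noteq> j \<Longrightarrow> m \<noteq> i \<Longrightarrow> m \<noteq> j \<Longrightarrow>
      B i j * B l m = B l m * B i j"
  shows "(A i + (\<Sum>l\<in>{..<i}. B l i)) * (A j + (\<Sum>l\<in>{..<j}. B l j))
    = (A j + (\<Sum>l\<in>{..<j}. B l j)) * (A i + (\<Sum>l\<in>{..<i}. B l i))"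
proof -
  have main: "(A i + (\<Sum>l\<in>{..<i}. B l i)) * (A j + (\<Sum>l\<in>{..<j}. B l j))
    = (A j + (\<Sum>l\<in>{..<j}. B l j)) * (A i + (\<Sum>l\<in>{..<i}. B l i))" if ij: "i < j" for i j
  proof -
    define Si Sj where "Si = (\<Sum>l\<in>{..<i}. B l i)" and "Sj = (\<Sum>l\<in>{..<j}. B l j)"
    have 1: "A i * Sj - Sj * A i = (A i - A j) * B i j"
    proof -
      have "A i * Sj - Sj * A i = (\<Sum>l\<in>{..<j}. A i * B l j - B l j * A i)"
        by (simp add: Sj_def sum_distrib_left sum_distrib_right sum_subtractf)
      also have "\<dots> = (\<Sum>l\<in>{..<j}. if l = i then (A i - A j) * B i j else 0)"
        by (rule sum.cong) (use ij in \<open>auto simp: BA Transposition.transpose_def left_diff_distrib\<close>)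
      finally show ?thesis using ij by simp
    qed
    have 2: "A j * Si = Si * A j"
      unfolding Si_def by (rule commute_sum) (use ij in \<open>auto simp: BA Transposition.transpose_def\<close>)
    have 3: "Sj * Si = Si * Sj"
      unfolding Si_def
    proof (rule commute_sum)
      fix m assume "m \<in> {..<i}"
      then have m: "m < i" by simp
      define R where "R = {..<j} - {m, i}"
      have split: "{..<j} = insert m (insert i R)" "m \<notin> insert i R" "i \<notin> R"
        using m ij by (auto simp: R_def)
      have fin: "finite R" by (simp add: R_def)
      have R: "(\<Sum>l\<in>R. B l j) * B m i = B m i * (\<Sum>l\<in>R. B l j)"
        by (rule HOL.sym, rule commute_sum, rule disj) (use m ij in \<open>auto simp: R_def\<close>)
      have b1: "B m i * B m j = B i j * B m i"
        using m ij by (intro braid) auto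
      have b2: "B m i * B i j = B m j * B m i"
        using braid[of i m j] m ij by (auto simp: sym[of i m])
      have Sj: "Sj = B m j + (B i j + (\<Sum>l\<in>R. B l j))"
        unfolding Sj_def split(1) using split(2,3) fin by simp
      show "Sj * B m i = B m i * Sj"
        unfolding Sj using R b1 b2 by (simp add: distrib_left distrib_right)
    qed
    have "(A i + Si) * (A j + Sj) - (A j + Sj) * (A i + Si)
      = (A i * A j - A j * A i) + (A i * Sj - Sj * A i) + (Si * A j - A j * Si) + (Si * Sj - Sj * Si)"
      by (simp add: algebra_simps)
    also have "\<dots> = 0"
      using ij by (simp add: 1 2 3 AA left_diff_distrib)
    finally show ?thesis by (simp add: Si_def Sj_def)
  qed
  show ?thesis
    using main[of i j] main[of j i] by (cases i j rule: linorder_cases) auto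
qed

section \<open>Dunkl operators\<close>

locale dunkl_parameters =
  fixes k kc :: complex
begin

text \<open>The Dunkl operators in real directions; by linearity nothing is lost, and the Weyl group acts on the index.\<close>

definition Y :: "real ^ 'n::{finite,linorder} \<Rightarrow> 'n endo" where
  "Y v = Endo (dunkl k kc (\<chi> i. of_real (v $ i)))"

lemma dunkl_real: "dunkl k kc (\<chi> i. of_real (v $ i)) p
    = (\<Sum>i\<in>UNIV. scal (of_real (v $ i)) * partial i p)
    + scal (1 / 2) * (\<Sum>\<alpha>\<in>roots_B. scal (kbar k kc \<alpha> * of_real (\<alpha> \<bullet> v)) * div_diff \<alpha> p)"
  by (simp add: dunkl_def dir_deriv_def cscale_eq_mult pairing_def inner_vec_def)

lemma app_Y: "app (Y v) p = (\<Sum>i\<in>UNIV. scal (of_real (v $ i)) * partial i p)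
    + scal (1 / 2) * (\<Sum>\<alpha>\<in>roots_B. scal (kbar k kc \<alpha> * of_real (\<alpha> \<bullet> v)) * div_diff \<alpha> p)"
proof -
  let ?f = "dunkl k kc (\<chi> i. of_real (v $ i))"
  have "?f (p + q) = ?f p + ?f q" for p q
    by (simp add: dunkl_real partial_add div_diff_add distrib_left sum.distrib)
  moreover have "?f (scal c * p) = scal c * ?f p" for c p
    by (simp add: dunkl_real partial_scal_mult div_diff_scal_mult distrib_left sum_distrib_left
        mult.left_commute[of "scal c"])
  ultimately have "?f \<in> carrier End_P" by (simp add: End_P_iff)
  then show ?thesis by (simp add: Y_def Endo_inverse dunkl_real)
qed

lemma app_Y_basis:
  fixes j :: "'n::{finite,linorder}"
  shows "app (Y (basis_vec j)) p = dunkl k kc (axis j 1) p"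
proof -
  have "(\<chi> i. of_real (basis_vec j $ i)) = (axis j 1 :: (complex, 'n) vec)"
    by (simp add: vec_eq_iff axis_def)
  then show ?thesis by (simp only: app_Y flip: dunkl_real)
qed

lemma Y_one: "app (Y v) 1 = 0"
  by (simp add: app_Y partial_one div_diff_one)

lemma Y_add: "Y (u + v) = Y u + Y v"
  by (rule endo_eqI)
    (simp add: app_Y inner_add_right single_add algebra_simps sum.distrib)

lemma Y_scaleR: "Y (c *\<^sub>R v) = escal (of_real c) * Y v"
  by (rule endo_eqI)
    (simp add: app_Y distrib_left sum_distrib_left mult_single mult.left_commute flip: mult.assoc)

lemma Y_diff: "Y (u - v) = Y u - Y v"
  using Y_add[of "u - v" v] by simp

lemma W_op_Y: "W_op w * Y v = Y (weyl_fun w v) * W_op w"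
proof (rule endo_eqI)
  fix p
  have "(\<Sum>i\<in>UNIV. scal (of_real (weyl_fun w v $ i)) * partial i (weyl_act w p))
     = (\<Sum>j\<in>UNIV. scal (of_real (v $ j)) * weyl_act w (partial j p))"
  proof -
    have coord: "weyl_fun w v $ i = (\<Sum>j\<in>UNIV. v $ j * weyl_fun w (basis_vec j) $ i)" for i
    proof -
      have "weyl_fun w v = (\<Sum>j\<in>UNIV. v $ j *\<^sub>R weyl_fun w (basis_vec j))"
        by (subst basis_vec_expansion[symmetric, of v])
          (simp only: linear_sum[OF linear_weyl_fun] linear_cmul[OF linear_weyl_fun])
      then show ?thesis by simp
    qed
    show ?thesis
      unfolding weyl_act_partial coord
      by (simp add: scal_sum sum_distrib_left sum_distrib_right mult_single flip: mult.assoc)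
        (rule sum.swap)
  qed
  moreover have "(\<Sum>\<alpha>\<in>roots_B. scal (kbar k kc \<alpha> * of_real (\<alpha> \<bullet> weyl_fun w v)) * div_diff \<alpha> (weyl_act w p))
     = (\<Sum>\<alpha>\<in>roots_B. scal (kbar k kc \<alpha> * of_real (\<alpha> \<bullet> v)) * weyl_act w (div_diff \<alpha> p))"
    by (subst sum.reindex_bij_betw[OF bij_weyl_fun_roots, symmetric, of _ w])
      (simp add: kbar_weyl_fun inner_weyl_fun div_diff_weyl_act)
  ultimately show "app (W_op w * Y v) p = app (Y (weyl_fun w v) * W_op w) p"
    by (simp add: app_Y weyl_act.add weyl_act.mult weyl_act.scal weyl_act.sum)
qed

text \<open>The commutator of \<open>Y u\<close> with the multiplication by the linear form \<open>v\<close>.\<close>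

definition E :: "real ^ 'n::{finite,linorder} \<Rightarrow> (real, 'n) vec \<Rightarrow> 'n endo" where
  "E u v = escal (of_real (u \<bullet> v))
    + (\<Sum>\<alpha>\<in>roots_B. escal (kbar k kc \<alpha> * of_real ((\<alpha> \<bullet> u) * (\<alpha> \<bullet> v) / (\<alpha> \<bullet> \<alpha>))) * W_op (weyl_refl \<alpha>))"

lemma E_commute: "E u v = E v u"
  by (simp add: E_def inner_commute mult.commute)

text \<open>The symmetry of \<open>E\<close> is what makes the Dunkl operators commute.\<close>

lemma Y_Mul_lin: "Y u * Mul (lin_elem v) = Mul (lin_elem v) * Y u + E u v"
proof (rule endo_eqI)
  fix p
  have 1: "(\<Sum>i\<in>UNIV. scal (of_real (u $ i)) * partial i (lin_elem v * p))
     = lin_elem v * (\<Sum>i\<in>UNIV. scal (of_real (u $ i)) * partial i p) + scal (of_real (u \<bullet> v)) * p"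
    by (simp add: partial_mult partial_lin_elem distrib_left sum.distrib sum_distrib_left scal_sum
        inner_vec_def mult_single sum_distrib_right mult.left_commute add.commute flip: mult.assoc)
  have "scal (1 / 2) * (\<Sum>\<alpha>\<in>roots_B. scal (kbar k kc \<alpha> * of_real (\<alpha> \<bullet> u)) * div_diff \<alpha> (lin_elem v * p))
     = lin_elem v * (scal (1 / 2) * (\<Sum>\<alpha>\<in>roots_B. scal (kbar k kc \<alpha> * of_real (\<alpha> \<bullet> u)) * div_diff \<alpha> p))
     + (\<Sum>\<alpha>\<in>roots_B. scal (1 / 2) * (scal (kbar k kc \<alpha> * of_real (\<alpha> \<bullet> u)) * (scal (of_real (coroot \<alpha> v)) * weyl_act (weyl_refl \<alpha>) p)))"
    unfolding sum_distrib_left sum.distrib[symmetric]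
    by (rule sum.cong[OF HOL.refl], subst div_diff_mult)
      (simp_all add: div_diff_lin_elem distrib_left mult_ac)
  also have "(\<Sum>\<alpha>\<in>roots_B. scal (1 / 2) * (scal (kbar k kc \<alpha> * of_real (\<alpha> \<bullet> u)) * (scal (of_real (coroot \<alpha> v)) * weyl_act (weyl_refl \<alpha>) p)))
     = (\<Sum>\<alpha>\<in>roots_B. scal (kbar k kc \<alpha> * of_real ((\<alpha> \<bullet> u) * (\<alpha> \<bullet> v) / (\<alpha> \<bullet> \<alpha>))) * weyl_act (weyl_refl \<alpha>) p)"
    by (rule sum.cong) (simp_all add: coroot_def mult_single flip: mult.assoc)
  finally show "app (Y u * Mul (lin_elem v)) p = app (Mul (lin_elem v) * Y u + E u v) p"
    using 1 by (simp add: app_Y E_def algebra_simps)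
qed

text \<open>Conjugation with the reflection in \<open>\<alpha>\<close> changes \<open>Y u\<close> by a multiple of \<open>Y \<alpha>\<close>. So the left-hand side is a sum
  over the roots in which \<open>u\<close> and \<open>v\<close> enter only through \<open>(\<alpha> \<bullet> u) (\<alpha> \<bullet> v)\<close>.\<close>

lemma Y_commutator_E:
  fixes u v x :: "real ^ 'n::{finite,linorder}"
  shows "Y u * E v x - E v x * Y u = Y v * E u x - E u x * Y v"
proof -
  have refl: "(Y u :: 'n endo) * W_op (weyl_refl \<alpha>) - W_op (weyl_refl \<alpha>) * Y u
      = escal (of_real (coroot \<alpha> u)) * (Y \<alpha> * W_op (weyl_refl \<alpha>))"
    if "\<alpha> \<in> roots_B" for \<alpha> u :: "(real, 'n) vec"
  proof -
    have "W_op (weyl_refl \<alpha>) * Y u = (Y u - escal (of_real (coroot \<alpha> u)) * Y \<alpha>) * W_op (weyl_refl \<alpha>)"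
      by (simp only: W_op_Y weyl_fun_refl[OF that] reflection_def Y_diff Y_scaleR)
    then show ?thesis by (simp add: algebra_simps)
  qed
  have gen: "Y u * E v x - E v x * Y u
    = (\<Sum>\<alpha>\<in>roots_B. escal (kbar k kc \<alpha> * of_real ((\<alpha> \<bullet> v) * (\<alpha> \<bullet> x) / (\<alpha> \<bullet> \<alpha>) * coroot \<alpha> u))
        * (Y \<alpha> * W_op (weyl_refl \<alpha>)))" (is "_ = ?R") for u v :: "(real, 'n) vec"
  proof -
    let ?c = "\<lambda>\<alpha>. escal (kbar k kc \<alpha> * of_real ((\<alpha> \<bullet> v) * (\<alpha> \<bullet> x) / (\<alpha> \<bullet> \<alpha>))) :: 'n endo"
    have "Y u * E v x - E v x * Y u
      = (\<Sum>\<alpha>\<in>roots_B. Y u * (?c \<alpha> * W_op (weyl_refl \<alpha>)) - ?c \<alpha> * W_op (weyl_refl \<alpha>) * Y u)"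
      by (simp add: E_def distrib_left distrib_right sum_distrib_left sum_distrib_right sum_subtractf
          escal.sc_central)
    also have "\<dots> = (\<Sum>\<alpha>\<in>roots_B. ?c \<alpha> * (Y u * W_op (weyl_refl \<alpha>) - W_op (weyl_refl \<alpha>) * Y u))"
      by (rule sum.cong) (simp_all add: right_diff_distrib mult.assoc[symmetric] escal.sc_central[of _ "Y u"])
    also have "\<dots> = ?R"
      by (rule sum.cong) (simp_all only: refl mult.assoc[symmetric] escal.sc_mult[symmetric] of_real_mult)
    finally show ?thesis .
  qed
  show ?thesis
    unfolding gen by (simp add: coroot_def algebra_simps)
qed

text \<open>
  The commutator of two Dunkl operators commutes with all multiplications, by the previous lemma,
  and kills \<open>1\<close>.
\<close>

lemma Y_commute: "Y u * Y v = Y v * Y u"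
proof -
  define C where "C = Y u * Y v - Y v * Y u"
  have lin: "C * Mul (lin_elem x) = Mul (lin_elem x) * C" for x
  proof -
    let ?X = "Mul (lin_elem x)"
    have m: "Y a * (Y b * ?X) = ?X * Y a * Y b + E a x * Y b + Y a * E b x" for a b
    proof -
      have "Y a * (Y b * ?X) = (Y a * ?X) * Y b + Y a * E b x"
        by (simp only: Y_Mul_lin[of b] distrib_left mult.assoc)
      then show ?thesis by (simp only: Y_Mul_lin[of a] distrib_right)
    qed
    have "C * ?X = ?X * C + ((Y u * E v x - E v x * Y u) - (Y v * E u x - E u x * Y v))"
      by (simp add: C_def left_diff_distrib right_diff_distrib mult.assoc[of "Y _" "Y _" ?X] m
          mult.assoc[of ?X])
    then show ?thesis by (simp add: Y_commutator_E[of u v])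
  qed
  have "C * Mul p = Mul p * C" for p
  proof (induction p rule: sym_alg_induct)
    case (scal c)
    then show ?case by (simp add: escal.sc_central flip: escal_def)
  next
    case (var i)
    then show ?case using lin[of "basis_vec i"] by (simp add: lin_elem_basis)
  next
    case (add p q)
    then show ?case by (simp add: alg_map.add[OF Mul_alg_map] algebra_simps)
  next
    case (mult p q)
    then show ?case by (simp add: alg_map.mult[OF Mul_alg_map]) (metis mult.assoc)
  qed
  then have "app (C * Mul p) 1 = app (Mul p * C) 1" for p by simp
  then have "app C p = 0" for p by (simp add: C_def Y_one)
  then have "C = 0" by (intro endo_eqI) simp
  then show ?thesis by (simp add: C_def)
qed

section \<open>Commutation of the operators \<open>D\<^sub>j\<close>\<close>

definition A_op :: "'n \<Rightarrow> 'n::{finite,linorder} endo" where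
  "A_op i = Mul (var i) * Y (basis_vec i)"

text \<open>The operator of the element \<open>k (1 + t\<^sub>i t\<^sub>j)\<close> of the group algebra.\<close>

definition K_op :: "'n \<Rightarrow> 'n \<Rightarrow> 'n::{finite,linorder} endo" where
  "K_op i j = escal k * (1 + W_op (tau i) * W_op (tau j))"

definition B_op :: "'n \<Rightarrow> 'n \<Rightarrow> 'n::{finite,linorder} endo" where
  "B_op i j = K_op i j * W_op (sigma i j)"

lemma roots_two_coords:
  assumes "\<alpha> \<in> roots_B" "\<alpha> $ i \<noteq> 0" "\<alpha> $ j \<noteq> 0" "i \<noteq> j"
  shows "\<alpha> \<in> {basis_vec i - basis_vec j, - (basis_vec i - basis_vec j),
    basis_vec i + basis_vec j, - (basis_vec i + basis_vec j)}"
  using assms unfolding roots_B_def long_roots_def short_roots_def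
  by (auto split: if_splits)

text \<open>Only the four roots \<open>\<plusminus>\<epsilon>\<^sub>i \<plusminus> \<epsilon>\<^sub>j\<close> pair nontrivially with both basis vectors.\<close>

lemma E_basis:
  fixes i j :: "'n::{finite,linorder}"
  assumes "i \<noteq> j"
  shows "E (basis_vec i) (basis_vec j)
    = - (escal k * (1 - W_op (tau i) * W_op (tau j)) * W_op (sigma i j))"
proof -
  let ?S = "{basis_vec i - basis_vec j, - (basis_vec i - basis_vec j),
    basis_vec i + basis_vec j, - (basis_vec i + basis_vec j)}"
  let ?f = "\<lambda>\<alpha>. escal (kbar k kc \<alpha> * of_real (\<alpha> $ i * \<alpha> $ j / (\<alpha> \<bullet> \<alpha>))) * W_op (weyl_refl \<alpha>)"
  have long: "\<alpha> \<in> long_roots" if "\<alpha> \<in> ?S" for \<alpha>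
  proof -
    have "- (basis_vec i - basis_vec j) \<in> long_roots"
      using basis_diff_long[of j i] assms by simp
    moreover have "- (basis_vec i + basis_vec j) \<in> long_roots"
      unfolding long_roots_eq using assms
      by (intro CollectI exI[of _ "- basis_vec i"] exI[of _ "- basis_vec j"]) (simp add: minus_short_roots)
    ultimately show ?thesis using that assms by (auto simp: basis_diff_long basis_add_long)
  qed
  have val: "?f \<alpha> = escal (k * of_real (\<alpha> $ i * \<alpha> $ j / 2)) * W_op (weyl_refl \<alpha>)" if "\<alpha> \<in> ?S" for \<alpha>
    using long[OF that] by (simp add: kbar_def inner_long_self)
  have nth: "(basis_vec i :: (real, 'n) vec) $ j = 0" "(basis_vec j :: (real, 'n) vec) $ i = 0"
    "(basis_vec i :: (real, 'n) vec) $ i = 1" "(basis_vec j :: (real, 'n) vec) $ j = 1"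
    using assms by auto
  have d: "u \<noteq> v" if "u $ i \<noteq> v $ i \<or> u $ j \<noteq> v $ j" for u v :: "(real, 'n) vec"
    using that by auto
  have "E (basis_vec i) (basis_vec j) = (\<Sum>\<alpha>\<in>roots_B. ?f \<alpha>)"
    using assms by (simp add: E_def escal.sc_zero)
  also have "\<dots> = (\<Sum>\<alpha>\<in>?S. ?f \<alpha>)"
  proof (rule sum.mono_neutral_right)
    show "?S \<subseteq> roots_B" using long by (auto simp: roots_B_def)
    show "\<forall>\<alpha>\<in>roots_B - ?S. ?f \<alpha> = 0"
      using roots_two_coords[OF _ _ _ assms] by (metis (no_types, lifting) DiffE div_0 escal.sc_zero
          mult_eq_0_iff mult_zero_left of_real_0)
  qed (rule finite_roots_B)
  also have "\<dots> = (\<Sum>\<alpha>\<in>?S. escal (k * of_real (\<alpha> $ i * \<alpha> $ j / 2)) * W_op (weyl_refl \<alpha>))"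
    by (rule sum.cong) (simp_all only: val)
  also have "\<dots> = escal (- k / 2) * W_op (sigma i j) + (escal (- k / 2) * W_op (sigma i j)
      + (escal (k / 2) * W_op (weyl_refl (basis_vec i + basis_vec j))
      + escal (k / 2) * W_op (weyl_refl (basis_vec i + basis_vec j))))"
  proof -
    let ?p = "basis_vec i - basis_vec j" and ?q = "basis_vec i + basis_vec j"
    have "?p \<noteq> - ?p" "?p \<noteq> ?q" "?p \<noteq> - ?q" "- ?p \<noteq> ?q" "- ?p \<noteq> - ?q" "?q \<noteq> - ?q"
      using assms by (intro d; simp)+
    then have "?p \<notin> {- ?p, ?q, - ?q}" "- ?p \<notin> {?q, - ?q}" "?q \<notin> {- ?q}"
      by blast+
    then show ?thesis
      by (simp only: sum.insert finite.intros sum.empty weyl_refl_minus not_False_eq_True)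
        (use weyl_refl_minus[of ?q] assms in simp)
  qed
  also have "\<dots> = escal (- k) * W_op (sigma i j) + escal k * W_op (weyl_refl (basis_vec i + basis_vec j))"
  proof -
    have "escal k = escal (k / 2) + (escal (k / 2) :: 'n endo)" for k
      using escal.sc_add[of "k / 2" "k / 2"] by simp
    from this[of k] this[of "- k"] show ?thesis by (simp add: distrib_right add.assoc)
  qed
  also have "\<dots> = - (escal k * (1 - W_op (tau i) * W_op (tau j)) * W_op (sigma i j))"
  proof -
    have "escal (- k) = - (escal k :: 'n endo)"
      using escal.sc_add[of k "- k"] by (simp add: escal.sc_zero eq_neg_iff_add_eq_0 add.commute)
    then show ?thesis
      using assms by (simp add: refl_add_eq W_op_add algebra_simps)
  qed
  finally show ?thesis .
qed

lemma W_tau_Mul: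
  fixes i j :: "'n::{finite,linorder}"
  shows "W_op (tau i) * Mul (var j) = (if i = j then - 1 else 1) * (Mul (var j) * W_op (tau i))"
proof -
  have "Mul (- p) = - (Mul p :: 'n endo)" for p
    by (rule endo_eqI) simp
  then show ?thesis
    by (simp add: W_op_Mul weyl_act_var tau_basis lin_elem_minus lin_elem_basis)
qed

lemma W_sigma_Mul:
  "i \<noteq> j \<Longrightarrow> W_op (sigma i j) * Mul (var l) = Mul (var (Transposition.transpose i j l)) * W_op (sigma i j)"
  by (simp add: W_op_Mul weyl_act_var sigma_basis lin_elem_basis)

lemma W_tau_Y:
  fixes i j :: "'n::{finite,linorder}"
  shows "W_op (tau i) * Y (basis_vec j) = (if i = j then - 1 else 1) * (Y (basis_vec j) * W_op (tau i))"
proof -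
  have "Y (- v) = - (Y v :: 'n endo)" for v
    using Y_diff[of 0 v] Y_diff[of v v] by simp
  then show ?thesis by (simp add: W_op_Y tau_basis)
qed

lemma W_sigma_Y:
  "i \<noteq> j \<Longrightarrow> W_op (sigma i j) * Y (basis_vec l)
    = Y (basis_vec (Transposition.transpose i j l)) * W_op (sigma i j)"
  by (simp add: W_op_Y sigma_basis)

lemma W_tau_A: "W_op (tau i) * A_op j = A_op j * W_op (tau i)"
proof -
  have "W_op (tau i) * A_op j = (W_op (tau i) * Mul (var j)) * Y (basis_vec j)"
    by (simp add: A_op_def mult.assoc)
  also have "\<dots> = (if i = j then - 1 else 1) * (Mul (var j) * (W_op (tau i) * Y (basis_vec j)))"
    by (simp add: W_tau_Mul mult.assoc)
  also have "\<dots> = A_op j * W_op (tau i)"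
    by (simp add: W_tau_Y A_op_def mult.assoc)
  finally show ?thesis .
qed

lemma W_sigma_A:
  assumes "i \<noteq> j"
  shows "W_op (sigma i j) * A_op l = A_op (Transposition.transpose i j l) * W_op (sigma i j)"
proof -
  have "W_op (sigma i j) * A_op l = (W_op (sigma i j) * Mul (var l)) * Y (basis_vec l)"
    by (simp add: A_op_def mult.assoc)
  also have "\<dots> = A_op (Transposition.transpose i j l) * W_op (sigma i j)"
    by (simp add: W_sigma_Mul[OF assms] W_sigma_Y[OF assms] A_op_def mult.assoc)
  finally show ?thesis .
qed

lemma W_tau_tau: "W_op (tau i) * W_op (tau j) = W_op (tau j) * W_op (tau i)"
  by (metis W_op_add tau_comm)

lemma W_tau_sq: "W_op (tau i) * W_op (tau i) = 1"
  by (metis W_op_add W_op_zero basis_vec_root weyl_refl_self)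

lemma W_sigma_sq: "i \<noteq> j \<Longrightarrow> W_op (sigma i j) * W_op (sigma i j) = 1"
  by (metis W_op_add W_op_zero basis_diff_root weyl_refl_self)

lemma W_sigma_tau:
  "i \<noteq> j \<Longrightarrow> W_op (sigma i j) * W_op (tau l) = W_op (tau (Transposition.transpose i j l)) * W_op (sigma i j)"
  by (metis W_op_add sigma_tau)

lemma W_sigma_sigma:
  "i \<noteq> j \<Longrightarrow> l \<noteq> m \<Longrightarrow> W_op (sigma i j) * W_op (sigma l m)
    = W_op (sigma (Transposition.transpose i j l) (Transposition.transpose i j m)) * W_op (sigma i j)"
  by (metis W_op_add sigma_sigma)

lemma K_op_commute: "K_op i j = K_op j i"
  by (simp add: K_op_def W_tau_tau[of i j])

lemma W_tau_K: "W_op (tau l) * K_op i j = K_op i j * W_op (tau l)"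
  unfolding K_op_def by (intro commute_mult commute_add W_tau_tau escal.sc_central[symmetric]) simp

lemma K_tau: "K_op i j * W_op (tau i) = K_op i j * W_op (tau j)"
proof -
  have "W_op (tau i) * W_op (tau j) * W_op (tau i) = W_op (tau j)"
    by (simp only: W_tau_tau[of i j] mult.assoc W_tau_sq mult_1_right)
  moreover have "W_op (tau i) * W_op (tau j) * W_op (tau j) = W_op (tau i)"
    by (simp only: mult.assoc W_tau_sq mult_1_right)
  ultimately show ?thesis by (simp add: K_op_def mult.assoc[of "escal k"] distrib_right add.commute)
qed

lemma K_A: "K_op i j * A_op l = A_op l * K_op i j"
  by (rule sym, unfold K_op_def, intro commute_mult commute_add escal.sc_central[symmetric] W_tau_A[symmetric]) simp

lemma K_K: "K_op i j * K_op l m = K_op l m * K_op i j"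
  unfolding K_op_def[of l m]
  by (intro commute_mult commute_add escal.sc_central[symmetric] W_tau_K[symmetric]) simp

lemma W_sigma_K:
  "i \<noteq> j \<Longrightarrow> W_op (sigma i j) * K_op l m
    = K_op (Transposition.transpose i j l) (Transposition.transpose i j m) * W_op (sigma i j)"
  by (simp add: K_op_def distrib_left distrib_right mult.assoc W_sigma_tau
      escal.sc_central[of _ "W_op (sigma i j)", symmetric] flip: mult.assoc[of "W_op (sigma i j)"])

lemma escal_left: "x * (escal c * y) = escal c * (x * y)"
  by (simp only: mult.assoc[symmetric] escal.sc_central[of c x])

lemma escal_mult_mult: "escal a * x * (escal b * y) = escal a * escal b * (x * y)"
proof -
  have "escal a * x * (escal b * y) = escal a * (x * escal b) * y" by (simp only: mult.assoc)
  also have "\<dots> = escal a * escal b * (x * y)" by (simp only: escal.sc_central[of b x, symmetric] mult.assoc)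
  finally show ?thesis .
qed

lemma K_K_distinct: "K_op i j * K_op j l = K_op j l * K_op i l"
proof -
  let ?t = "\<lambda>i. W_op (tau i)"
  have K: "K_op a b * K_op c d = escal k * escal k * ((1 + ?t a * ?t b) * (1 + ?t c * ?t d))" for a b c d :: 'a
    unfolding K_op_def by (rule escal_mult_mult)
  have 1: "?t i * ?t j * (?t j * ?t l) = ?t i * ?t l"
    by (simp only: mult.assoc mult.assoc[of "?t j" "?t j", symmetric] W_tau_sq mult_1_left)
  have "?t l * (?t i * ?t l) = ?t i"
    by (simp only: W_tau_tau[of i l] mult.assoc[symmetric] W_tau_sq mult_1_left)
  then have 2: "?t j * ?t l * (?t i * ?t l) = ?t i * ?t j"
    by (simp only: mult.assoc W_tau_tau[of j i])
  show ?thesis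
    unfolding K by (simp add: distrib_left distrib_right 1 2 add_ac)
qed

lemma B_op_commute: "B_op i j = B_op j i"
  by (simp add: B_op_def K_op_commute[of i j] sigma_commute[of i j])

lemma W_tau_B:
  assumes "i \<noteq> j"
  shows "W_op (tau l) * B_op i j = B_op i j * W_op (tau l)"
proof -
  have "B_op i j * W_op (tau l) = K_op i j * W_op (tau (Transposition.transpose i j l)) * W_op (sigma i j)"
    by (simp add: B_op_def mult.assoc W_sigma_tau assms)
  also have "K_op i j * W_op (tau (Transposition.transpose i j l)) = K_op i j * W_op (tau l)"
    by (auto simp: Transposition.transpose_def K_tau[of i j])
  also have "K_op i j * W_op (tau l) * W_op (sigma i j) = W_op (tau l) * B_op i j"
    by (simp only: W_tau_K[symmetric] B_op_def mult.assoc)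
  finally show ?thesis by simp
qed

lemma W_sigma_B:
  assumes "i \<noteq> j" "l \<noteq> m"
  shows "W_op (sigma i j) * B_op l m
    = B_op (Transposition.transpose i j l) (Transposition.transpose i j m) * W_op (sigma i j)"
proof -
  have "W_op (sigma i j) * B_op l m = (W_op (sigma i j) * K_op l m) * W_op (sigma l m)"
    by (simp only: B_op_def mult.assoc)
  then show ?thesis
    by (simp only: W_sigma_K[OF assms(1)] W_sigma_sigma[OF assms] mult.assoc B_op_def)
qed

lemma B_A:
  assumes "i \<noteq> j"
  shows "B_op i j * A_op l = A_op (Transposition.transpose i j l) * B_op i j"
proof -
  have "B_op i j * A_op l = (K_op i j * A_op (Transposition.transpose i j l)) * W_op (sigma i j)"
    by (simp only: B_op_def mult.assoc W_sigma_A[OF assms])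
  then show ?thesis by (simp only: K_A B_op_def mult.assoc)
qed

lemma B_B:
  assumes "i \<noteq> j" "l \<noteq> m"
  shows "B_op i j * B_op l m = K_op i j * K_op (Transposition.transpose i j l) (Transposition.transpose i j m)
    * (W_op (sigma (Transposition.transpose i j l) (Transposition.transpose i j m)) * W_op (sigma i j))"
proof -
  have "B_op i j * B_op l m = K_op i j * (W_op (sigma i j) * B_op l m)"
    by (simp add: B_op_def[of i j] mult.assoc)
  also have "\<dots> = K_op i j * (B_op (Transposition.transpose i j l) (Transposition.transpose i j m) * W_op (sigma i j))"
    by (simp only: W_sigma_B[OF assms])
  finally show ?thesis by (simp add: B_op_def mult.assoc)
qed

lemma B_B_disjoint:
  assumes "i \<noteq> j" "l \<noteq> m" "l \<noteq> i" "l \<noteq> j" "m \<noteq> i" "m \<noteq> j"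
  shows "B_op i j * B_op l m = B_op l m * B_op i j"
proof -
  have "B_op l m * B_op i j = K_op l m * (W_op (sigma l m) * K_op i j) * W_op (sigma i j)"
    by (simp add: B_op_def mult.assoc)
  also have "\<dots> = K_op l m * K_op i j * (W_op (sigma l m) * W_op (sigma i j))"
    using assms by (simp add: W_sigma_K Transposition.transpose_def mult.assoc)
  also have "\<dots> = B_op i j * B_op l m"
    using assms by (simp add: B_B Transposition.transpose_def K_K[of l m])
  finally show ?thesis by simp
qed

text \<open>The factors \<open>K_op\<close> on both sides agree: expanded, each product of two of them runs over all even
  sign changes in the three coordinates \<open>i\<close>, \<open>j\<close>, \<open>l\<close>.\<close>

lemma B_B_braid:
  assumes "i \<noteq> j" "i \<noteq> l" "j \<noteq> l"
  shows "B_op i j * B_op i l = B_op j l * B_op i j"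
proof -
  have "B_op j l * B_op i j = K_op j l * (W_op (sigma j l) * K_op i j) * W_op (sigma i j)"
    by (simp add: B_op_def mult.assoc)
  also have "\<dots> = K_op j l * K_op i l * (W_op (sigma j l) * W_op (sigma i j))"
    using assms by (simp add: W_sigma_K Transposition.transpose_def mult.assoc)
  also have "\<dots> = B_op i j * B_op i l"
    using assms by (simp add: B_B Transposition.transpose_def K_K_distinct[of i j l])
  finally show ?thesis by simp
qed

text \<open>Since \<open>A i * A j\<close> is the symmetric expression \<open>z\<^sub>i z\<^sub>j T\<^sub>i T\<^sub>j\<close> plus \<open>z\<^sub>i [T\<^sub>i, z\<^sub>j] T\<^sub>j\<close>, only the latter
  contributes. Moving \<open>z\<^sub>i\<close> past \<open>1 - t\<^sub>i t\<^sub>j\<close> turns it into \<open>1 + t\<^sub>i t\<^sub>j\<close>.\<close>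

lemma A_commutator:
  fixes i j :: "'n::{finite,linorder}"
  assumes "i \<noteq> j"
  shows "A_op i * A_op j - A_op j * A_op i = (A_op j - A_op i) * B_op i j"
proof -
  let ?X = "\<lambda>i. Mul (var i)" and ?Y = "\<lambda>i. Y (basis_vec i)" and ?t = "\<lambda>i. W_op (tau i)"
  have YX: "?Y i * ?X j = ?X j * ?Y i + E (basis_vec i) (basis_vec j)" for i j :: 'n
    using Y_Mul_lin[of "basis_vec i" "basis_vec j"] by (simp add: lin_elem_basis)
  have XX: "?X i * ?X j = ?X j * ?X i" for i j :: 'n
    by (rule endo_eqI) (simp add: mult.left_commute)
  have flip: "?X a * (1 - ?t i * ?t j) = (1 + ?t i * ?t j) * ?X a" if "a = i \<or> a = j" for a
  proof -
    have "?t i * (?t j * ?X a) = - (?X a * (?t i * ?t j))"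
      using that assms by (auto simp: W_tau_Mul mult.assoc[symmetric])
    then show ?thesis by (simp add: algebra_simps)
  qed
  have XEY: "?X a * E (basis_vec i) (basis_vec j) * ?Y b = - (A_op a * B_op i j)"
    if "(a, b) = (i, j) \<or> (a, b) = (j, i)" for a b :: 'n
  proof -
    have sY: "W_op (sigma i j) * ?Y b = ?Y a * W_op (sigma i j)"
      using that assms by (auto simp: W_sigma_Y Transposition.transpose_def)
    have Xk: "?X a * (escal k * (1 - ?t i * ?t j)) = K_op i j * ?X a"
      using flip[of a] that unfolding K_op_def mult.assoc[of "escal k"] escal_left by auto
    have "?X a * E (basis_vec i) (basis_vec j) * ?Y b
        = - ((?X a * (escal k * (1 - ?t i * ?t j))) * (W_op (sigma i j) * ?Y b))"
      unfolding E_basis[OF assms] by (simp only: mult.assoc mult_minus_left mult_minus_right)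
    also have "\<dots> = - (K_op i j * ?X a * (?Y a * W_op (sigma i j)))"
      by (simp only: sY Xk)
    also have "K_op i j * ?X a * (?Y a * W_op (sigma i j)) = K_op i j * A_op a * W_op (sigma i j)"
      by (simp only: A_op_def mult.assoc)
    also have "\<dots> = A_op a * B_op i j"
      by (simp only: K_A B_op_def mult.assoc)
    finally show ?thesis .
  qed
  have AA: "A_op a * A_op b = ?X a * ?X b * (?Y a * ?Y b) + ?X a * E (basis_vec a) (basis_vec b) * ?Y b" for a b :: 'n
  proof -
    have "A_op a * A_op b = ?X a * (?Y a * ?X b) * ?Y b" by (simp add: A_op_def mult.assoc)
    then show ?thesis by (simp only: YX distrib_left distrib_right mult.assoc)
  qed
  show ?thesis
    unfolding AA[of i j] AA[of j i] E_commute[of "basis_vec j"] XX[of j i] Y_commute[of "basis_vec j"]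
    using XEY[of i j] XEY[of j i] by (simp add: algebra_simps)
qed

definition D :: "'n \<Rightarrow> 'n::{finite,linorder} endo" where
  "D j = A_op j + (\<Sum>i\<in>{..<j}. B_op i j)"

lemma D_commute: "D i * D j = D j * D i"
  unfolding D_def
  by (rule commuting_sums; rule A_commutator B_A B_op_commute B_B_braid B_B_disjoint; assumption)

lemma W_tau_D: "W_op (tau l) * D j = D j * W_op (tau l)"
  unfolding D_def by (intro commute_add commute_sum W_tau_A W_tau_B) auto

text \<open>Since no index lies between \<open>i\<close> and \<open>j\<close>, the sums defining \<open>D i\<close> and \<open>D j\<close> differ in one term.\<close>

lemma W_sigma_D:
  assumes "i < j" and adj: "\<And>l. \<not> (i < l \<and> l < j)"
  shows "W_op (sigma i j) * D l = D (Transposition.transpose i j l) * W_op (sigma i j)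
    + (if l = i then - K_op i j else if l = j then K_op i j else 0)"
proof -
  let ?s = "W_op (sigma i j)" and ?p = "Transposition.transpose i j"
  have ij: "i \<noteq> j" using assms by auto
  have ss: "B_op i j * ?s = K_op i j" "?s * B_op i j = K_op i j"
  proof -
    show "B_op i j * ?s = K_op i j"
      by (simp add: B_op_def mult.assoc W_sigma_sq[OF ij])
    then show "?s * B_op i j = K_op i j"
      using W_sigma_B[OF ij ij] by (simp add: B_op_commute[of j i])
  qed
  have conj: "?s * D l = A_op (?p l) * ?s + (\<Sum>m\<in>{..<l}. B_op (?p m) (?p l)) * ?s"
    by (simp add: D_def distrib_left W_sigma_A[OF ij] sum_distrib_left sum_distrib_right W_sigma_B[OF ij])
  have le: "m < j \<longleftrightarrow> m < i \<or> m = i" for m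
    using assms by (metis linorder_neqE less_trans)
  consider "l = i" | "l = j" | "l \<noteq> i" "l \<noteq> j" by blast
  then show ?thesis
  proof cases
    case 1
    have "(\<Sum>m\<in>{..<i}. B_op (?p m) j) = (\<Sum>m\<in>{..<i}. B_op m j)"
      by (rule sum.cong) (use assms in \<open>auto simp: Transposition.transpose_def\<close>)
    moreover have "{..<j} = insert i {..<i}" by (auto simp: le)
    ultimately have "?s * D i = D j * ?s - B_op i j * ?s"
      by (simp add: conj[unfolded 1] D_def[of j] algebra_simps)
    then show ?thesis using 1 ij by (simp add: ss)
  next
    case 2
    have "(\<Sum>m\<in>{..<i}. B_op (?p m) i) = (\<Sum>m\<in>{..<i}. B_op m i)"
      by (rule sum.cong) (use assms in \<open>auto simp: Transposition.transpose_def\<close>)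
    moreover have "{..<j} = insert i {..<i}" by (auto simp: le)
    ultimately have "?s * D j = D i * ?s + B_op j i * ?s"
      by (simp add: conj[unfolded 2] D_def[of i] algebra_simps)
    then show ?thesis using 2 ij by (simp add: ss B_op_commute[of j i])
  next
    case 3
    have "?p m < l \<longleftrightarrow> m < l" for m
      using 3 assms by (auto simp: Transposition.transpose_def le) (metis le linorder_neqE less_trans)+
    then have "bij_betw ?p {..<l} {..<l}"
      by (intro bij_betwI[where g = ?p]) auto
    then have eq: "(\<Sum>m\<in>{..<l}. B_op (?p m) l) = (\<Sum>m\<in>{..<l}. B_op m l)"
      by (rule sum.reindex_bij_betw)
    have pl: "?p l = l" using 3 by (simp add: Transposition.transpose_def)
    have "?s * D l = D l * ?s"
      unfolding conj pl eq by (simp add: D_def distrib_right)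
    then show ?thesis using 3 pl by simp
  qed
qed

end

section \<open>Polynomials in the operators \<open>D\<^sub>j\<close>\<close>

lemma prod_list_power_add:
  fixes x :: "'n \<Rightarrow> 'r::ring_1"
  assumes comm: "\<And>i j. x i * x j = x j * x i"
  shows "(\<Prod>i\<leftarrow>L. x i ^ (f i + g i)) = (\<Prod>i\<leftarrow>L. x i ^ f i) * (\<Prod>i\<leftarrow>L. x i ^ g i)"
proof (induction L)
  case (Cons a L)
  have "x a ^ n * x i = x i * x a ^ n" for n i
    by (rule power_commuting_commutes) (rule comm)
  then have pp: "x a ^ n * x i ^ m = x i ^ m * x a ^ n" for n m i
    by (metis power_commuting_commutes)
  have comm': "x a ^ n * (\<Prod>i\<leftarrow>L. x i ^ f i) = (\<Prod>i\<leftarrow>L. x i ^ f i) * x a ^ n" for n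
    by (induction L) (simp, simp only: list.map prod_list.Cons, rule commute_mult[OF pp])
  have "x a ^ f a * x a ^ g a * ((\<Prod>i\<leftarrow>L. x i ^ f i) * (\<Prod>i\<leftarrow>L. x i ^ g i))
     = x a ^ f a * (x a ^ g a * (\<Prod>i\<leftarrow>L. x i ^ f i)) * (\<Prod>i\<leftarrow>L. x i ^ g i)"
    by (simp only: mult.assoc)
  also have "\<dots> = x a ^ f a * (\<Prod>i\<leftarrow>L. x i ^ f i) * (x a ^ g a * (\<Prod>i\<leftarrow>L. x i ^ g i))"
    by (simp only: comm'[of "g a"] mult.assoc)
  finally show ?case by (simp only: list.map prod_list.Cons Cons.IH power_add[of "x a"])
qed simp

lemma prod_list_ones: "(\<Prod>i\<leftarrow>L. 1) = (1 :: 'r::monoid_mult)"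
  by (induction L) simp_all

lemma prod_list_delta:
  fixes a :: "'r::monoid_mult"
  assumes "distinct L"
  shows "(\<Prod>i\<leftarrow>L. if i = j then a else 1) = (if j \<in> set L then a else 1)"
  using assms by (induction L) auto

definition deg :: "('n::finite \<Rightarrow>\<^sub>0 nat) \<Rightarrow> nat" where
  "deg m = (\<Sum>i\<in>UNIV. lookup m i)"

lemma deg_zero [simp]: "deg 0 = 0"
  by (simp add: deg_def)

lemma deg_add: "deg (m + m') = deg m + deg m'"
  by (simp add: deg_def lookup_add sum.distrib)

lemma deg_single [simp]: "deg (single i n) = n"
proof -
  have "deg (single i n) = (\<Sum>j\<in>UNIV. if j = i then n else 0)"
    unfolding deg_def by (rule sum.cong) (auto simp: lookup_single when_def)
  then show ?thesis by simp
qed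

abbreviation word_weight :: "'n list \<Rightarrow> 'n \<Rightarrow>\<^sub>0 nat" where
  "word_weight xs \<equiv> (\<Sum>x\<leftarrow>xs. single x 1)"

lemma deg_word_weight: "deg (word_weight xs) = length xs"
  by (induction xs) (simp_all add: deg_add)

lemma prod_list_power_word:
  "\<exists>xs. (\<Prod>i\<leftarrow>L. x i ^ f i) = (\<Prod>i\<leftarrow>xs. (x i :: 'r::monoid_mult))
    \<and> word_weight xs = (\<Sum>i\<leftarrow>L. single i (f i))"
proof (induction L)
  case Nil
  show ?case by (rule exI[of _ "[]"]) simp
next
  case (Cons a L)
  then obtain xs where xs: "(\<Prod>i\<leftarrow>L. x i ^ f i) = (\<Prod>i\<leftarrow>xs. x i)"
    "word_weight xs = (\<Sum>i\<leftarrow>L. single i (f i))" by blast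
  have "(\<Prod>i\<leftarrow>replicate n a. x i) = x a ^ n" for n
    by (induction n) simp_all
  moreover have "word_weight (replicate n a) = single a n" for n
    by (induction n) (simp_all flip: single_add)
  ultimately show ?case using xs by (intro exI[of _ "replicate (f a) a @ xs"]) simp
qed

definition grp_op :: "'n grp_alg \<Rightarrow> 'n::{finite,linorder} endo" where
  "grp_op = lin_ext escal W_op"

lemma grp_op_alg_map: "alg_map escal grp_op"
  unfolding grp_op_def by (rule escal.lin_ext_alg_map) (simp_all add: W_op_zero W_op_add)

lemma grp_op_grp: "grp_op (grp w) = W_op w"
  by (simp add: grp_op_def grp_def escal.lin_ext_single escal.sc_one)

lemma app_grp_op: "app (grp_op a) p = grp_alg_act a p"
  by (simp add: grp_op_def lin_ext_def grp_alg_act_def cscale_eq_mult)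

context dunkl_parameters
begin

lemma grp_op_ktilde: "grp_op (ktilde k i j) = K_op i j"
proof -
  interpret grp_op: alg_map escal grp_op by (rule grp_op_alg_map)
  show ?thesis
    by (simp add: ktilde_def grp_op.cscale grp_op.add grp_op.one grp_op.mult t_refl_def grp_op_grp K_op_def)
qed

lemma app_D: "app (D j) = D_op k kc j"
proof
  fix p
  have "grp_op (ktilde k i j * t_refl (basis_vec i - basis_vec j)) = B_op i j" for i
    by (simp add: alg_map.mult[OF grp_op_alg_map] grp_op_ktilde t_refl_def grp_op_grp B_op_def)
  then show "app (D j) p = D_op k kc j p"
    by (simp add: D_def D_op_def A_op_def zT_def app_Y_basis lin_elem_basis flip: app_grp_op)
qed

lemma app_A_op: "app (A_op j) = zT k kc j"
  by (rule ext) (simp add: A_op_def zT_def app_Y_basis lin_elem_basis)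

text \<open>The ring of operators is not commutative, so the product is taken in the order of the indices.\<close>

definition D_mono :: "('n \<Rightarrow>\<^sub>0 nat) \<Rightarrow> 'n::{finite,linorder} endo" where
  "D_mono m = (\<Prod>i\<leftarrow>sorted_list_of_set UNIV. D i ^ lookup m i)"

definition D_poly :: "'n sym_alg \<Rightarrow> 'n::{finite,linorder} endo" where
  "D_poly = lin_ext escal D_mono"

lemma D_poly_alg_map: "alg_map escal D_poly"
  unfolding D_poly_def
proof (rule escal.lin_ext_alg_map)
  show "D_mono 0 = 1" by (simp add: D_mono_def prod_list_ones)
  show "D_mono (m + m') = D_mono m * D_mono m'" for m m'
    unfolding D_mono_def lookup_add by (rule prod_list_power_add) (rule D_commute)
qed

lemma D_poly_var: "D_poly (var j) = D j"
proof -
  have "(\<lambda>i. D i ^ lookup (single j 1) i) = (\<lambda>i. if i = j then D j else 1)"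
    by (auto simp: lookup_single)
  then have "D_mono (single j 1) = D j"
    unfolding D_mono_def by (simp add: prod_list_delta)
  then show ?thesis by (simp add: D_poly_def var_def escal.lin_ext_single escal.sc_one)
qed

lemma D_poly_lin_elem: "D_poly (lin_elem v) = (\<Sum>i\<in>UNIV. escal (of_real (v $ i)) * D i)"
  by (simp add: lin_elem_eq alg_map.sum[OF D_poly_alg_map] alg_map.mult[OF D_poly_alg_map]
      alg_map.scal[OF D_poly_alg_map] D_poly_var)

text \<open>Words in the \<open>D\<^sub>j\<close> allow an induction in which one operator is applied at a time.\<close>

lemma D_mono_word: "\<exists>xs. D_mono m = (\<Prod>i\<leftarrow>xs. D i) \<and> word_weight xs = m"
proof -
  have "(\<Sum>i\<leftarrow>sorted_list_of_set UNIV. single i (lookup m i))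
      = (\<Sum>i\<in>UNIV. single i (lookup m i))"
    by (subst sum_list_distinct_conv_sum_set) simp_all
  also have "\<dots> = m"
    by (rule poly_mapping_eqI) (simp add: lookup_sum lookup_single when_def)
  finally show ?thesis
    using prod_list_power_word[of "\<lambda>i. D i" "lookup m" "sorted_list_of_set UNIV"]
    by (simp add: D_mono_def)
qed

end

section \<open>Order of vanishing along a regular orbit\<close>

text \<open>Membership in the \<open>r\<close>-th power of the maximal ideal at the origin.\<close>

definition order_ge :: "nat \<Rightarrow> 'n::finite sym_alg \<Rightarrow> bool" where
  "order_ge r q \<longleftrightarrow> (\<forall>m. deg m < r \<longrightarrow> lookup q m = 0)"

lemma order_ge_0 [simp]: "order_ge 0 q"
  by (simp add: order_ge_def)

lemma order_ge_mono: "order_ge r q \<Longrightarrow> s \<le> r \<Longrightarrow> order_ge s q"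
  by (simp add: order_ge_def)

lemma order_ge_add: "order_ge r p \<Longrightarrow> order_ge r q \<Longrightarrow> order_ge r (p + q)"
  by (simp add: order_ge_def lookup_add)

lemma order_ge_diff: "order_ge r p \<Longrightarrow> order_ge r q \<Longrightarrow> order_ge r (p - q)"
  by (simp add: order_ge_def lookup_minus)

lemma order_ge_sum: "(\<And>i. i \<in> I \<Longrightarrow> order_ge r (f i)) \<Longrightarrow> order_ge r (\<Sum>i\<in>I. f i)"
  by (simp add: order_ge_def lookup_sum)

lemma order_ge_single: "order_ge r (single m c)" if "r \<le> deg m"
  using that by (auto simp: order_ge_def lookup_single when_def)

lemma order_ge_mult:
  assumes "order_ge r p" "order_ge s q"
  shows "order_ge (r + s) (p * q)"
  unfolding order_ge_def
proof (intro allI impI, rule ccontr)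
  fix m :: "'a \<Rightarrow>\<^sub>0 nat" assume m: "deg m < r + s" "lookup (p * q) m \<noteq> 0"
  then have "m \<in> Poly_Mapping.keys (p * q)" by (simp add: in_keys_iff)
  then obtain a b where "m = a + b" "a \<in> Poly_Mapping.keys p" "b \<in> Poly_Mapping.keys q"
    using keys_mult[of p q] by blast
  with assms have "r \<le> deg a" "s \<le> deg b" by (auto simp: order_ge_def in_keys_iff not_less[symmetric])
  with m \<open>m = a + b\<close> show False by (simp add: deg_add)
qed

lemma order_ge_mult_left: "order_ge s q \<Longrightarrow> order_ge s (p * q)"
  using order_ge_mult[of 0 p s q] by simp

lemma order_ge_power: "order_ge r q \<Longrightarrow> order_ge (n * r) (q ^ n)"
  by (induction n) (simp_all add: order_ge_mult)

lemma order_ge_partial: "order_ge r p \<Longrightarrow> order_ge (r - 1) (partial i p)"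
  by (simp add: order_ge_def lookup_partial deg_add)

lemma lookup_scal_mult: "lookup (scal c * q) m = c * lookup q m"
  for m :: "'n \<Rightarrow>\<^sub>0 nat"
proof (induction q rule: poly_mapping_add_induct)
  case (single m' c')
  then show ?case by (simp add: mult_single lookup_single when_def)
qed (simp add: distrib_left lookup_add)

lemma order_ge_Suc_0: "order_ge (Suc 0) q \<longleftrightarrow> lookup q 0 = 0"
proof -
  have "deg m = 0 \<longleftrightarrow> m = 0" for m :: "'a \<Rightarrow>\<^sub>0 nat"
    by (auto simp: deg_def intro: poly_mapping_eqI)
  then show ?thesis by (simp add: order_ge_def)
qed

lemma order_ge_minus_const: "order_ge (Suc 0) (q - scal (lookup q 0))"
  by (simp add: order_ge_Suc_0 lookup_minus)

lemma lookup_mult_0: "lookup (p * q) 0 = lookup p 0 * lookup q 0"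
  for p q :: "'n::finite sym_alg"
proof -
  let ?p = "p - scal (lookup p 0)"
  have "order_ge (Suc 0) (?p * q)"
    using order_ge_mult[OF order_ge_minus_const[of p] order_ge_0[of q]] by simp
  then have "lookup (?p * q) 0 = 0" by (simp add: order_ge_Suc_0)
  moreover have "p * q = ?p * q + scal (lookup p 0) * q" by (simp add: algebra_simps)
  ultimately show ?thesis by (simp only: lookup_add lookup_scal_mult add_0_left)
qed

lemma lookup_power_0: "lookup (q ^ n) 0 = lookup q 0 ^ n"
  for q :: "'n::finite sym_alg"
  by (induction n) (simp_all add: lookup_mult_0)

lemma lookup_prod_0: "lookup (\<Prod>i\<in>I. f i) 0 = (\<Prod>i\<in>I. lookup (f i) 0)"
  for f :: "'i \<Rightarrow> 'n::finite sym_alg"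
  by (induction I rule: infinite_finite_induct) (simp_all add: lookup_mult_0)

text \<open>A polynomial with nonzero constant term is a unit in the ring of power series.\<close>

lemma order_ge_cancel:
  assumes "lookup u 0 \<noteq> 0" and "order_ge r (u * g)"
  shows "order_ge r g"
proof -
  have "s \<le> r \<Longrightarrow> order_ge s g" for s
  proof (induction s)
    case (Suc s)
    let ?c = "lookup u 0"
    have eq: "scal ?c * g = u * g - (u - scal ?c) * g"
      by (simp add: algebra_simps)
    have "order_ge (Suc s) ((u - scal ?c) * g)"
      using order_ge_mult[OF order_ge_minus_const, of s g u] Suc by simp
    then have "order_ge (Suc s) (scal ?c * g)"
      unfolding eq using Suc.prems assms(2) by (intro order_ge_diff) (auto intro: order_ge_mono)
    then show ?case using assms(1) by (simp add: order_ge_def lookup_scal_mult)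
  qed simp
  then show ?thesis by simp
qed

text \<open>Coordinates that are distinct and positive: no reflection of the Weyl group fixes this point.\<close>

definition base_pt :: "'n::{finite,linorder} \<Rightarrow> real" where
  "base_pt i = real (card {..i})"

lemma base_pt_pos: "base_pt i > 0"
  unfolding base_pt_def by (simp add: card_gt_0_iff)

lemma base_pt_inj: "base_pt i = base_pt j \<Longrightarrow> i = j"
proof (rule ccontr)
  assume eq: "base_pt i = base_pt j" and "i \<noteq> j"
  have less: "base_pt a < base_pt b" if "a < b" for a b :: 'a
  proof -
    have "{..a} \<subset> {..b}" using that by (auto simp: psubset_eq)
    then show ?thesis unfolding base_pt_def by (simp add: psubset_card_mono)
  qed
  from \<open>i \<noteq> j\<close> consider "i < j" | "j < i" by force
  then show False using less[of i j] less[of j i] eq by cases auto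
qed

definition ev_pt :: "real ^ 'n::{finite,linorder} \<Rightarrow> real" where
  "ev_pt v = v \<bullet> (\<chi> i. base_pt i)"

lemma ev_pt_basis [simp]: "ev_pt (basis_vec i) = base_pt i"
  by (simp add: ev_pt_def)

lemma ev_pt_short: "u \<in> short_roots \<Longrightarrow> ev_pt u \<noteq> 0"
proof (elim short_rootsE)
  fix a i assume "a = 1 \<or> a = - 1" "u = a *\<^sub>R basis_vec i"
  then show ?thesis using base_pt_pos[of i] by (auto simp: ev_pt_def)
qed

lemma ev_pt_short_inj:
  assumes "u \<in> short_roots" "v \<in> short_roots" "ev_pt u = ev_pt v"
  shows "u = v"
  using assms
proof (elim short_rootsE)
  fix a b :: real and i j
  assume ab: "a = 1 \<or> a = - 1" "b = 1 \<or> b = - 1" and u: "u = a *\<^sub>R basis_vec i" "v = b *\<^sub>R basis_vec j"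
  from assms(3) have "a * base_pt i = b * base_pt j" by (simp add: u ev_pt_def)
  then show "u = v" using ab base_pt_pos[of i] base_pt_pos[of j] base_pt_inj[of i j] by (auto simp: u)
qed

lemma ev_pt_root:
  assumes "\<alpha> \<in> roots_B"
  shows "ev_pt \<alpha> \<noteq> 0"
proof (cases "\<alpha> \<in> long_roots")
  case True
  then obtain u v where uv: "\<alpha> = u + v" "u \<in> short_roots" "v \<in> short_roots" "u \<bullet> v = 0"
    by (rule long_rootsE)
  show ?thesis
  proof
    assume "ev_pt \<alpha> = 0"
    then have "ev_pt u = ev_pt (- v)" by (simp add: uv(1) ev_pt_def inner_add_left)
    then have "u = - v" using ev_pt_short_inj uv minus_short_roots by blast
    then show False using uv inner_short_self[of v] by simp
  qed
next
  case False
  then show ?thesis using assms ev_pt_short by (simp add: roots_B_def)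
qed

text \<open>Taylor expansion at the base point.\<close>

definition shift :: "'n sym_alg \<Rightarrow> 'n::{finite,linorder} sym_alg" where
  "shift = subst (\<lambda>i. var i + scal (of_real (base_pt i)))"

interpretation shift: alg_map scal shift
  unfolding shift_def by (rule subst_alg_map)

lemma shift_var: "shift (var i) = var i + scal (of_real (base_pt i))"
  by (simp add: shift_def subst_var)

lemma lookup_var_0: "lookup (var i) 0 = 0"
proof -
  have "single i (Suc 0) \<noteq> 0"
    by (metis lookup_single_eq lookup_zero nat.distinct(1))
  then show ?thesis by (simp add: var_def lookup_single when_def)
qed

lemma lookup_shift_lin: "lookup (shift (lin_elem v)) 0 = of_real (ev_pt v)"
  by (simp add: lin_elem_eq shift.sum shift.mult shift.scal shift_var lookup_sum lookup_scal_mult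
      lookup_add lookup_var_0 ev_pt_def inner_vec_def)

lemma partial_shift: "partial i (shift p) = shift (partial i p)"
proof (induction p rule: sym_alg_induct)
  case (var j)
  then show ?case by (simp add: shift_var partial_add partial_var partial_scal shift.one shift.zero)
qed (simp_all add: shift.scal shift.add shift.mult partial_scal partial_add partial_mult shift.zero)

lemma shift_surj: "\<exists>p. shift p = q"
proof -
  let ?u = "subst (\<lambda>i. var i - scal (of_real (base_pt i)))"
  interpret u: alg_map scal ?u by (rule subst_alg_map)
  have "shift (?u q) = q"
  proof (rule alg_map_eqI[where h = "\<lambda>q. shift (?u q)" and h' = "\<lambda>q. q"])
    show "alg_map scal (\<lambda>q. shift (?u q))"
      by unfold_locales (simp_all add: u.add u.mult u.scal shift.add shift.mult shift.scal)
    show "alg_map scal (\<lambda>q. q)" by unfold_locales simp_all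
  qed (simp add: subst_var shift.diff shift_var shift.scal)
  then show ?thesis by blast
qed

text \<open>Expanding the translate of \<open>f\<close> by \<open>w\<close> at the base point amounts to expanding \<open>f\<close> at a point of the orbit.\<close>

definition vanishes :: "nat \<Rightarrow> 'n::{finite,linorder} sym_alg \<Rightarrow> bool" where
  "vanishes r f \<longleftrightarrow> (\<forall>w. order_ge r (shift (weyl_act w f)))"

lemma vanishes_mono: "vanishes r f \<Longrightarrow> s \<le> r \<Longrightarrow> vanishes s f"
  unfolding vanishes_def using order_ge_mono by blast

lemma vanishes_add: "vanishes r f \<Longrightarrow> vanishes r g \<Longrightarrow> vanishes r (f + g)"
  by (simp add: vanishes_def weyl_act.add shift.add order_ge_add)

lemma vanishes_diff: "vanishes r f \<Longrightarrow> vanishes r g \<Longrightarrow> vanishes r (f - g)"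
  by (simp add: vanishes_def weyl_act.diff shift.diff order_ge_diff)

lemma vanishes_sum: "(\<And>i. i \<in> I \<Longrightarrow> vanishes r (f i)) \<Longrightarrow> vanishes r (\<Sum>i\<in>I. f i)"
  by (simp add: vanishes_def weyl_act.sum shift.sum order_ge_sum)

lemma vanishes_mult: "vanishes r f \<Longrightarrow> vanishes r (p * f)"
  by (simp add: vanishes_def weyl_act.mult shift.mult order_ge_mult_left)

lemma vanishes_weyl_act: "vanishes r f \<Longrightarrow> vanishes r (weyl_act w f)"
  unfolding vanishes_def by (simp flip: weyl_act_add)

lemma vanishes_partial: "vanishes r f \<Longrightarrow> vanishes (r - 1) (partial j f)"
  unfolding vanishes_def weyl_act_partial shift.sum shift.mult partial_shift[symmetric]
  by (intro allI order_ge_sum order_ge_mult_left order_ge_partial) blast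

text \<open>Roots do not vanish at the points of the orbit, so division by a root keeps the order.\<close>

lemma vanishes_div_diff:
  assumes "\<alpha> \<in> roots_B" "vanishes r f"
  shows "vanishes r (div_diff \<alpha> f)"
  unfolding vanishes_def
proof
  fix w
  have "vanishes r (lin_elem \<alpha> * div_diff \<alpha> f)"
    unfolding div_diff_eq[OF assms(1)] by (intro vanishes_diff vanishes_weyl_act assms)
  then have "order_ge r (shift (lin_elem (weyl_fun w \<alpha>)) * shift (weyl_act w (div_diff \<alpha> f)))"
    by (simp add: vanishes_def weyl_act.mult shift.mult weyl_act_lin_elem)
  moreover have "lookup (shift (lin_elem (weyl_fun w \<alpha>))) 0 \<noteq> 0"
    using ev_pt_root[OF weyl_fun_root[OF assms(1)]] by (simp add: lookup_shift_lin)
  ultimately show "order_ge r (shift (weyl_act w (div_diff \<alpha> f)))"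
    by (rule order_ge_cancel[rotated])
qed

text \<open>For each \<open>w \<noteq> 0\<close> some coordinate distinguishes the base point from the point belonging to \<open>w\<close>, so an affine
  function of that coordinate has the values \<open>1\<close> and \<open>0\<close> there; the polynomial is the product of these.\<close>

lemma ex_separating:
  "\<exists>l :: 'n::{finite,linorder} sym_alg. lookup (shift l) 0 = 1 \<and>
    (\<forall>w. w \<noteq> 0 \<longrightarrow> lookup (shift (weyl_act w l)) 0 = 0)"
proof -
  have "\<exists>l. lookup (shift l) 0 = 1 \<and> lookup (shift (weyl_act w l)) 0 = 0"
    if "w \<noteq> 0" for w :: "'n weyl"
  proof -
    have "\<exists>i. weyl_fun w (basis_vec i) \<noteq> basis_vec i"
    proof (rule ccontr)
      assume "\<not> ?thesis"
      then have "weyl_fun w (basis_vec i) = weyl_fun 0 (basis_vec i)" for i by simp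
      then have "w = 0" by (rule weyl_eq_basisI)
      with that show False by simp
    qed
    then obtain i where i: "weyl_fun w (basis_vec i) \<noteq> basis_vec i" by blast
    define c where "c = ev_pt (weyl_fun w (basis_vec i))"
    have c: "base_pt i \<noteq> c"
      using i ev_pt_short_inj[of "basis_vec i" "weyl_fun w (basis_vec i)"]
      by (auto simp: c_def weyl_fun_short)
    let ?l = "scal (of_real (1 / (base_pt i - c))) * (lin_elem (basis_vec i) - scal (of_real c))"
    have "lookup (shift ?l) 0 = of_real (1 / (base_pt i - c)) * (of_real (base_pt i) - of_real c)"
      by (simp add: shift.mult shift.diff shift.scal lookup_scal_mult lookup_minus lookup_shift_lin
          del: of_real_divide)
    also have "\<dots> = 1" using c by (simp flip: of_real_diff of_real_mult)
    finally have "lookup (shift ?l) 0 = 1" .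
    moreover have "lookup (shift (weyl_act w ?l)) 0 = 0"
      by (simp add: weyl_act.mult weyl_act.diff weyl_act.scal weyl_act_lin_elem shift.mult shift.diff
          shift.scal lookup_scal_mult lookup_minus lookup_shift_lin c_def)
    ultimately show ?thesis by blast
  qed
  then obtain l where l: "\<And>w :: 'n weyl. w \<noteq> 0 \<Longrightarrow> lookup (shift (l w)) 0 = 1"
    "\<And>w :: 'n weyl. w \<noteq> 0 \<Longrightarrow> lookup (shift (weyl_act w (l w))) 0 = 0" by metis
  have prod_hom: "h (\<Prod>i\<in>I. f i) = (\<Prod>i\<in>I. h (f i))" if "alg_map scal h"
    for h :: "'n sym_alg \<Rightarrow> 'n sym_alg" and I and f :: "'n weyl \<Rightarrow> 'n sym_alg"
  proof -
    interpret h: alg_map scal h by fact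
    show ?thesis by (induction I rule: infinite_finite_induct) (simp_all add: h.one h.mult)
  qed
  show ?thesis
  proof (intro exI[of _ "\<Prod>w\<in>- {0}. l w"] conjI allI impI)
    show "lookup (shift (\<Prod>w\<in>- {0}. l w)) 0 = 1"
      by (simp add: prod_hom[OF shift.alg_map_axioms] lookup_prod_0 l)
    show "lookup (shift (weyl_act w (\<Prod>w\<in>- {0}. l w))) 0 = 0" if "w \<noteq> 0" for w
      using l(2)[OF that] that
      by (auto simp: prod_hom[OF shift.alg_map_axioms] prod_hom[OF weyl_act_alg_map] lookup_prod_0 prod_zero_iff)
  qed
qed

text \<open>A monomial centred at the base point, multiplied by a power of a separating polynomial that is high
  enough to make the other points of the orbit invisible.\<close>

lemma ex_test_function:
  fixes m0 :: "'n::{finite,linorder} \<Rightarrow>\<^sub>0 nat"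
  shows "\<exists>f. vanishes (deg m0) f \<and>
    (\<forall>m. deg m = deg m0 \<longrightarrow> lookup (shift f) m = (if m = m0 then 1 else 0)) \<and>
    (\<forall>w. w \<noteq> 0 \<longrightarrow> order_ge (Suc (deg m0)) (shift (weyl_act w f)))"
proof -
  obtain l :: "'n sym_alg" where l: "lookup (shift l) 0 = 1"
    "\<And>w. w \<noteq> 0 \<Longrightarrow> lookup (shift (weyl_act w l)) 0 = 0" using ex_separating by blast
  obtain q where q: "shift q = single m0 1" using shift_surj by blast
  define f where "f = q * l ^ Suc (deg m0)"
  let ?L = "shift (l ^ Suc (deg m0))"
  have far: "order_ge (Suc (deg m0)) (shift (weyl_act w f))" if "w \<noteq> 0" for w
  proof -
    have "order_ge (Suc (deg m0) * Suc 0) (shift (weyl_act w l) ^ Suc (deg m0))"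
      by (rule order_ge_power) (simp add: order_ge_Suc_0 l that)
    then show ?thesis
      by (simp add: f_def weyl_act.mult weyl_act.power shift.mult shift.power order_ge_mult_left
          del: power_Suc)
  qed
  have near: "shift f = single m0 1 * (?L - scal (lookup ?L 0)) + single m0 1"
    using l(1) by (simp add: f_def shift.mult q shift.power lookup_mult_0 lookup_power_0 algebra_simps)
  have ord: "order_ge (deg m0 + Suc 0) (single m0 1 * (?L - scal (lookup ?L 0)))"
    by (intro order_ge_mult order_ge_single order_ge_minus_const) simp
  have "lookup (shift f) m = (if m = m0 then 1 else 0)" if "deg m = deg m0" for m
    using ord that unfolding near lookup_add by (simp add: order_ge_def lookup_single when_def)
  moreover have "order_ge (deg m0) (shift (weyl_act w f))" for w
  proof (cases "w = 0")
    case True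
    have "order_ge (deg m0) (shift f)"
      unfolding near by (intro order_ge_add order_ge_mono[OF ord] order_ge_single) simp_all
    then show ?thesis by (simp add: True weyl_act_zero)
  next
    case False
    from order_ge_mono[OF far[OF this]] show ?thesis by simp
  qed
  ultimately show ?thesis using far unfolding vanishes_def by blast
qed

context dunkl_parameters
begin

text \<open>Beside \<open>z\<^sub>j \<partial>\<^sub>j\<close>, the operator \<open>D j\<close> involves divided differences and group elements only.\<close>

lemma vanishes_D:
  assumes "vanishes r f"
  shows "vanishes r (app (D j) f - var j * partial j f)"
proof -
  have "(\<Sum>i\<in>UNIV. scal (of_real (basis_vec j $ i)) * partial i f) = (\<Sum>i\<in>UNIV. if i = j then partial i f else 0)"
    by (rule sum.cong) auto
  then have "app (Y (basis_vec j)) f = partial j f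
      + scal (1 / 2) * (\<Sum>\<alpha>\<in>roots_B. scal (kbar k kc \<alpha> * of_real (\<alpha> \<bullet> basis_vec j)) * div_diff \<alpha> f)"
    by (simp add: app_Y)
  then have "app (D j) f - var j * partial j f
    = var j * (scal (1 / 2) * (\<Sum>\<alpha>\<in>roots_B. scal (kbar k kc \<alpha> * of_real (\<alpha> \<bullet> basis_vec j)) * div_diff \<alpha> f))
    + (\<Sum>i\<in>{..<j}. scal k * (weyl_act (sigma i j) f
        + weyl_act (tau i) (weyl_act (tau j) (weyl_act (sigma i j) f))))"
    by (simp add: D_def A_op_def B_op_def K_op_def distrib_left)
  also have "vanishes r \<dots>"
    by (intro vanishes_add vanishes_sum vanishes_mult vanishes_div_diff vanishes_weyl_act assms)
  finally show ?thesis .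
qed

lemma vanishes_D_1: "vanishes r f \<Longrightarrow> vanishes (r - 1) (app (D j) f)"
  using vanishes_add[OF vanishes_mono[OF vanishes_D, of r f "r - 1" j] vanishes_mult[OF vanishes_partial, of r f "var j" j]]
  by simp

lemma vanishes_D_word: "vanishes r f \<Longrightarrow> vanishes (r - length xs) (app (\<Prod>i\<leftarrow>xs. D i) f)"
proof (induction xs)
  case (Cons x xs)
  then show ?case using vanishes_D_1[of "r - length xs" "app (\<Prod>i\<leftarrow>xs. D i) f" x] by simp
qed simp

text \<open>Up to terms of higher order, \<open>D j\<close> acts on the Taylor expansion as \<open>base_pt j\<close> times \<open>\<partial>\<^sub>j\<close>. The constant
  \<open>C\<close> collects coordinates of the base point and factors from differentiating monomials.\<close>

lemma D_word_leading:
  "\<exists>C. C \<noteq> 0 \<and> (\<forall>f. vanishes (deg n + length xs) f \<longrightarrow>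
    lookup (shift (app (\<Prod>i\<leftarrow>xs. D i) f)) n
      = C * lookup (shift f) (n + word_weight xs))"
proof (induction xs arbitrary: n)
  case Nil
  show ?case by (rule exI[of _ 1]) simp
next
  case (Cons x xs)
  let ?n = "n + single x 1"
  obtain C where C: "C \<noteq> 0" "\<And>f. vanishes (deg ?n + length xs) f \<Longrightarrow>
    lookup (shift (app (\<Prod>i\<leftarrow>xs. D i) f)) ?n
      = C * lookup (shift f) (?n + word_weight xs)" using Cons.IH[of ?n] by blast
  define C' where "C' = of_real (base_pt x) * of_nat (Suc (lookup n x)) * C"
  have "lookup (shift (app (\<Prod>i\<leftarrow>x # xs. D i) f)) n
      = C' * lookup (shift f) (n + word_weight (x # xs))"
    if f: "vanishes (deg n + length (x # xs)) f" for f
  proof -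
    define g where "g = app (\<Prod>i\<leftarrow>xs. D i) f"
    have g: "vanishes (Suc (deg n)) g"
      using vanishes_D_word[OF f, of xs] by (simp add: g_def)
    have 1: "lookup (shift (app (D x) g - var x * partial x g)) n = 0"
      using vanishes_D[OF g, of x, unfolded vanishes_def, THEN spec[of _ 0]]
      by (simp add: weyl_act_zero order_ge_def)
    have "order_ge (Suc (deg n)) (shift g)"
      using g[unfolded vanishes_def, THEN spec[of _ 0]] by (simp add: weyl_act_zero)
    then have p: "order_ge (deg n) (partial x (shift g))"
      using order_ge_partial by force
    have "order_ge (Suc (deg n)) (var x * partial x (shift g))"
      using order_ge_mult[OF _ p, of "Suc 0" "var x"] by (simp add: order_ge_Suc_0 lookup_var_0)
    then have 2: "lookup (var x * partial x (shift g)) n = 0"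
      by (simp add: order_ge_def)
    have "app (\<Prod>i\<leftarrow>x # xs. D i) f = (app (D x) g - var x * partial x g) + var x * partial x g"
      by (simp add: g_def)
    then have "lookup (shift (app (\<Prod>i\<leftarrow>x # xs. D i) f)) n
      = lookup (shift (var x * partial x g)) n"
      using 1 by (simp only: shift.add lookup_add add_0_left)
    also have "\<dots> = of_real (base_pt x) * lookup (partial x (shift g)) n"
      using 2 by (simp add: shift.mult shift_var distrib_right lookup_add lookup_scal_mult partial_shift)
    also have "\<dots> = of_real (base_pt x) * (of_nat (Suc (lookup n x)) * lookup (shift g) ?n)"
      by (simp only: lookup_partial)
    also have "lookup (shift g) ?n = C * lookup (shift f) (?n + word_weight xs)"
      unfolding g_def by (rule C) (use f in \<open>simp add: deg_add\<close>)
    finally show ?thesis by (simp add: C'_def add.assoc)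
  qed
  moreover have "C' \<noteq> 0" using C(1) base_pt_pos[of x] by (simp add: C'_def del: of_nat_Suc)
  ultimately show ?case by blast
qed

text \<open>Applied to a test polynomial for a monomial \<open>m0\<close> of maximal degree in some \<open>p w0\<close>, and evaluated at the
  base point, all terms of the sum vanish except the one with \<open>w0\<close> and \<open>m0\<close>.\<close>

theorem D_poly_W_op_independent:
  fixes p :: "'n weyl \<Rightarrow> 'n::{finite,linorder} sym_alg"
  assumes "(\<Sum>w\<in>UNIV. D_poly (p w) * W_op w) = 0"
  shows "p w = 0"
proof (rule ccontr)
  assume "p w \<noteq> 0"
  define S where "S = (\<Union>w. deg ` Poly_Mapping.keys (p w))"
  have S: "finite S" "S \<noteq> {}"
    using \<open>p w \<noteq> 0\<close> by (auto simp: S_def)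
  then obtain w0 m0 where wm: "m0 \<in> Poly_Mapping.keys (p w0)" "deg m0 = Max S"
    using Max_in[OF S] unfolding S_def by auto
  have le: "deg m \<le> deg m0" if "m \<in> Poly_Mapping.keys (p w)" for m w
    unfolding wm(2) using S(1) that by (intro Max_ge) (auto simp: S_def)
  obtain f where f: "vanishes (deg m0) f"
    "\<And>m. deg m = deg m0 \<Longrightarrow> lookup (shift f) m = (if m = m0 then 1 else 0)"
    "\<And>w. w \<noteq> 0 \<Longrightarrow> order_ge (Suc (deg m0)) (shift (weyl_act w f))"
    using ex_test_function[of m0] by blast
  \<comment> \<open>The test polynomial is moved by the inverse of \<open>w0\<close>, so that \<open>t\<^sub>w\<close> with \<open>w = w0\<close> moves it back.\<close>
  obtain v where v: "v + w0 = 0" using weyl_inverse by blast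
  have v': "w + v = 0 \<longleftrightarrow> w = w0" for w
  proof -
    have "w = w0" if "w + v = 0" for w
      using that v by (metis add.assoc add.left_neutral add.right_neutral)
    moreover obtain u where "u + v = 0" using weyl_inverse by blast
    ultimately show ?thesis by metis
  qed
  have "\<exists>C. C \<noteq> 0 \<and> (\<forall>g. vanishes (deg m) g \<longrightarrow>
    lookup (shift (app (D_mono m) g)) 0 = C * lookup (shift g) m)" for m :: "'n \<Rightarrow>\<^sub>0 nat"
  proof -
    obtain xs where xs: "D_mono m = (\<Prod>i\<leftarrow>xs. D i)" "word_weight xs = m"
      using D_mono_word by blast
    then have "length xs = deg m" using deg_word_weight[of xs] by simp
    then show ?thesis using D_word_leading[of 0 xs] xs by simp
  qed
  then have "\<forall>m :: 'n \<Rightarrow>\<^sub>0 nat. \<exists>C. C \<noteq> 0 \<and> (\<forall>g. vanishes (deg m) g \<longrightarrow>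
    lookup (shift (app (D_mono m) g)) 0 = C * lookup (shift g) m)" by blast
  from choice[OF this] obtain C where C: "\<And>m :: 'n \<Rightarrow>\<^sub>0 nat. C m \<noteq> 0" "\<And>(m :: 'n \<Rightarrow>\<^sub>0 nat) g. vanishes (deg m) g \<Longrightarrow>
    lookup (shift (app (D_mono m) g)) 0 = C m * lookup (shift g) m"
    by blast
  have low: "lookup (shift (app (D_mono m) g)) 0 = 0"
    if "vanishes (deg m0) g" "deg m < deg m0" for m g
  proof -
    obtain xs where xs: "D_mono m = (\<Prod>i\<leftarrow>xs. D i)" "word_weight xs = m"
      using D_mono_word by blast
    then have "length xs = deg m" using deg_word_weight[of xs] by simp
    then have "vanishes (Suc 0) (app (D_mono m) g)"
      using vanishes_mono[OF vanishes_D_word[OF that(1), of xs], of "Suc 0"] that(2) xs by simp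
    then show ?thesis
      using weyl_act_zero[of "app (D_mono m) g"] unfolding vanishes_def order_ge_Suc_0 by metis
  qed
  let ?g = "\<lambda>w. weyl_act w (weyl_act v f)"
  have g: "vanishes (deg m0) (?g w)" for w by (intro vanishes_weyl_act f)
  have summand: "lookup (shift (app (D_mono m) (?g w))) 0 = (if w = w0 \<and> m = m0 then C m0 else 0)"
    if "m \<in> Poly_Mapping.keys (p w)" for m w
  proof (cases "deg m = deg m0")
    case True
    then have eq: "lookup (shift (app (D_mono m) (?g w))) 0 = C m * lookup (shift (?g w)) m"
      by (intro C(2)) (simp add: g)
    show ?thesis
    proof (cases "w = w0")
      case w: True
      then have "?g w = f" using v'[of w] by (simp add: weyl_act_zero flip: weyl_act_add)
      then show ?thesis using f(2)[OF True] w eq by simp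
    next
      case False
      then have "order_ge (Suc (deg m0)) (shift (?g w))"
        using f(3)[of "w + v"] v'[of w] by (simp add: weyl_act_add)
      then show ?thesis using eq False True by (simp add: order_ge_def)
    qed
  next
    case False
    then show ?thesis using le[OF that] low[OF g, of m w] by auto
  qed
  have "0 = lookup (shift (app (\<Sum>w\<in>UNIV. D_poly (p w) * W_op w) (weyl_act v f))) 0"
    by (simp add: assms shift.zero)
  also have "\<dots> = (\<Sum>w\<in>UNIV. \<Sum>m\<in>Poly_Mapping.keys (p w).
      lookup (p w) m * lookup (shift (app (D_mono m) (?g w))) 0)"
    by (simp add: D_poly_def lin_ext_def shift.sum lookup_sum shift.mult shift.scal lookup_scal_mult)
  also have "\<dots> = (\<Sum>w\<in>UNIV. \<Sum>m\<in>Poly_Mapping.keys (p w).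
      if w = w0 then if m = m0 then lookup (p w) m * C m0 else 0 else 0)"
    by (intro sum.cong HOL.refl) (simp add: summand)
  also have "\<dots> = (\<Sum>w\<in>UNIV. if w = w0 then \<Sum>m\<in>Poly_Mapping.keys (p w).
      if m = m0 then lookup (p w) m * C m0 else 0 else 0)"
    by (intro sum.cong HOL.refl) simp
  also have "\<dots> = lookup (p w0) m0 * C m0"
    using wm(1) by simp
  finally show False using C(1) wm(1) by (simp add: in_keys_iff)
qed

end

section \<open>Generation of the Weyl group by sign changes and adjacent transpositions\<close>

text \<open>The presentation specifies how these generators commute with the symmetric algebra.\<close>

lemma weyl_simple_induct [case_names zero add tau sigma]:
  fixes w :: "'n::{finite,linorder} weyl"
  assumes zero: "P 0" and add: "\<And>v w. P v \<Longrightarrow> P w \<Longrightarrow> P (v + w)"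
    and tau: "\<And>i. P (tau i)"
    and sigma: "\<And>i j. i < j \<Longrightarrow> (\<And>l. \<not> (i < l \<and> l < j)) \<Longrightarrow> P (sigma i j)"
  shows "P w"
proof -
  have trans: "P (sigma i j)" if "i < j" for i j
    using that
  proof (induction "card {i<..<j}" arbitrary: i j rule: less_induct)
    case less
    show ?case
    proof (cases "\<exists>l. i < l \<and> l < j")
      case True
      then obtain l where l: "i < l" "l < j" by blast
      have "{i<..<l} \<subset> {i<..<j}" "{l<..<j} \<subset> {i<..<j}" using l by auto
      then have "card {i<..<l} < card {i<..<j}" "card {l<..<j} < card {i<..<j}"
        by (simp_all add: psubset_card_mono)
      with less l have P: "P (sigma i l)" "P (sigma l j)" by blast+
      have "sigma i l + sigma l j + sigma i l = sigma i j"
      proof -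
        have "sigma i l + sigma l j = sigma i j + sigma i l"
          using l sigma_sigma[of i l l j] by (auto simp: Transposition.transpose_def)
        then show ?thesis using l weyl_refl_self[of "basis_vec i - basis_vec l"] by (simp add: add.assoc)
      qed
      then show ?thesis using add[OF add[OF P] P(1)] by simp
    qed (use sigma less in blast)
  qed
  have refl: "P (weyl_refl \<alpha>)" if "\<alpha> \<in> roots_B" for \<alpha>
  proof (cases "\<alpha> \<in> long_roots")
    case True
    then obtain a b :: real and i j :: 'n where *: "\<alpha> = a *\<^sub>R basis_vec i + b *\<^sub>R basis_vec j"
      "a \<in> {1,-1}" "b \<in> {1,-1}" "i < j"
      unfolding long_roots_def by blast
    then have "\<alpha> \<in> {basis_vec i - basis_vec j, - (basis_vec i - basis_vec j),
      basis_vec i + basis_vec j, - (basis_vec i + basis_vec j)}" by auto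
    then have "weyl_refl \<alpha> = sigma i j \<or> weyl_refl \<alpha> = tau i + tau j + sigma i j"
      using weyl_refl_minus[of "basis_vec i - basis_vec j"] weyl_refl_minus[of "basis_vec i + basis_vec j"]
        refl_add_eq[of i j] *(4) by auto
    then show ?thesis using trans[OF *(4)] add tau by auto
  next
    case False
    then have "\<alpha> \<in> short_roots" using that by (simp add: roots_B_def)
    then obtain a i where "a = 1 \<or> a = - 1" "\<alpha> = a *\<^sub>R basis_vec i" by (rule short_rootsE)
    then have "weyl_refl \<alpha> = tau i" using weyl_refl_minus[of "basis_vec i"] by auto
    then show ?thesis using tau by simp
  qed
  show ?thesis
    by (induction w rule: weyl_induct) (simp_all add: zero add refl)
qed

lemma sign_group_induct [consumes 1, case_names zero tau]:
  assumes "x \<in> sign_group" and "P 0" and "\<And>i w. P w \<Longrightarrow> P (tau i + w)"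
  shows "P x"
proof -
  have "\<exists>w. weyl_fun w = g \<and> P w" if "g \<in> reflection_group (range basis_vec)" for g
    using that
  proof (induction rule: reflection_group.induct)
    case id
    then show ?case using assms(2) by (intro exI[of _ 0]) (simp add: zero_weyl.rep_eq)
  next
    case (refl \<alpha> g)
    then obtain w i where "weyl_fun w = g" "P w" "\<alpha> = basis_vec i" by blast
    then show ?case using assms(3)
      by (intro exI[of _ "tau i + w"]) (simp add: plus_weyl.rep_eq weyl_fun_refl)
  qed
  from this[of "weyl_fun x"] assms(1) show ?thesis by (auto simp: sign_group_def weyl_fun_inject)
qed

lemma sign_group_tau: "tau i \<in> sign_group"
  using reflection_group.refl[OF _ reflection_group.id, of "basis_vec i" "range basis_vec"]
  by (simp add: sign_group_def weyl_fun_refl)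

lemma sign_group_add: "v \<in> sign_group \<Longrightarrow> w \<in> sign_group \<Longrightarrow> v + w \<in> sign_group"
  by (simp add: sign_group_def plus_weyl.rep_eq reflection_group_comp)

section \<open>The presented algebra\<close>

lemma ring_type_ring: "ring (type_ring :: 'a::ring_1 ring)"
proof (intro ringI abelian_groupI monoidI)
  fix x :: 'a
  show "\<exists>y\<in>carrier type_ring. y \<oplus>\<^bsub>type_ring\<^esub> x = \<zero>\<^bsub>type_ring\<^esub>"
    by (rule bexI[of _ "- x"]) (simp_all add: type_ring_def)
qed (simp_all add: type_ring_def algebra_simps)

lemma type_ring_simps [simp]: "carrier type_ring = UNIV" "x \<otimes>\<^bsub>type_ring\<^esub> y = x * y"
  "x \<oplus>\<^bsub>type_ring\<^esub> y = x + y" "\<one>\<^bsub>type_ring\<^esub> = 1" "\<zero>\<^bsub>type_ring\<^esub> = 0"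
  by (simp_all add: type_ring_def)

lemma ideal_HB_ideal: "ideal (HB_ideal k) type_ring"
  unfolding HB_ideal_def by (rule ring.genideal_ideal[OF ring_type_ring]) simp

lemma
  shows HB_ideal_zero: "0 \<in> HB_ideal k"
    and HB_ideal_add: "x \<in> HB_ideal k \<Longrightarrow> y \<in> HB_ideal k \<Longrightarrow> x + y \<in> HB_ideal k"
    and HB_ideal_left: "x \<in> HB_ideal k \<Longrightarrow> a * x \<in> HB_ideal k"
    and HB_ideal_right: "x \<in> HB_ideal k \<Longrightarrow> x * a \<in> HB_ideal k"
proof -
  interpret I: ideal "HB_ideal k" type_ring by (rule ideal_HB_ideal)
  show "0 \<in> HB_ideal k" using additive_subgroup.zero_closed[OF I.is_additive_subgroup] by simp
  show "x \<in> HB_ideal k \<Longrightarrow> y \<in> HB_ideal k \<Longrightarrow> x + y \<in> HB_ideal k" using additive_subgroup.a_closed[OF I.is_additive_subgroup, of x y] by simp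
  show "x \<in> HB_ideal k \<Longrightarrow> a * x \<in> HB_ideal k" using I.I_l_closed[of x a] by simp
  show "x \<in> HB_ideal k \<Longrightarrow> x * a \<in> HB_ideal k" using I.I_r_closed[of x a] by simp
qed

lemma HB_ideal_minus: "x \<in> HB_ideal k \<Longrightarrow> - x \<in> HB_ideal k"
  using HB_ideal_left[of x k "- 1"] by simp

lemma HB_ideal_relation:
  "x \<in> hom_relations gen_S \<union> hom_relations gen_W \<union> cross_relations k \<Longrightarrow> x \<in> HB_ideal k"
  unfolding HB_ideal_def using ring.genideal_self[OF ring_type_ring] by fastforce

text \<open>Since \<open>k\<close> is a variable there is no type for the quotient; computations in it are done with representatives.\<close>

definition HB_eq :: "complex \<Rightarrow> 'n pre_HB \<Rightarrow> 'n::{finite,linorder} pre_HB \<Rightarrow> bool" where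
  "HB_eq k x y \<longleftrightarrow> x - y \<in> HB_ideal k"

lemma HB_eq_refl [simp]: "HB_eq k x x"
  by (simp add: HB_eq_def HB_ideal_zero)

lemma HB_eq_sym: "HB_eq k x y \<Longrightarrow> HB_eq k y x"
  unfolding HB_eq_def using HB_ideal_minus[of "x - y" k] by simp

lemma HB_eq_trans [trans]: "HB_eq k x y \<Longrightarrow> HB_eq k y z \<Longrightarrow> HB_eq k x z"
  unfolding HB_eq_def using HB_ideal_add[of "x - y" k "y - z"] by simp

lemma HB_eq_add: "HB_eq k x x' \<Longrightarrow> HB_eq k y y' \<Longrightarrow> HB_eq k (x + y) (x' + y')"
  unfolding HB_eq_def using HB_ideal_add[of "x - x'" k "y - y'"] by (simp add: algebra_simps)

lemma HB_eq_mult: "HB_eq k x x' \<Longrightarrow> HB_eq k y y' \<Longrightarrow> HB_eq k (x * y) (x' * y')"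
proof -
  assume "HB_eq k x x'" "HB_eq k y y'"
  then have "(x - x') * y + x' * (y - y') \<in> HB_ideal k"
    unfolding HB_eq_def by (intro HB_ideal_add HB_ideal_left HB_ideal_right)
  then show ?thesis by (simp add: HB_eq_def algebra_simps)
qed

lemma HB_eq_sum: "(\<And>i. i \<in> I \<Longrightarrow> HB_eq k (f i) (g i)) \<Longrightarrow> HB_eq k (\<Sum>i\<in>I. f i) (\<Sum>i\<in>I. g i)"
  by (induction I rule: infinite_finite_induct) (simp_all add: HB_eq_add)

lemma
  shows gen_S_one: "HB_eq k (gen_S 1) 1"
    and gen_S_add: "HB_eq k (gen_S (p + q)) (gen_S p + gen_S q)"
    and gen_S_scale: "HB_eq k (gen_S (scal c * p)) (scal c * gen_S p)"
    and gen_S_mult: "HB_eq k (gen_S (p * q)) (gen_S p * gen_S q)"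
  unfolding HB_eq_def
  by (rule HB_ideal_relation; simp add: hom_relations_def flip: cscale_eq_mult; blast)+

lemma
  shows gen_W_one: "HB_eq k (gen_W 1) 1"
    and gen_W_add: "HB_eq k (gen_W (a + b)) (gen_W a + gen_W b)"
    and gen_W_scale: "HB_eq k (gen_W (scal c * a)) (scal c * gen_W a)"
    and gen_W_mult: "HB_eq k (gen_W (a * b)) (gen_W a * gen_W b)"
  unfolding HB_eq_def
  by (rule HB_ideal_relation; simp add: hom_relations_def flip: cscale_eq_mult; blast)+

lemma gen_S_scal: "HB_eq k (gen_S (scal c)) (scal c)"
  using HB_eq_trans[OF gen_S_scale[of k c 1] HB_eq_mult[OF HB_eq_refl gen_S_one]] by simp

lemma gen_S_zero: "HB_eq k (gen_S 0) 0"
  using gen_S_scal[of k 0] by simp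

lemma gen_W_zero: "HB_eq k (gen_W 0) 0"
  using gen_W_scale[of k 0 0] by simp

lemma gen_W_sum: "HB_eq k (gen_W (\<Sum>i\<in>I. f i)) (\<Sum>i\<in>I. gen_W (f i))"
proof (induction I rule: infinite_finite_induct)
  case (insert i I)
  then show ?case
    using HB_eq_trans[OF gen_W_add HB_eq_add[OF HB_eq_refl insert.IH]] by simp
qed (simp_all add: gen_W_zero)

lemma grp_add: "grp (v + w) = grp v * grp w" and grp_zero: "grp 0 = 1"
  by (simp_all add: grp_def mult_single)

lemma grp_alg_expansion: "a = (\<Sum>w\<in>UNIV. scal (lookup a w) * grp w)"
  for a :: "'n::{finite,linorder} grp_alg"
  by (rule poly_mapping_eqI)
    (simp add: grp_def mult_single lookup_sum lookup_single when_def)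

lemma gen_W_expansion: "HB_eq k (gen_W a) (\<Sum>w\<in>UNIV. scal (lookup a w) * gen_W (grp w))"
proof -
  have "HB_eq k (gen_W (\<Sum>w\<in>UNIV. scal (lookup a w) * grp w))
    (\<Sum>w\<in>UNIV. scal (lookup a w) * gen_W (grp w))"
    by (rule HB_eq_trans, rule gen_W_sum, rule HB_eq_sum, rule gen_W_scale)
  then show ?thesis unfolding grp_alg_expansion[symmetric] .
qed

lemma cross_sign: "x \<in> sign_group \<Longrightarrow> HB_eq k (gen_W (grp x) * gen_S (lin_elem v)) (gen_S (lin_elem v) * gen_W (grp x))"
  unfolding HB_eq_def by (rule HB_ideal_relation) (auto simp: cross_relations_def)

lemma cross_sigma:
  assumes "i < j" "\<And>l. \<not> (i < l \<and> l < j)"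
  shows "HB_eq k (gen_W (grp (sigma i j)) * gen_S (lin_elem v))
    (gen_S (lin_elem (reflection (basis_vec i - basis_vec j) v)) * gen_W (grp (sigma i j))
     + scal (of_real (coroot (basis_vec i - basis_vec j) (reflection (basis_vec i - basis_vec j) v))) * gen_W (ktilde k i j))"
  unfolding HB_eq_def cscale_eq_mult[symmetric]
  by (rule HB_ideal_relation, unfold cross_relations_def t_refl_def Let_def, intro UnI2 CollectI,
      rule exI[of _ i], rule exI[of _ j], rule exI[of _ v], intro conjI HOL.refl)
    (use assms in auto)

lemma gen_S_commute:
  assumes "\<And>i. HB_eq k (x * gen_S (var i)) (gen_S (var i) * x)"
  shows "HB_eq k (x * gen_S q) (gen_S q * x)"
proof (induction q rule: sym_alg_induct)
  case (scal c)
  have "HB_eq k (x * gen_S (scal c)) (x * scal c)" by (intro HB_eq_mult HB_eq_refl gen_S_scal)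
  also have "x * scal c = scal c * x" by (simp add: scal_central)
  also have "HB_eq k (scal c * x) (gen_S (scal c) * x)"
    by (intro HB_eq_mult HB_eq_refl HB_eq_sym[OF gen_S_scal])
  finally show ?case .
next
  case (var i)
  show ?case by (rule assms)
next
  case (add p q)
  have "HB_eq k (x * gen_S (p + q)) (x * (gen_S p + gen_S q))" by (intro HB_eq_mult HB_eq_refl gen_S_add)
  also have "x * (gen_S p + gen_S q) = x * gen_S p + x * gen_S q" by (simp add: distrib_left)
  also have "HB_eq k \<dots> (gen_S p * x + gen_S q * x)" by (intro HB_eq_add add)
  also have "gen_S p * x + gen_S q * x = (gen_S p + gen_S q) * x" by (simp add: distrib_right)
  also have "HB_eq k \<dots> (gen_S (p + q) * x)" by (intro HB_eq_mult HB_eq_refl HB_eq_sym[OF gen_S_add])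
  finally show ?case .
next
  case (mult p q)
  have "HB_eq k (x * gen_S (p * q)) (x * (gen_S p * gen_S q))" by (intro HB_eq_mult HB_eq_refl gen_S_mult)
  also have "x * (gen_S p * gen_S q) = x * gen_S p * gen_S q" by (simp add: mult.assoc)
  also have "HB_eq k \<dots> (gen_S p * x * gen_S q)" by (intro HB_eq_mult HB_eq_refl mult)
  also have "gen_S p * x * gen_S q = gen_S p * (x * gen_S q)" by (simp add: mult.assoc)
  also have "HB_eq k \<dots> (gen_S p * (gen_S q * x))" by (intro HB_eq_mult HB_eq_refl mult)
  also have "gen_S p * (gen_S q * x) = gen_S p * gen_S q * x" by (simp add: mult.assoc)
  also have "HB_eq k \<dots> (gen_S (p * q) * x)" by (intro HB_eq_mult HB_eq_refl HB_eq_sym[OF gen_S_mult])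
  finally show ?case .
qed

lemma sign_commute: "x \<in> sign_group \<Longrightarrow> HB_eq k (gen_W (grp x) * gen_S q) (gen_S q * gen_W (grp x))"
  by (rule gen_S_commute) (use cross_sign[of x k "basis_vec _"] in \<open>simp add: lin_elem_basis\<close>)

lemma ktilde_commute: "HB_eq k (gen_W (ktilde k i j) * gen_S q) (gen_S q * gen_W (ktilde k i j))"
proof -
  let ?z = "gen_W (grp (tau i + tau j))"
  have eq: "HB_eq k (gen_W (ktilde k i j)) (scal k * (1 + ?z))"
  proof -
    have "ktilde k i j = scal k * (1 + grp (tau i + tau j))"
      by (simp add: ktilde_def cscale_eq_mult t_refl_def grp_add)
    moreover have "HB_eq k (gen_W (scal k * (1 + grp (tau i + tau j)))) (scal k * (1 + ?z))"
      by (rule HB_eq_trans[OF gen_W_scale HB_eq_mult[OF HB_eq_refl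
            HB_eq_trans[OF gen_W_add HB_eq_add[OF gen_W_one HB_eq_refl]]]])
    ultimately show ?thesis by simp
  qed
  have "HB_eq k (gen_W (ktilde k i j) * gen_S q) (scal k * (1 + ?z) * gen_S q)"
    by (intro HB_eq_mult HB_eq_refl eq)
  also have "scal k * (1 + ?z) * gen_S q = scal k * (gen_S q + ?z * gen_S q)"
    by (simp add: mult.assoc distrib_right)
  also have "HB_eq k \<dots> (scal k * (gen_S q + gen_S q * ?z))"
    by (intro HB_eq_mult HB_eq_add HB_eq_refl sign_commute sign_group_add sign_group_tau)
  also have "scal k * (gen_S q + gen_S q * ?z) = scal k * gen_S q * (1 + ?z)"
    by (simp add: distrib_left mult.assoc)
  also have "\<dots> = gen_S q * (scal k * (1 + ?z))"
    by (simp only: scal_central[of k "gen_S q"] mult.assoc)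
  also have "HB_eq k \<dots> (gen_S q * gen_W (ktilde k i j))"
    by (intro HB_eq_mult HB_eq_refl HB_eq_sym[OF eq])
  finally show ?thesis .
qed

text \<open>The polynomials \<open>q\<close> with this property form an algebra, because \<open>ktilde k i j\<close> commutes with polynomials.\<close>

lemma sigma_straighten:
  assumes adj: "i < j" "\<And>l. \<not> (i < l \<and> l < j)"
  shows "\<exists>q1 q2. HB_eq k (gen_W (grp (sigma i j)) * gen_S q)
    (gen_S q1 * gen_W (grp (sigma i j)) + gen_S q2 * gen_W (ktilde k i j))"
proof -
  let ?s = "gen_W (grp (sigma i j))" and ?K = "gen_W (ktilde k i j)"
  show ?thesis
  proof (induction q rule: sym_alg_induct)
    case (scal c)
    have "HB_eq k (?s * gen_S (scal c)) (?s * scal c)" by (intro HB_eq_mult HB_eq_refl gen_S_scal)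
    also have "?s * scal c = scal c * ?s + 0 * ?K" by (simp add: scal_central)
    also have "HB_eq k \<dots> (gen_S (scal c) * ?s + gen_S 0 * ?K)"
      by (intro HB_eq_add HB_eq_mult HB_eq_refl HB_eq_sym[OF gen_S_scal] HB_eq_sym[OF gen_S_zero])
    finally show ?case by blast
  next
    case (var l)
    let ?c = "of_real (coroot (basis_vec i - basis_vec j) (reflection (basis_vec i - basis_vec j) (basis_vec l)))"
    have "HB_eq k (?s * gen_S (var l)) (gen_S (lin_elem (reflection (basis_vec i - basis_vec j) (basis_vec l))) * ?s + scal ?c * ?K)"
      using cross_sigma[OF adj, of k "basis_vec l"] by (simp add: lin_elem_basis)
    also have "HB_eq k \<dots> (gen_S (lin_elem (reflection (basis_vec i - basis_vec j) (basis_vec l))) * ?s + gen_S (scal ?c) * ?K)"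
      by (intro HB_eq_add HB_eq_mult HB_eq_refl HB_eq_sym[OF gen_S_scal])
    finally show ?case by blast
  next
    case (add p q)
    then obtain p1 p2 q1 q2 where "HB_eq k (?s * gen_S p) (gen_S p1 * ?s + gen_S p2 * ?K)"
      "HB_eq k (?s * gen_S q) (gen_S q1 * ?s + gen_S q2 * ?K)" by blast
    note pq = this
    have "HB_eq k (?s * gen_S (p + q)) (?s * (gen_S p + gen_S q))" by (intro HB_eq_mult HB_eq_refl gen_S_add)
    also have "?s * (gen_S p + gen_S q) = ?s * gen_S p + ?s * gen_S q" by (simp add: distrib_left)
    also have "HB_eq k \<dots> ((gen_S p1 * ?s + gen_S p2 * ?K) + (gen_S q1 * ?s + gen_S q2 * ?K))"
      by (intro HB_eq_add pq)
    also have "(gen_S p1 * ?s + gen_S p2 * ?K) + (gen_S q1 * ?s + gen_S q2 * ?K)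
      = (gen_S p1 + gen_S q1) * ?s + (gen_S p2 + gen_S q2) * ?K" by (simp add: algebra_simps)
    also have "HB_eq k \<dots> (gen_S (p1 + q1) * ?s + gen_S (p2 + q2) * ?K)"
      by (intro HB_eq_add HB_eq_mult HB_eq_refl HB_eq_sym[OF gen_S_add])
    finally show ?case by blast
  next
    case (mult p q)
    then obtain p1 p2 q1 q2 where "HB_eq k (?s * gen_S p) (gen_S p1 * ?s + gen_S p2 * ?K)"
      "HB_eq k (?s * gen_S q) (gen_S q1 * ?s + gen_S q2 * ?K)" by blast
    note pq = this
    have "HB_eq k (?s * gen_S (p * q)) (?s * (gen_S p * gen_S q))" by (intro HB_eq_mult HB_eq_refl gen_S_mult)
    also have "?s * (gen_S p * gen_S q) = ?s * gen_S p * gen_S q" by (simp add: mult.assoc)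
    also have "HB_eq k \<dots> ((gen_S p1 * ?s + gen_S p2 * ?K) * gen_S q)"
      by (intro HB_eq_mult HB_eq_refl pq)
    also have "(gen_S p1 * ?s + gen_S p2 * ?K) * gen_S q = gen_S p1 * (?s * gen_S q) + gen_S p2 * (?K * gen_S q)"
      by (simp add: distrib_right mult.assoc)
    also have "HB_eq k \<dots> (gen_S p1 * (gen_S q1 * ?s + gen_S q2 * ?K) + gen_S p2 * (gen_S q * ?K))"
      by (intro HB_eq_add HB_eq_mult HB_eq_refl pq ktilde_commute)
    also have "gen_S p1 * (gen_S q1 * ?s + gen_S q2 * ?K) + gen_S p2 * (gen_S q * ?K)
      = gen_S p1 * gen_S q1 * ?s + (gen_S p1 * gen_S q2 + gen_S p2 * gen_S q) * ?K"
      by (simp add: algebra_simps)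
    also have "HB_eq k \<dots> (gen_S (p1 * q1) * ?s + gen_S (p1 * q2 + p2 * q) * ?K)"
      by (intro HB_eq_add HB_eq_mult HB_eq_refl HB_eq_sym[OF gen_S_mult]
          HB_eq_sym[OF HB_eq_trans[OF gen_S_add HB_eq_add[OF gen_S_mult gen_S_mult]]])
    finally show ?case by blast
  qed
qed

definition normal_form :: "('n weyl \<Rightarrow> 'n sym_alg) \<Rightarrow> 'n::{finite,linorder} pre_HB" where
  "normal_form p = (\<Sum>w\<in>UNIV. gen_S (p w) * gen_W (grp w))"

definition normalizable :: "complex \<Rightarrow> 'n::{finite,linorder} pre_HB set" where
  "normalizable k = {x. \<exists>p. HB_eq k x (normal_form p)}"

lemma normalizable_cong: "HB_eq k x y \<Longrightarrow> y \<in> normalizable k \<Longrightarrow> x \<in> normalizable k"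
  unfolding normalizable_def using HB_eq_trans by blast

lemma normalizable_add:
  assumes "x \<in> normalizable k" "y \<in> normalizable k"
  shows "x + y \<in> normalizable k"
proof -
  obtain p q where pq: "HB_eq k x (normal_form p)" "HB_eq k y (normal_form q)"
    using assms by (auto simp: normalizable_def)
  have "HB_eq k (x + y) (normal_form p + normal_form q)" by (intro HB_eq_add pq)
  also have "normal_form p + normal_form q = (\<Sum>w\<in>UNIV. (gen_S (p w) + gen_S (q w)) * gen_W (grp w))"
    by (simp add: normal_form_def sum.distrib distrib_right)
  also have "HB_eq k \<dots> (normal_form (\<lambda>w. p w + q w))"
    unfolding normal_form_def by (intro HB_eq_sum HB_eq_mult HB_eq_refl HB_eq_sym[OF gen_S_add])
  finally show ?thesis by (auto simp: normalizable_def)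
qed

lemma normalizable_S:
  assumes "x \<in> normalizable k"
  shows "gen_S q * x \<in> normalizable k"
proof -
  obtain p where p: "HB_eq k x (normal_form p)" using assms by (auto simp: normalizable_def)
  have "HB_eq k (gen_S q * x) (gen_S q * normal_form p)" by (intro HB_eq_mult HB_eq_refl p)
  also have "gen_S q * normal_form p = (\<Sum>w\<in>UNIV. (gen_S q * gen_S (p w)) * gen_W (grp w))"
    by (simp add: normal_form_def sum_distrib_left mult.assoc)
  also have "HB_eq k \<dots> (normal_form (\<lambda>w. q * p w))"
    unfolding normal_form_def by (intro HB_eq_sum HB_eq_mult HB_eq_refl HB_eq_sym[OF gen_S_mult])
  finally show ?thesis by (auto simp: normalizable_def)
qed

lemma normalizable_zero: "0 \<in> normalizable k"
proof -
  have "HB_eq k (normal_form (\<lambda>_. 0)) (\<Sum>w\<in>UNIV. 0 * gen_W (grp w))"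
    unfolding normal_form_def by (intro HB_eq_sum HB_eq_mult HB_eq_refl gen_S_zero)
  then show ?thesis unfolding normalizable_def using HB_eq_sym by auto
qed

lemma normalizable_sum: "(\<And>i. i \<in> I \<Longrightarrow> f i \<in> normalizable k) \<Longrightarrow> (\<Sum>i\<in>I. f i) \<in> normalizable k"
  by (induction I rule: infinite_finite_induct) (simp_all add: normalizable_zero normalizable_add)

lemma normalizable_scal: "x \<in> normalizable k \<Longrightarrow> scal c * x \<in> normalizable k"
  using normalizable_cong[OF HB_eq_mult[OF HB_eq_sym[OF gen_S_scal] HB_eq_refl] normalizable_S] .

lemma normalizable_SW: "gen_S p * gen_W a \<in> normalizable k"
proof -
  have "HB_eq k (gen_W a) (normal_form (\<lambda>w. scal (lookup a w)))"
    unfolding normal_form_def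
    by (rule HB_eq_trans[OF gen_W_expansion])
      (intro HB_eq_sum HB_eq_mult HB_eq_sym[OF gen_S_scal] HB_eq_refl)
  then have "gen_W a \<in> normalizable k" by (auto simp: normalizable_def)
  then show ?thesis by (rule normalizable_S)
qed

lemma normalizable_grp:
  assumes "x \<in> normalizable k"
  shows "gen_W (grp v) * x \<in> normalizable k"
proof -
  have reduce: "gen_W (grp v) * x \<in> normalizable k"
    if x: "x \<in> normalizable k" and nf: "\<And>q w. gen_W (grp v) * (gen_S q * gen_W (grp w)) \<in> normalizable k"
    for v and x :: "'a pre_HB"
  proof -
    obtain p where p: "HB_eq k x (normal_form p)" using x by (auto simp: normalizable_def)
    have "HB_eq k (gen_W (grp v) * x) (gen_W (grp v) * normal_form p)" by (intro HB_eq_mult HB_eq_refl p)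
    moreover have "gen_W (grp v) * normal_form p \<in> normalizable k"
      unfolding normal_form_def sum_distrib_left by (intro normalizable_sum nf)
    ultimately show ?thesis by (rule normalizable_cong)
  qed
  show ?thesis using assms
  proof (induction v arbitrary: x rule: weyl_simple_induct)
    case zero
    have "HB_eq k (gen_W (grp 0) * x) (1 * x)"
      unfolding grp_zero by (intro HB_eq_mult HB_eq_refl gen_W_one)
    with zero show ?case using normalizable_cong by auto
  next
    case (add v w)
    have "HB_eq k (gen_W (grp (v + w)) * x) (gen_W (grp v) * gen_W (grp w) * x)"
      unfolding grp_add by (intro HB_eq_mult HB_eq_refl gen_W_mult)
    moreover have "gen_W (grp v) * gen_W (grp w) * x \<in> normalizable k"
      unfolding mult.assoc by (intro add)
    ultimately show ?case by (rule normalizable_cong)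
  next
    case (tau i)
    show ?case
    proof (rule reduce[OF tau])
      fix q w
      have "HB_eq k (gen_W (grp (tau i)) * gen_S q * gen_W (grp w)) (gen_S q * gen_W (grp (tau i)) * gen_W (grp w))"
        by (intro HB_eq_mult HB_eq_refl sign_commute sign_group_tau)
      also have "gen_S q * gen_W (grp (tau i)) * gen_W (grp w) = gen_S q * (gen_W (grp (tau i)) * gen_W (grp w))"
        by (simp add: mult.assoc)
      also have "HB_eq k \<dots> (gen_S q * gen_W (grp (tau i) * grp w))"
        by (intro HB_eq_mult HB_eq_refl HB_eq_sym[OF gen_W_mult])
      finally show "gen_W (grp (tau i)) * (gen_S q * gen_W (grp w)) \<in> normalizable k"
        using normalizable_cong[OF _ normalizable_SW] by (simp add: mult.assoc)
    qed
  next
    case (sigma i j)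
    show ?case
    proof (rule reduce[OF sigma(3)])
      fix q w
      obtain q1 q2 where q: "HB_eq k (gen_W (grp (sigma i j)) * gen_S q)
        (gen_S q1 * gen_W (grp (sigma i j)) + gen_S q2 * gen_W (ktilde k i j))"
        using sigma_straighten[OF sigma(1,2)] by blast
      have "HB_eq k (gen_W (grp (sigma i j)) * gen_S q * gen_W (grp w))
        ((gen_S q1 * gen_W (grp (sigma i j)) + gen_S q2 * gen_W (ktilde k i j)) * gen_W (grp w))"
        by (intro HB_eq_mult HB_eq_refl q)
      also have "(gen_S q1 * gen_W (grp (sigma i j)) + gen_S q2 * gen_W (ktilde k i j)) * gen_W (grp w)
        = gen_S q1 * (gen_W (grp (sigma i j)) * gen_W (grp w)) + gen_S q2 * (gen_W (ktilde k i j) * gen_W (grp w))"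
        by (simp add: distrib_right mult.assoc)
      also have "HB_eq k \<dots> (gen_S q1 * gen_W (grp (sigma i j) * grp w) + gen_S q2 * gen_W (ktilde k i j * grp w))"
        by (intro HB_eq_add HB_eq_mult HB_eq_refl HB_eq_sym[OF gen_W_mult])
      finally show "gen_W (grp (sigma i j)) * (gen_S q * gen_W (grp w)) \<in> normalizable k"
        using normalizable_cong[OF _ normalizable_add[OF normalizable_SW normalizable_SW]] by (simp add: mult.assoc)
    qed
  qed
qed

lemma normalizable_W:
  assumes "x \<in> normalizable k"
  shows "gen_W a * x \<in> normalizable k"
proof -
  have "HB_eq k (gen_W a * x) ((\<Sum>w\<in>UNIV. scal (lookup a w) * gen_W (grp w)) * x)"
    by (intro HB_eq_mult HB_eq_refl gen_W_expansion)
  moreover have "(\<Sum>w\<in>UNIV. scal (lookup a w) * gen_W (grp w)) * x \<in> normalizable k"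
    unfolding sum_distrib_right mult.assoc
    by (intro normalizable_sum normalizable_scal normalizable_grp assms)
  ultimately show ?thesis by (rule normalizable_cong)
qed

lemma pre_HB_induct [case_names scal S W add]:
  fixes x :: "'n::{finite,linorder} pre_HB"
  assumes "\<And>c. P (scal c)" and "\<And>p x. P x \<Longrightarrow> P (gen_S p * x)" and "\<And>a x. P x \<Longrightarrow> P (gen_W a * x)"
    and "\<And>x y. P x \<Longrightarrow> P y \<Longrightarrow> P (x + y)"
  shows "P x"
proof (induction x rule: poly_mapping_add_induct)
  case (single m c)
  obtain u where "m = Word u" by (cases m)
  moreover have "P (single (Word u) c)"
  proof (induction u)
    case Nil
    show ?case using assms(1)[of c] by (simp add: zero_word_def)
  next
    case (Cons g u)
    have "single (Word (g # u)) c = single (Word [g]) 1 * single (Word u) c"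
      by (simp add: mult_single)
    then show ?case
      using assms(2)[OF Cons] assms(3)[OF Cons] by (cases g) (simp_all add: gen_S_def gen_W_def)
  qed
  ultimately show ?case by simp
qed (rule assms)

theorem HB_normal_form: "\<exists>p. HB_eq k x (normal_form p)"
proof -
  have "x \<in> normalizable k"
  proof (induction x rule: pre_HB_induct)
    case (scal c)
    have "HB_eq k (scal c * 1) (gen_S (scal c) * gen_W 1)"
      by (intro HB_eq_mult HB_eq_sym[OF gen_S_scal] HB_eq_sym[OF gen_W_one])
    then show ?case using normalizable_cong[OF _ normalizable_SW] by simp
  qed (simp_all add: normalizable_S normalizable_W normalizable_add)
  then show ?thesis by (simp add: normalizable_def)
qed

section \<open>The representation of the presented algebra\<close>

context dunkl_parameters
begin

fun gen_op :: "'n sym_alg + 'n grp_alg \<Rightarrow> 'n::{finite,linorder} endo" where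
  "gen_op (Inl p) = D_poly p"
| "gen_op (Inr a) = grp_op a"

fun word_op :: "('n sym_alg + 'n grp_alg) word \<Rightarrow> 'n::{finite,linorder} endo" where
  "word_op (Word u) = (\<Prod>g\<leftarrow>u. gen_op g)"

text \<open>The lift of the representation to the free algebra.\<close>

definition HB_op :: "'n pre_HB \<Rightarrow> 'n::{finite,linorder} endo" where
  "HB_op = lin_ext escal word_op"

lemma HB_op_alg_map: "alg_map escal HB_op"
  unfolding HB_op_def
proof (rule escal.lin_ext_alg_map)
  show "word_op 0 = 1" by (simp add: zero_word_def)
  show "word_op (u + v) = word_op u * word_op v" for u v
    by (cases u; cases v) simp
qed

lemma HB_op_gen_S: "HB_op (gen_S p) = D_poly p"
  by (simp add: HB_op_def gen_S_def escal.lin_ext_single escal.sc_one)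

lemma HB_op_gen_W: "HB_op (gen_W a) = grp_op a"
  by (simp add: HB_op_def gen_W_def escal.lin_ext_single escal.sc_one)

lemma W_op_sign_D:
  assumes "x \<in> sign_group"
  shows "W_op x * D j = D j * W_op x"
  using assms
proof (induction x rule: sign_group_induct)
  case zero
  show ?case by (simp add: W_op_zero)
next
  case (tau i w)
  show ?case
    unfolding W_op_add by (rule HOL.sym, intro commute_mult HOL.sym[OF tau] HOL.sym[OF W_tau_D])
qed

lemma W_op_sign_D_poly: "x \<in> sign_group \<Longrightarrow> W_op x * D_poly (lin_elem v) = D_poly (lin_elem v) * W_op x"
  unfolding D_poly_lin_elem
  by (intro commute_sum commute_mult escal.sc_central[symmetric] W_op_sign_D)

text \<open>For basis vectors this is \<open>W_sigma_D\<close>; the coroot term sums up the corrections for the indices \<open>i\<close> and \<open>j\<close>.\<close>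

lemma W_op_sigma_D_poly:
  assumes adj: "i < j" "\<And>l. \<not> (i < l \<and> l < j)"
  shows "W_op (sigma i j) * D_poly (lin_elem v)
    = D_poly (lin_elem (reflection (basis_vec i - basis_vec j) v)) * W_op (sigma i j)
      + escal (of_real (coroot (basis_vec i - basis_vec j) (reflection (basis_vec i - basis_vec j) v))) * K_op i j"
proof -
  let ?p = "Transposition.transpose i j" and ?s = "W_op (sigma i j)" and ?K = "K_op i j"
  let ?r = "reflection (basis_vec i - basis_vec j)"
  have ij: "i \<noteq> j" using adj by auto
  have r: "?r v = (\<Sum>l\<in>UNIV. v $ l *\<^sub>R basis_vec (?p l))"
  proof -
    have "?r v = weyl_fun (sigma i j) (\<Sum>l\<in>UNIV. v $ l *\<^sub>R basis_vec l)"
      by (simp add: weyl_fun_refl ij basis_vec_expansion)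
    also have "\<dots> = (\<Sum>l\<in>UNIV. v $ l *\<^sub>R weyl_fun (sigma i j) (basis_vec l))"
      by (simp only: linear_sum[OF linear_weyl_fun] linear_cmul[OF linear_weyl_fun])
    finally show ?thesis by (simp add: sigma_basis ij)
  qed
  have D: "D_poly (lin_elem (?r v)) = (\<Sum>l\<in>UNIV. escal (of_real (v $ l)) * D (?p l))"
    unfolding r lin_elem_sum alg_map.sum[OF D_poly_alg_map] lin_elem_scaleR alg_map.mult[OF D_poly_alg_map]
      alg_map.scal[OF D_poly_alg_map] lin_elem_basis D_poly_var ..
  have c: "coroot (basis_vec i - basis_vec j) (?r v) = v $ j - v $ i"
    using ij unfolding reflection_long[OF basis_diff_long[OF ij]]
    by (simp add: coroot_def inner_diff_left inner_diff_right)
  have "?s * D_poly (lin_elem v) = (\<Sum>l\<in>UNIV. escal (of_real (v $ l)) * (?s * D l))"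
    unfolding D_poly_lin_elem sum_distrib_left escal_left ..
  also have "\<dots> = (\<Sum>l\<in>UNIV. escal (of_real (v $ l)) * D (?p l) * ?s
      + escal (of_real (v $ l)) * (if l = i then - ?K else if l = j then ?K else 0))"
    unfolding W_sigma_D[OF adj] distrib_left mult.assoc ..
  also have "\<dots> = D_poly (lin_elem (?r v)) * ?s
      + (\<Sum>l\<in>UNIV. escal (of_real (v $ l)) * (if l = i then - ?K else if l = j then ?K else 0))"
    by (simp add: sum.distrib D sum_distrib_right)
  also have "(\<Sum>l\<in>UNIV. escal (of_real (v $ l)) * (if l = i then - ?K else if l = j then ?K else 0))
      = (\<Sum>l\<in>UNIV. (if l = i then - escal (of_real (v $ i)) * ?K else 0)
          + (if l = j then escal (of_real (v $ j)) * ?K else 0))"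
    by (rule sum.cong) (use ij in auto)
  also have "\<dots> = escal (of_real (v $ j)) * ?K - escal (of_real (v $ i)) * ?K"
    by (simp add: sum.distrib)
  also have "\<dots> = escal (of_real (v $ j - v $ i)) * ?K"
    by (simp add: escal.sc_diff left_diff_distrib)
  finally show ?thesis unfolding c .
qed

lemma HB_op_hom_relations:
  fixes \<iota> :: "('m::monoid_add \<Rightarrow>\<^sub>0 complex) \<Rightarrow> 'n::{finite,linorder} pre_HB"
  assumes "x \<in> hom_relations \<iota>" "alg_map escal h" "\<And>y. HB_op (\<iota> y) = h y"
  shows "HB_op x = 0"
proof -
  interpret HB_op: alg_map escal "HB_op :: 'n pre_HB \<Rightarrow> 'n endo" by (rule HB_op_alg_map)
  interpret h: alg_map escal h by fact
  show ?thesis using assms(1,3)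
    by (auto simp: hom_relations_def HB_op.diff HB_op.add HB_op.mult HB_op.one HB_op.cscale
        h.add h.mult h.one h.cscale)
qed

lemma HB_op_ideal:
  fixes x :: "'n::{finite,linorder} pre_HB"
  shows "x \<in> HB_ideal k \<Longrightarrow> HB_op x = 0"
proof -
  interpret HB_op: alg_map escal "HB_op :: 'n pre_HB \<Rightarrow> 'n endo" by (rule HB_op_alg_map)
  interpret grp_op: alg_map escal "grp_op :: 'n grp_alg \<Rightarrow> 'n endo" by (rule grp_op_alg_map)
  have cross: "HB_op x = 0" if "x \<in> cross_relations k" for x :: "'n pre_HB"
    using that unfolding cross_relations_def Let_def
  proof (elim UnE CollectE exE conjE)
    fix w v assume "x = gen_W (grp w) * gen_S (lin_elem v) - gen_S (lin_elem v) * gen_W (grp w)" "w \<in> sign_group"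
    then show ?thesis
      by (simp add: HB_op.diff HB_op.mult HB_op_gen_S HB_op_gen_W grp_op_grp W_op_sign_D_poly)
  next
    fix i j :: 'n and v
    let ?\<alpha> = "basis_vec i - basis_vec j"
    assume "x = gen_W (t_refl ?\<alpha>) * gen_S (lin_elem v) - (gen_S (lin_elem (reflection ?\<alpha> v)) * gen_W (t_refl ?\<alpha>)
           + cscale (complex_of_real (coroot ?\<alpha> (reflection ?\<alpha> v))) (gen_W (ktilde k i j)))"
      and "i < j" "\<forall>l. \<not> (i < l \<and> l < j)"
    then show ?thesis
      using W_op_sigma_D_poly[of i j v]
      by (simp add: HB_op.diff HB_op.add HB_op.mult HB_op.cscale HB_op_gen_S HB_op_gen_W t_refl_def
          grp_op_grp grp_op_ktilde)
  qed
  have ideal: "ideal {x. HB_op x = 0} (type_ring :: 'n pre_HB ring)"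
  proof (rule idealI[OF ring_type_ring])
    show "subgroup {x. HB_op x = 0} (add_monoid (type_ring :: 'n pre_HB ring))"
    proof (rule group.subgroupI)
      show "group (add_monoid (type_ring :: 'n pre_HB ring))"
        using ring.is_abelian_group[OF ring_type_ring] abelian_group.a_group by blast
      fix a :: "'n pre_HB"
      assume "a \<in> {x. HB_op x = 0}"
      moreover have "inv\<^bsub>add_monoid (type_ring :: 'n pre_HB ring)\<^esub> a = - a"
        using abelian_group.minus_equality[OF ring.is_abelian_group[OF ring_type_ring], of "- a" a]
        by (simp add: a_inv_def)
      ultimately show "inv\<^bsub>add_monoid (type_ring :: 'n pre_HB ring)\<^esub> a \<in> {x. HB_op x = 0}"
        by (simp add: HB_op.minus)
    qed (use HB_op.zero in \<open>auto simp: HB_op.add\<close>)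
  qed (simp_all add: HB_op.mult)
  have "HB_ideal k \<subseteq> {x :: 'n pre_HB. HB_op x = 0}"
    unfolding HB_ideal_def
  proof (rule ring.genideal_minimal[OF ring_type_ring ideal])
    show "hom_relations gen_S \<union> hom_relations gen_W \<union> cross_relations k \<subseteq> {x :: 'n pre_HB. HB_op x = 0}"
      using HB_op_hom_relations[OF _ D_poly_alg_map HB_op_gen_S] HB_op_hom_relations[OF _ grp_op_alg_map HB_op_gen_W] cross by auto
  qed
  then show "x \<in> HB_ideal k \<Longrightarrow> HB_op x = 0" by blast
qed

lemma HB_op_normal_form: "HB_op (normal_form p) = (\<Sum>w\<in>UNIV. D_poly (p w) * W_op w)"
  by (simp add: normal_form_def alg_map.sum[OF HB_op_alg_map] alg_map.mult[OF HB_op_alg_map]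
      HB_op_gen_S HB_op_gen_W grp_op_grp)

lemma HB_op_cong: "HB_eq k x y \<Longrightarrow> HB_op x = HB_op y"
  using HB_op_ideal[of "x - y"] by (simp add: HB_eq_def alg_map.diff[OF HB_op_alg_map])

text \<open>Both elements are congruent to normal forms, and the operators occurring in these are independent.\<close>

lemma HB_op_faithful:
  assumes "HB_op x = HB_op y"
  shows "HB_eq k x y"
proof -
  obtain p where p: "HB_eq k (x - y) (normal_form p)" using HB_normal_form by blast
  have "(\<Sum>w\<in>UNIV. D_poly (p w) * W_op w) = 0"
    using HB_op_cong[OF p] assms by (simp add: HB_op_normal_form alg_map.diff[OF HB_op_alg_map])
  then have "p = (\<lambda>_. 0)" using D_poly_W_op_independent by blast
  moreover have "HB_eq k (normal_form (\<lambda>_. 0)) (\<Sum>w\<in>UNIV. 0 * gen_W (grp w))"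
    unfolding normal_form_def by (intro HB_eq_sum HB_eq_mult HB_eq_refl gen_S_zero)
  ultimately have "HB_eq k (x - y) 0" using HB_eq_trans[OF p] by simp
  then show ?thesis by (simp add: HB_eq_def)
qed

lemma normal_form_unique:
  assumes "HB_eq k (normal_form p) 0"
  shows "p w = 0"
  using D_poly_W_op_independent[of p w] HB_op_cong[OF assms]
  by (simp add: HB_op_normal_form alg_map.zero[OF HB_op_alg_map])

end

section \<open>The algebra \<open>HB\<close> and its classes\<close>

lemma HB_class_eq: "HB_class k x = {y. HB_eq k y x}"
proof -
  have "HB_class k x = {h + x | h. h \<in> HB_ideal k}"
    by (auto simp: HB_class_def a_r_coset_def r_coset_def)
  then show ?thesis
    by (auto simp: HB_eq_def)
qed

lemma HB_class_eq_iff: "HB_class k x = HB_class k y \<longleftrightarrow> HB_eq k x y"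
  unfolding HB_class_eq using HB_eq_refl HB_eq_sym HB_eq_trans by blast

lemma HB_class_mem: "x \<in> HB_class k x"
  by (simp add: HB_class_eq)

lemma HB_ring_simps:
  fixes x y :: "'n::{finite,linorder} pre_HB"
  shows "carrier (HB_ring k) = range (HB_class k :: 'n pre_HB \<Rightarrow> 'n pre_HB set)"
    and "HB_class k x \<otimes>\<^bsub>HB_ring k\<^esub> HB_class k y = HB_class k (x * y)"
    and "HB_class k x \<oplus>\<^bsub>HB_ring k\<^esub> HB_class k y = HB_class k (x + y)"
    and "\<one>\<^bsub>HB_ring k\<^esub> = HB_class k (1 :: 'n pre_HB)"
proof -
  interpret I: ideal "HB_ideal k" "type_ring :: 'n pre_HB ring" by (rule ideal_HB_ideal)
  show "carrier (HB_ring k) = range (HB_class k :: 'n pre_HB \<Rightarrow> 'n pre_HB set)"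
    by (auto simp: HB_ring_def FactRing_def A_RCOSETS_def' HB_class_def)
  show "HB_class k x \<otimes>\<^bsub>HB_ring k\<^esub> HB_class k y = HB_class k (x * y)"
    using I.rcoset_mult_add[of x y] by (simp add: HB_ring_def FactRing_def HB_class_def)
  show "HB_class k x \<oplus>\<^bsub>HB_ring k\<^esub> HB_class k y = HB_class k (x + y)"
    using I.a_rcos_sum[of x y] by (simp add: HB_ring_def FactRing_def HB_class_def)
  show "\<one>\<^bsub>HB_ring k\<^esub> = HB_class k (1 :: 'n pre_HB)"
    by (simp add: HB_ring_def FactRing_def HB_class_def)
qed

lemma with_smult_simps:
  shows "carrier (with_smult R s) = carrier R" "mult (with_smult R s) = mult R" "one (with_smult R s) = one R"
    "add (with_smult R s) = add R" "smult (with_smult R s) = s"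
  by (simp_all add: with_smult_def ring.defs module.defs)

lemma HB_simps:
  shows "carrier (HB k) = range (HB_class k)"
    and "HB_class k x \<otimes>\<^bsub>HB k\<^esub> HB_class k y = HB_class k (x * y)"
    and "HB_class k x \<oplus>\<^bsub>HB k\<^esub> HB_class k y = HB_class k (x + y)"
    and "\<one>\<^bsub>HB k\<^esub> = HB_class k 1"
    and "c \<odot>\<^bsub>HB k\<^esub> HB_class k x = HB_class k (scal c * x)"
  by (simp_all add: HB_def with_smult_simps HB_ring_simps cscale_eq_mult)

lemma HB_S_module_simps:
  shows "carrier (HB_S_module k) = range (HB_class k)"
    and "HB_class k x \<oplus>\<^bsub>HB_S_module k\<^esub> HB_class k y = HB_class k (x + y)"
    and "p \<odot>\<^bsub>HB_S_module k\<^esub> HB_class k x = HB_class k (gen_S p * x)"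
  by (simp_all add: HB_S_module_def with_smult_simps HB_ring_simps)

section \<open>The tensor product\<close>

lemma cscale_single: "cscale c (single m a) = single m (c * a)"
  by (simp add: cscale_def)

lemma lookup_cscale: "lookup (cscale c f) m = c * lookup f m"
  by (simp add: cscale_def Poly_Mapping.map.rep_eq when_def)

lemma cscale_add: "cscale c (f + g) = cscale c f + cscale c g"
  by (rule poly_mapping_eqI) (simp add: lookup_cscale lookup_add distrib_left)

lemma cscale_zero: "cscale c 0 = 0"
  by (rule poly_mapping_eqI) (simp add: lookup_cscale)

lemma cscale_minus_one: "cscale (- 1) f = - f"
  by (rule poly_mapping_eqI) (simp add: lookup_cscale)

abbreviation tens :: "('a \<Rightarrow>\<^sub>0 complex) \<Rightarrow> ('b \<Rightarrow>\<^sub>0 complex) \<Rightarrow>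
    ((('a \<Rightarrow>\<^sub>0 complex) \<times> ('b \<Rightarrow>\<^sub>0 complex)) \<Rightarrow>\<^sub>0 complex)" where
  "tens x y \<equiv> single (x, y) 1"

definition tens_eq where
  "tens_eq f g \<longleftrightarrow> f - g \<in> tensor_null"

lemma tensor_null_minus: "f \<in> tensor_null \<Longrightarrow> - f \<in> tensor_null"
  using tensor_null.scale[of f "- 1"] by (simp add: cscale_minus_one)

lemma tens_eq_refl [simp]: "tens_eq f f"
  by (simp add: tens_eq_def tensor_null.zero)

lemma tens_eq_sym: "tens_eq f g \<Longrightarrow> tens_eq g f"
  unfolding tens_eq_def using tensor_null_minus[of "f - g"] by simp

lemma tens_eq_trans [trans]: "tens_eq f g \<Longrightarrow> tens_eq g h \<Longrightarrow> tens_eq f h"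
  unfolding tens_eq_def using tensor_null.add[of "f - g" "g - h"] by simp

lemma tens_eq_add: "tens_eq f f' \<Longrightarrow> tens_eq g g' \<Longrightarrow> tens_eq (f + g) (f' + g')"
  unfolding tens_eq_def using tensor_null.add[of "f - f'" "g - g'"] by (simp add: algebra_simps)

lemma tens_eq_sum: "(\<And>i. i \<in> I \<Longrightarrow> tens_eq (f i) (g i)) \<Longrightarrow> tens_eq (\<Sum>i\<in>I. f i) (\<Sum>i\<in>I. g i)"
  by (induction I rule: infinite_finite_induct) (simp_all add: tens_eq_add)

lemma tens_add_left: "tens_eq (tens (x + x') y) (tens x y + tens x' y)"
  using tensor_null.add_left[of x x' y] by (simp add: tens_eq_def algebra_simps)

lemma tens_add_right: "tens_eq (tens x (y + y')) (tens x y + tens x y')"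
  using tensor_null.add_right[of x y y'] by (simp add: tens_eq_def algebra_simps)

lemma tens_scale_left: "tens_eq (tens (cscale c x) y) (single (x, y) c)"
  using tensor_null.scale_left[of c x y] by (simp add: tens_eq_def)

lemma tens_scale_right: "tens_eq (tens x (cscale c y)) (single (x, y) c)"
  using tensor_null.scale_right[of x c y] by (simp add: tens_eq_def)

lemma tens_zero_left: "tens_eq (tens 0 y) 0"
  using tens_scale_left[of 0 0 y] by (simp add: cscale_zero)

lemma tens_zero_right: "tens_eq (tens x 0) 0"
  using tens_scale_right[of x 0 0] by (simp add: cscale_zero)

lemma tens_sum_right: "tens_eq (tens x (\<Sum>i\<in>I. f i)) (\<Sum>i\<in>I. tens x (f i))"
proof (induction I rule: infinite_finite_induct)
  case (insert i I)
  then show ?case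
    using tens_eq_trans[OF tens_add_right tens_eq_add[OF tens_eq_refl insert.IH]] by simp
qed (simp_all add: tens_zero_right)

definition tens_normal_form :: "('n weyl \<Rightarrow> 'n sym_alg) \<Rightarrow>
    (('n sym_alg \<times> 'n::{finite,linorder} grp_alg) \<Rightarrow>\<^sub>0 complex)" where
  "tens_normal_form p = (\<Sum>w\<in>UNIV. tens (p w) (grp w))"

text \<open>Bilinearity allows the second factor to be expanded in the basis of the group algebra.\<close>

lemma tens_normal_form_exists: "\<exists>p. tens_eq f (tens_normal_form p)"
proof (induction f rule: poly_mapping_add_induct)
  case (single xy c)
  obtain x and y :: "'a grp_alg" where xy: "xy = (x, y)" by (cases xy)
  let ?a = "lookup y"
  have y: "(\<Sum>w\<in>UNIV. cscale (?a w) (grp w)) = y"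
    using grp_alg_expansion[of y] by (simp add: cscale_eq_mult)
  have "tens_eq (single (x, y) c) (tens (cscale c x) y)"
    by (rule tens_eq_sym[OF tens_scale_left])
  also have "tens_eq \<dots> (\<Sum>w\<in>UNIV. tens (cscale c x) (cscale (?a w) (grp w)))"
    using tens_sum_right[of "cscale c x" "\<lambda>w. cscale (?a w) (grp w)" UNIV] unfolding y .
  also have "tens_eq \<dots> (tens_normal_form (\<lambda>w. cscale (?a w) (cscale c x)))"
    unfolding tens_normal_form_def
    by (rule tens_eq_sum, rule tens_eq_trans[OF tens_scale_right tens_eq_sym[OF tens_scale_left]])
  finally show ?case unfolding xy by blast
next
  case (add f g)
  then obtain p q where "tens_eq f (tens_normal_form p)" "tens_eq g (tens_normal_form q)" by blast
  then have "tens_eq (f + g) (tens_normal_form p + tens_normal_form q)" by (rule tens_eq_add)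
  also have "tens_eq \<dots> (tens_normal_form (\<lambda>w. p w + q w))"
    unfolding tens_normal_form_def sum.distrib[symmetric]
    by (rule tens_eq_sum, rule tens_eq_sym[OF tens_add_left])
  finally show ?case by blast
qed

lemma tensor_act_add: "tensor_act p (f + g) = tensor_act p f + tensor_act p g"
proof -
  let ?h = "\<lambda>xy c. single (p * fst xy, snd xy) c"
  have eq: "tensor_act p f = (\<Sum>xy\<in>Poly_Mapping.keys f. ?h xy (lookup f xy))" for f
    by (simp add: tensor_act_def case_prod_unfold)
  show ?thesis unfolding eq by (rule setsum_keys_plus_distrib) (simp_all add: single_add)
qed

lemma tensor_act_single: "tensor_act p (single (x, y) c) = single (p * x, y) c"
  by (simp add: tensor_act_def)

lemma tensor_act_zero: "tensor_act p 0 = 0"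
  by (simp add: tensor_act_def)

lemma tensor_act_diff: "tensor_act p (f - g) = tensor_act p f - tensor_act p g"
  using tensor_act_add[of p "f - g" g] by simp

lemma tensor_act_cscale: "tensor_act p (cscale c f) = cscale c (tensor_act p f)"
proof (induction f rule: poly_mapping_add_induct)
  case (single xy a)
  then show ?case by (cases xy) (simp add: cscale_single tensor_act_single)
qed (simp add: cscale_add tensor_act_add)

lemma tensor_act_null: "f \<in> tensor_null \<Longrightarrow> tensor_act p f \<in> tensor_null"
proof (induction rule: tensor_null.induct)
  case zero
  show ?case by (simp add: tensor_act_zero tensor_null.zero)
next
  case (add f g)
  then show ?case by (simp add: tensor_act_add tensor_null.add)
next
  case (scale f c)
  then show ?case by (simp add: tensor_act_cscale tensor_null.scale)
next
  case (add_left x x' y)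
  show ?case using tensor_null.add_left[of "p * x" "p * x'" y]
    by (simp add: tensor_act_diff tensor_act_single distrib_left)
next
  case (add_right x y y')
  show ?case using tensor_null.add_right[of "p * x" y y']
    by (simp add: tensor_act_diff tensor_act_single)
next
  case (scale_left c x y)
  have "p * cscale c x = cscale c (p * x)"
    by (simp add: cscale_eq_mult scal_central[of c "p * x"] scal_central[of c x] mult.assoc)
  then show ?case using tensor_null.scale_left[of c "p * x" y]
    by (simp add: tensor_act_diff tensor_act_single)
next
  case (scale_right x c y)
  show ?case using tensor_null.scale_right[of "p * x" c y]
    by (simp add: tensor_act_diff tensor_act_single)
qed

definition tens_class :: "((('a \<Rightarrow>\<^sub>0 complex) \<times> ('b \<Rightarrow>\<^sub>0 complex)) \<Rightarrow>\<^sub>0 complex) \<Rightarrow>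
    ((('a \<Rightarrow>\<^sub>0 complex) \<times> ('b \<Rightarrow>\<^sub>0 complex)) \<Rightarrow>\<^sub>0 complex) set" where
  "tens_class f = tensor_rel `` {f}"

lemma tens_class_eq: "tens_class f = {g. tens_eq f g}"
  by (auto simp: tens_class_def tensor_rel_def tens_eq_def)

lemma tens_class_eq_iff: "tens_class f = tens_class g \<longleftrightarrow> tens_eq f g"
  unfolding tens_class_eq using tens_eq_refl tens_eq_sym tens_eq_trans by blast

lemma tens_class_mem: "f \<in> tens_class f"
  by (simp add: tens_class_eq)

lemma tensor_simps:
  shows "carrier tensor = range tens_class"
    and "tens_class f \<oplus>\<^bsub>tensor\<^esub> tens_class g = tens_class (f + g)"
    and "p \<odot>\<^bsub>tensor\<^esub> tens_class f = tens_class (tensor_act p f)"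
proof -
  show "carrier tensor = range tens_class"
    by (auto simp: tensor_def tens_class_def quotient_def)
  have add_eq: "tens_class (f' + g') = tens_class (f + g)" if "f' \<in> tens_class f" "g' \<in> tens_class g" for f' g'
    using that unfolding tens_class_eq_iff by (auto simp: tens_class_eq intro: tens_eq_add tens_eq_sym)
  have "tens_class f \<oplus>\<^bsub>tensor\<^esub> tens_class g = (\<Union>f'\<in>tens_class f. \<Union>g'\<in>tens_class g. tens_class (f' + g'))"
    by (simp add: tensor_def tens_class_def)
  also have "\<dots> = (\<Union>f'\<in>tens_class f. \<Union>g'\<in>tens_class g. tens_class (f + g))"
    by (intro SUP_cong HOL.refl add_eq)
  also have "\<dots> = tens_class (f + g)" using tens_class_mem[of f] tens_class_mem[of g] by blast
  finally show "tens_class f \<oplus>\<^bsub>tensor\<^esub> tens_class g = tens_class (f + g)" .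
  have act_eq: "tens_class (tensor_act p f') = tens_class (tensor_act p f)" if "f' \<in> tens_class f" for f'
  proof -
    have "tens_eq f' f" using that by (auto simp: tens_class_eq intro: tens_eq_sym)
    then show ?thesis
      unfolding tens_class_eq_iff tens_eq_def by (simp add: tensor_act_null flip: tensor_act_diff)
  qed
  have "p \<odot>\<^bsub>tensor\<^esub> tens_class f = (\<Union>f'\<in>tens_class f. tens_class (tensor_act p f'))"
    by (simp add: tensor_def tens_class_def)
  also have "\<dots> = (\<Union>f'\<in>tens_class f. tens_class (tensor_act p f))"
    by (intro SUP_cong HOL.refl act_eq)
  also have "\<dots> = tens_class (tensor_act p f)" using tens_class_mem[of f] by blast
  finally show "p \<odot>\<^bsub>tensor\<^esub> tens_class f = tens_class (tensor_act p f)" .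
qed

text \<open>The isomorphism, on representatives. It is injective because normal forms of the tensor product go to
  normal forms of the presented algebra, which are unique.\<close>

definition tens_mult :: "(('n sym_alg \<times> 'n::{finite,linorder} grp_alg) \<Rightarrow>\<^sub>0 complex) \<Rightarrow> 'n pre_HB" where
  "tens_mult = lin_ext scal (\<lambda>(p, a). gen_S p * gen_W a)"

lemma tens_mult_add: "tens_mult (f + g) = tens_mult f + tens_mult g"
  unfolding tens_mult_def by (rule scal.lin_ext_add)

lemma tens_mult_single: "tens_mult (single (p, a) c) = scal c * (gen_S p * gen_W a)"
  by (simp add: tens_mult_def scal.lin_ext_single)

lemma tens_mult_zero: "tens_mult 0 = 0"
  by (simp add: tens_mult_def lin_ext_def)

lemma tens_mult_diff: "tens_mult (f - g) = tens_mult f - tens_mult g"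
  using tens_mult_add[of "f - g" g] by simp

lemma tens_mult_cscale: "tens_mult (cscale c f) = scal c * tens_mult f"
proof (induction f rule: poly_mapping_add_induct)
  case (single xy a)
  then show ?case
    by (cases xy) (simp add: cscale_single tens_mult_single scal.sc_mult mult.assoc)
qed (simp add: cscale_add tens_mult_add distrib_left)

lemma tens_mult_normal_form: "tens_mult (tens_normal_form p) = normal_form p"
proof -
  have "tens_mult (\<Sum>w\<in>A. tens (p w) (grp w)) = (\<Sum>w\<in>A. gen_S (p w) * gen_W (grp w))" for A
    by (induction A rule: infinite_finite_induct)
      (simp_all add: tens_mult_zero tens_mult_add tens_mult_single)
  then show ?thesis by (simp add: tens_normal_form_def normal_form_def)
qed

lemma tens_mult_null: "f \<in> tensor_null \<Longrightarrow> HB_eq k (tens_mult f) 0"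
proof (induction rule: tensor_null.induct)
  case zero
  show ?case by (simp add: tens_mult_zero)
next
  case (add f g)
  then show ?case using HB_eq_add[of k "tens_mult f" 0 "tens_mult g" 0] by (simp add: tens_mult_add)
next
  case (scale f c)
  then show ?case using HB_eq_mult[of k "scal c" "scal c" "tens_mult f" 0] by (simp add: tens_mult_cscale)
next
  case (add_left p p' a)
  have "HB_eq k (gen_S (p + p') * gen_W a) ((gen_S p + gen_S p') * gen_W a)"
    by (intro HB_eq_mult gen_S_add HB_eq_refl)
  then show ?case by (simp add: tens_mult_diff tens_mult_add tens_mult_single HB_eq_def algebra_simps)
next
  case (add_right p a a')
  have "HB_eq k (gen_S p * gen_W (a + a')) (gen_S p * (gen_W a + gen_W a'))"
    by (intro HB_eq_mult gen_W_add HB_eq_refl)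
  then show ?case by (simp add: tens_mult_diff tens_mult_add tens_mult_single HB_eq_def algebra_simps)
next
  case (scale_left c p a)
  have "HB_eq k (gen_S (scal c * p) * gen_W a) (scal c * gen_S p * gen_W a)"
    by (intro HB_eq_mult gen_S_scale HB_eq_refl)
  then show ?case by (simp add: tens_mult_diff tens_mult_single HB_eq_def cscale_eq_mult mult.assoc)
next
  case (scale_right p c a)
  have "HB_eq k (gen_S p * gen_W (scal c * a)) (gen_S p * (scal c * gen_W a))"
    by (intro HB_eq_mult gen_W_scale HB_eq_refl)
  moreover have "gen_S p * (scal c * gen_W a) = scal c * (gen_S p * gen_W a)"
    by (simp only: mult.assoc[symmetric] scal_central[of c "gen_S p"])
  ultimately show ?case by (simp add: tens_mult_diff tens_mult_single HB_eq_def cscale_eq_mult)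
qed

lemma tens_mult_cong: "tens_eq f g \<Longrightarrow> HB_eq k (tens_mult f) (tens_mult g)"
  using tens_mult_null[of "f - g" k] by (simp add: tens_eq_def tens_mult_diff HB_eq_def)

lemma tens_mult_act: "HB_eq k (tens_mult (tensor_act p f)) (gen_S p * tens_mult f)"
proof (induction f rule: poly_mapping_add_induct)
  case (single xy c)
  obtain q a where xy: "xy = (q, a)" by (cases xy)
  have "HB_eq k (scal c * (gen_S (p * q) * gen_W a)) (scal c * (gen_S p * gen_S q * gen_W a))"
    by (intro HB_eq_mult gen_S_mult HB_eq_refl)
  also have "scal c * (gen_S p * gen_S q * gen_W a) = gen_S p * (scal c * (gen_S q * gen_W a))"
    by (simp only: mult.assoc[symmetric] scal_central[of c "gen_S p"])
  finally show ?case by (simp add: xy tensor_act_single tens_mult_single)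
next
  case (add f g)
  then show ?case by (simp add: tensor_act_add tens_mult_add distrib_left HB_eq_add)
qed

lemma tens_mult_inject:
  fixes f g :: "('n sym_alg \<times> 'n::{finite,linorder} grp_alg) \<Rightarrow>\<^sub>0 complex"
  assumes "HB_eq k (tens_mult f) (tens_mult g)"
  shows "tens_eq f g"
proof -
  \<comment> \<open>Any value of the parameter on the short roots gives a faithful representation; the presentation depends on \<open>k\<close> only.\<close>
  interpret dunkl_parameters k 0 .
  obtain p where p: "tens_eq (f - g) (tens_normal_form p)" using tens_normal_form_exists by blast
  have "HB_eq k (tens_mult (f - g)) 0"
    using assms by (simp add: tens_mult_diff HB_eq_def)
  then have "HB_eq k (normal_form p) 0"
    using HB_eq_trans[OF HB_eq_sym[OF tens_mult_cong[OF p]]] by (simp add: tens_mult_normal_form)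
  then have "p = (\<lambda>_. 0)" using normal_form_unique by blast
  moreover have "tens_eq (tens_normal_form (\<lambda>_ :: 'n weyl. 0)) (\<Sum>w\<in>(UNIV :: 'n weyl set). 0)"
    unfolding tens_normal_form_def by (intro tens_eq_sum tens_zero_left)
  ultimately have "tens_eq (f - g) 0" using tens_eq_trans[OF p] by simp
  then show ?thesis by (simp add: tens_eq_def)
qed

lemma tensor_iso_HB:
  fixes k :: complex
  defines "\<theta> \<equiv> \<lambda>X. HB_class k (tens_mult (SOME f. f \<in> X))"
  shows "\<theta> \<in> module_iso (type_ring :: 'n::{finite,linorder} sym_alg ring) tensor (HB_S_module k)"
proof -
  have val: "\<theta> (tens_class f) = HB_class k (tens_mult f)" for f
  proof -
    have "(SOME g. g \<in> tens_class f) \<in> tens_class f" by (rule someI[of _ f]) (rule tens_class_mem)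
    then have "tens_eq f (SOME g. g \<in> tens_class f)" by (simp add: tens_class_eq)
    from tens_mult_cong[OF tens_eq_sym[OF this]] show ?thesis
      unfolding \<theta>_def HB_class_eq_iff .
  qed
  have "\<exists>f. HB_class k (tens_mult f) = HB_class k x" for x :: "'n pre_HB"
  proof -
    obtain p where "HB_eq k x (normal_form p)" using HB_normal_form by blast
    then have "HB_class k (tens_mult (tens_normal_form p)) = HB_class k x"
      unfolding HB_class_eq_iff tens_mult_normal_form by (rule HB_eq_sym)
    then show ?thesis by blast
  qed
  then have surj: "range (HB_class k) \<subseteq> \<theta> ` range tens_class"
    by (auto simp: val image_iff) (metis)
  have "bij_betw \<theta> (carrier tensor) (carrier (HB_S_module k))"
    unfolding bij_betw_def tensor_simps HB_S_module_simps
  proof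
    show "inj_on \<theta> (range tens_class)"
      by (rule inj_onI, elim rangeE) (simp add: val HB_class_eq_iff tens_class_eq_iff tens_mult_inject)
    show "\<theta> ` range tens_class = range (HB_class k)"
      using surj by (auto simp: val)
  qed
  moreover have "HB_class k (tens_mult (tensor_act p f)) = HB_class k (gen_S p * tens_mult f)" for p f
    unfolding HB_class_eq_iff by (rule tens_mult_act)
  ultimately show ?thesis
    unfolding module_iso_def tensor_simps(1)
    by (auto simp: tensor_simps HB_S_module_simps val tens_mult_add)
qed

section \<open>The isomorphism\<close>

lemma End_P_simps: "mult End_P = (\<circ>)" "one End_P = id"
  "add End_P = (\<lambda>f g p. f p + g p)" "smult End_P = (\<lambda>c f p. scal c * f p)"
  by (simp_all add: End_P_def cscale_eq_mult)

text \<open>Every element is congruent to one built from scalars, the \<open>\<epsilon>\<^sub>j\<close> and the \<open>t\<^sub>w\<close>, so homomorphisms are determined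
  by their values on these.\<close>

lemma HB_eq_generators [case_names scal var grp add mult cong]:
  assumes "\<And>c. P (scal c)" and "\<And>j. P (gen_S (var j))" and "\<And>w. P (gen_W (grp w))"
    and "\<And>x y. P x \<Longrightarrow> P y \<Longrightarrow> P (x + y)" and "\<And>x y. P x \<Longrightarrow> P y \<Longrightarrow> P (x * y)"
    and cong: "\<And>x y. HB_eq k x y \<Longrightarrow> P y \<Longrightarrow> P x"
  shows "P x"
proof -
  have S: "P (gen_S p)" for p
  proof (induction p rule: sym_alg_induct)
    case (scal c)
    show ?case using cong[OF gen_S_scal] assms(1) .
  next
    case (add p q)
    show ?case using cong[OF gen_S_add] assms(4) add by blast
  next
    case (mult p q)
    show ?case using cong[OF gen_S_mult] assms(5) mult by blast
  qed (rule assms)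
  have "P (\<Sum>w\<in>A. gen_S (p w) * gen_W (grp w))" for p A
    by (induction A rule: infinite_finite_induct) (use assms(1)[of 0] in \<open>simp_all add: S assms\<close>)
  moreover obtain p where "HB_eq k x (normal_form p)" using HB_normal_form by blast
  ultimately show ?thesis using cong unfolding normal_form_def by blast
qed

context dunkl_parameters
begin

abbreviation DB_gens :: "('n sym_alg \<Rightarrow> 'n::{finite,linorder} sym_alg) set" where
  "DB_gens \<equiv> range (zT k kc) \<union> range weyl_act"

lemma DB_simps:
  shows "carrier (DB k kc) = subalg_gen End_P DB_gens" "mult (DB k kc) = (\<circ>)" "one (DB k kc) = id"
    "add (DB k kc) = (\<lambda>f g p. f p + g p)" "smult (DB k kc) = (\<lambda>c f p. scal c * f p)"
  by (simp_all add: DB_def End_P_simps)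

lemma subalg_app:
  shows "app 1 \<in> subalg_gen End_P DB_gens"
    and "app x \<in> subalg_gen End_P DB_gens \<Longrightarrow> app y \<in> subalg_gen End_P DB_gens \<Longrightarrow> app (x + y) \<in> subalg_gen End_P DB_gens"
    and "app x \<in> subalg_gen End_P DB_gens \<Longrightarrow> app y \<in> subalg_gen End_P DB_gens \<Longrightarrow> app (x * y) \<in> subalg_gen End_P DB_gens"
    and "app (escal c) \<in> subalg_gen End_P DB_gens"
    and "app (A_op j) \<in> subalg_gen End_P DB_gens"
    and "app (W_op w) \<in> subalg_gen End_P DB_gens"
proof -
  show 1: "app 1 \<in> subalg_gen End_P DB_gens"
    using subalg_gen.one[of End_P DB_gens] by (simp add: End_P_simps id_def one_endo.rep_eq)
  show "app x \<in> subalg_gen End_P DB_gens \<Longrightarrow> app y \<in> subalg_gen End_P DB_gens \<Longrightarrow> app (x + y) \<in> subalg_gen End_P DB_gens"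
    using subalg_gen.add[of "app x" End_P DB_gens "app y"] by (simp add: End_P_simps plus_endo.rep_eq)
  show "app x \<in> subalg_gen End_P DB_gens \<Longrightarrow> app y \<in> subalg_gen End_P DB_gens \<Longrightarrow> app (x * y) \<in> subalg_gen End_P DB_gens"
    using subalg_gen.mult[of "app x" End_P DB_gens "app y"] by (simp add: End_P_simps times_endo.rep_eq comp_def)
  show "app (escal c) \<in> subalg_gen End_P DB_gens"
    using subalg_gen.smult[OF 1, of c] by (simp add: End_P_simps one_endo.rep_eq app_escal[abs_def])
  show "app (A_op j) \<in> subalg_gen End_P DB_gens"
    unfolding app_A_op by (intro subalg_gen.gen) simp
  have "app (W_op w) = weyl_act w" by (rule ext) simp
  then show "app (W_op w) \<in> subalg_gen End_P DB_gens"
    by (simp add: subalg_gen.gen)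
qed

lemma app_B_op_subalg: "app (B_op i j) \<in> subalg_gen End_P DB_gens"
  unfolding B_op_def K_op_def by (intro subalg_app)

lemma app_HB_op_subalg: "app (HB_op x) \<in> subalg_gen End_P DB_gens"
proof (induction x rule: HB_eq_generators[where k = k])
  case (scal c)
  show ?case unfolding alg_map.scal[OF HB_op_alg_map] by (rule subalg_app)
next
  case (var j)
  have "app (A_op j + (\<Sum>i\<in>I. B_op i j)) \<in> subalg_gen End_P DB_gens" if "finite I" for I
    using that
  proof induction
    case empty
    show ?case unfolding sum.empty add_0_right by (rule subalg_app)
  next
    case (insert i I)
    show ?case
      unfolding sum.insert[OF insert.hyps] add.left_commute[of "A_op j"]
      by (rule subalg_app(2)[OF app_B_op_subalg insert.IH])
  qed
  then show ?case unfolding HB_op_gen_S D_poly_var D_def by simp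
next
  case (grp w)
  show ?case unfolding HB_op_gen_W grp_op_grp by (rule subalg_app)
next
  case (add x y)
  then show ?case unfolding alg_map.add[OF HB_op_alg_map] by (rule subalg_app)
next
  case (mult x y)
  then show ?case unfolding alg_map.mult[OF HB_op_alg_map] by (rule subalg_app)
next
  case (cong x y)
  then show ?case using HB_op_cong[OF cong(1)] by simp
qed

text \<open>The generator \<open>z\<^sub>j T\<^sub>j\<close> is the image of \<open>\<epsilon>\<^sub>j\<close> minus the elements \<open>k (1 + t\<^sub>i t\<^sub>j) s\<^sub>i\<^sub>j\<close> with \<open>i < j\<close>.\<close>

lemma subalg_range_HB_op: "f \<in> subalg_gen End_P DB_gens \<Longrightarrow> \<exists>x. f = app (HB_op x)"
proof (induction rule: subalg_gen.induct)
  case one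
  have "\<one>\<^bsub>End_P\<^esub> = app (HB_op 1)"
    by (simp add: End_P_simps alg_map.one[OF HB_op_alg_map] one_endo.rep_eq id_def)
  then show ?case ..
next
  case (gen f)
  then consider j where "f = zT k kc j" | w where "f = weyl_act w" by blast
  then show ?case
  proof cases
    case 1
    have "HB_op (gen_S (var j) - (\<Sum>i\<in>{..<j}. gen_W (ktilde k i j * grp (sigma i j)))) = A_op j"
      by (simp add: alg_map.diff[OF HB_op_alg_map] alg_map.sum[OF HB_op_alg_map] HB_op_gen_S D_poly_var D_def
          HB_op_gen_W alg_map.mult[OF grp_op_alg_map] grp_op_grp grp_op_ktilde B_op_def)
    with 1 have "f = app (HB_op (gen_S (var j) - (\<Sum>i\<in>{..<j}. gen_W (ktilde k i j * grp (sigma i j)))))"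
      by (simp only: app_A_op)
    then show ?thesis by blast
  next
    case 2
    have "weyl_act w = app (HB_op (gen_W (grp w)))"
      by (rule ext) (simp add: HB_op_gen_W grp_op_grp)
    then show ?thesis using 2 by blast
  qed
next
  case (add f g)
  then obtain x y where "f = app (HB_op x)" "g = app (HB_op y)" by blast
  then have "f \<oplus>\<^bsub>End_P\<^esub> g = app (HB_op (x + y))"
    by (simp add: End_P_simps alg_map.add[OF HB_op_alg_map] plus_endo.rep_eq)
  then show ?case ..
next
  case (mult f g)
  then obtain x y where "f = app (HB_op x)" "g = app (HB_op y)" by blast
  then have "f \<otimes>\<^bsub>End_P\<^esub> g = app (HB_op (x * y))"
    by (simp add: End_P_simps alg_map.mult[OF HB_op_alg_map] times_endo.rep_eq comp_def)
  then show ?case ..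
next
  case (smult f c)
  then obtain x where "f = app (HB_op x)" by blast
  then have "c \<odot>\<^bsub>End_P\<^esub> f = app (HB_op (scal c * x))"
    by (simp add: End_P_simps alg_map.mult[OF HB_op_alg_map] alg_map.scal[OF HB_op_alg_map] times_endo.rep_eq)
  then show ?case ..
qed

definition Phi :: "'n pre_HB set \<Rightarrow> 'n sym_alg \<Rightarrow> 'n::{finite,linorder} sym_alg" where
  "Phi X = app (HB_op (SOME x. x \<in> X))"

lemma Phi_class: "Phi (HB_class k x) = app (HB_op x)"
proof -
  have "(SOME y. y \<in> HB_class k x) \<in> HB_class k x" by (rule someI[of _ x]) (rule HB_class_mem)
  then have "HB_eq k (SOME y. y \<in> HB_class k x) x" by (simp add: HB_class_eq)
  then show ?thesis unfolding Phi_def by (simp only: HB_op_cong)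
qed

lemma Phi_alg_iso:
  "(Phi :: 'n::{finite,linorder} pre_HB set \<Rightarrow> 'n sym_alg \<Rightarrow> 'n sym_alg) \<in> alg_iso (HB k) (DB k kc)"
proof -
  let ?Phi = "Phi :: 'n pre_HB set \<Rightarrow> 'n sym_alg \<Rightarrow> 'n sym_alg"
  interpret HB_op: alg_map escal HB_op by (rule HB_op_alg_map)
  have "?Phi \<in> ring_hom (HB k) (DB k kc)"
    by (rule ring_hom_memI)
      (auto simp: HB_simps DB_simps Phi_class app_HB_op_subalg HB_op.add HB_op.mult HB_op.one fun_eq_iff)
  moreover have "\<forall>c. \<forall>x\<in>carrier (HB k). ?Phi (c \<odot>\<^bsub>HB k\<^esub> x) = c \<odot>\<^bsub>DB k kc\<^esub> ?Phi x"
    by (auto simp: HB_simps DB_simps Phi_class HB_op.mult HB_op.scal fun_eq_iff)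
  moreover have "inj_on ?Phi (range (HB_class k))"
    by (rule inj_onI, elim rangeE) (simp add: Phi_class HB_class_eq_iff app_inject HB_op_faithful)
  moreover have "?Phi ` range (HB_class k) = subalg_gen End_P DB_gens"
  proof (intro equalityI subsetI)
    fix f :: "'n sym_alg \<Rightarrow> 'n sym_alg"
    assume "f \<in> subalg_gen End_P DB_gens"
    then obtain x where "f = app (HB_op x)" using subalg_range_HB_op by blast
    then show "f \<in> ?Phi ` range (HB_class k)" by (auto simp flip: Phi_class)
  qed (auto simp: Phi_class app_HB_op_subalg)
  ultimately show ?thesis
    by (simp add: alg_iso_def alg_hom_def bij_betw_def HB_simps DB_simps)
qed

lemma Phi_eps: "Phi (HB_eps k j) = D_op k kc j"
  by (simp add: HB_eps_def Phi_class HB_op_gen_S lin_elem_basis D_poly_var app_D)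

lemma Phi_t: "Phi (HB_t k w) = weyl_act w"
  by (rule ext) (simp add: HB_t_def Phi_class HB_op_gen_W grp_op_grp)

lemma Phi_unique:
  fixes \<Psi> :: "'n::{finite,linorder} pre_HB set \<Rightarrow> 'n sym_alg \<Rightarrow> 'n sym_alg"
  assumes \<Psi>: "\<Psi> \<in> alg_hom (HB k) (DB k kc)"
    and eps: "\<And>j. \<Psi> (HB_eps k j) = D_op k kc j" and t: "\<And>w. \<Psi> (HB_t k w) = weyl_act w"
    and x: "x \<in> carrier (HB k)"
  shows "\<Psi> x = Phi x"
proof -
  let ?Phi = "Phi :: 'n pre_HB set \<Rightarrow> 'n sym_alg \<Rightarrow> 'n sym_alg"
  have hom: "\<Psi> \<in> ring_hom (HB k) (DB k kc)" "?Phi \<in> ring_hom (HB k) (DB k kc)"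
    and sm: "\<Psi> (c \<odot>\<^bsub>HB k\<^esub> HB_class k y) = c \<odot>\<^bsub>DB k kc\<^esub> \<Psi> (HB_class k y)"
      "?Phi (c \<odot>\<^bsub>HB k\<^esub> HB_class k y) = c \<odot>\<^bsub>DB k kc\<^esub> ?Phi (HB_class k y)" for c y
    using \<Psi> Phi_alg_iso by (auto simp: alg_iso_def alg_hom_def HB_simps(1))
  have cl: "HB_class k y \<in> carrier (HB k)" for y :: "'n pre_HB" by (simp add: HB_simps)
  have "\<Psi> (HB_class k y) = ?Phi (HB_class k y)" for y
  proof (induction y rule: HB_eq_generators[where k = k])
    case (scal c)
    have "\<Psi> (HB_class k 1) = ?Phi (HB_class k (1 :: 'n pre_HB))"
      using ring_hom_one[OF hom(1)] ring_hom_one[OF hom(2)] by (simp add: HB_simps)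
    then show ?case using sm[of c 1] by (simp add: HB_simps)
  next
    case (var j)
    then show ?case using eps[of j] Phi_eps[of j] by (simp add: HB_eps_def lin_elem_basis)
  next
    case (grp w)
    then show ?case using t[of w] Phi_t[of w] by (simp add: HB_t_def)
  next
    case (add y z)
    then show ?case
      using ring_hom_add[OF hom(1) cl cl, of y z] ring_hom_add[OF hom(2) cl cl, of y z] by (simp add: HB_simps)
  next
    case (mult y z)
    then show ?case
      using ring_hom_mult[OF hom(1) cl cl, of y z] ring_hom_mult[OF hom(2) cl cl, of y z] by (simp add: HB_simps)
  next
    case (cong y z)
    then show ?case using iffD2[OF HB_class_eq_iff cong(1)] by simp
  qed
  then show ?thesis using x by (auto simp: HB_simps)
qed

end

theorem mainTheorem3:
  fixes k kc :: complex
  assumes "CARD('n::{finite,linorder}) \<ge> 2" and "k \<noteq> 0"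
  shows "(\<exists>\<Phi> \<in> alg_iso (HB k :: (complex, 'n pre_HB set) module) (DB k kc).
            (\<forall>j. \<Phi> (HB_eps k j) = D_op k kc j) \<and>
            (\<forall>w. \<Phi> (HB_t k w) = weyl_act w) \<and>
            (\<forall>\<Psi> \<in> alg_hom (HB k) (DB k kc).
               (\<forall>j. \<Psi> (HB_eps k j) = D_op k kc j) \<longrightarrow> (\<forall>w. \<Psi> (HB_t k w) = weyl_act w) \<longrightarrow>
               (\<forall>x \<in> carrier (HB k). \<Psi> x = \<Phi> x))) \<and>
         (\<exists>\<theta>. \<theta> \<in> module_iso (type_ring :: 'n sym_alg ring)
            (tensor :: ('n sym_alg, (('n sym_alg \<times> 'n grp_alg) \<Rightarrow>\<^sub>0 complex) set) module)
            (HB_S_module k))"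
proof -
  interpret dunkl_parameters k kc .
  show ?thesis
    using Phi_alg_iso Phi_eps Phi_t Phi_unique tensor_iso_HB by blast
qed

end
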